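(* Let $\mathbf C$ be a $2$-category with tensors by the category $\mathbb 2=\{0\to 1\}$, and let $F\colon \mathbf C^{\mathrm{op}}\to \mathbf{Cat}$ be a normal pseudo-functor which preserves these tensors. The following statements are equivalent. (i) The normal pseudo-functor $F$ has a bi-representation $(I,\rho)$. (ii) There is an object $I\in\mathbf C$ together with an object $i\in FI$ such that $(I,i)$ is bi-initial in $\mathbf{el}(F)$.
   Context: **$2$-categories.** $\mathbf{Cat}$ is the $2$-category of categories, functors and natural transformations; $\mathbf C^{\mathrm{op}}$ reverses morphisms but not $2$-morphisms. A normal pseudo-functor $F\colon\mathbf A\to\mathbf B$ between (strict) $2$-categories consists of an assignment on objects, functors $\mathbf A(A,A')\to\mathbf B(FA,FA')$, and invertible compositors $\phi_{a,a'}\colon (Fa')(Fa)\Rightarrow F(a'a)$ satisfying the usual naturality, associativity and unit axioms, with all unitors identities (so $F\mathrm{id}_A=\mathrm{id}_{FA}$). $\mathbf{Ps}(\mathbf A,\mathbf B)$ is the $2$-category of normal pseudo-functors, pseudo-natural transformations (with invertible $2$-morphism components) and modifications. **Tensors.** A tensor of an object $C\in\mathbf C$ by a category $\mathcal A$ is a pair $(C\otimes\mathcal A,\zeta)$ of an object $C\otimes\mathcal A\in\mathbf C$ and a functor $\zeta\colon\mathcal A\to\mathbf C(C,C\otimes\mathcal A)$ such that for every $C'\in\mathbf C$ the functor $\mathbf C(C\otimes\mathcal A,C')\to\mathbf{Cat}(\mathcal A,\mathbf C(C,C'))$, $h\mapsto (h\circ-)\circ\zeta$, is an isomorphism of categories.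 $\mathbf C$ has tensors by $\mathcal A$ if every object has one. A tensor in $\mathbf C$ is a power in $\mathbf C^{\mathrm{op}}$, and powers in $\mathbf{Cat}$ are given by $\mathbf{Cat}(\mathcal A,-)$. The normal pseudo-functor $F\colon \mathbf C^{\mathrm{op}}\to\mathbf{Cat}$ preserves these tensors (i.e. preserves powers by $\mathcal A$) if for every $C\in\mathbf C$ there is an isomorphism of categories $F(C\otimes\mathcal A)\cong\mathbf{Cat}(\mathcal A,FC)$ which is natural with respect to the defining cones, i.e. it is compatible with the cone $\mathcal A\xrightarrow{\zeta}\mathbf C(C,C\otimes\mathcal A)\xrightarrow{F}\mathbf{Cat}(F(C\otimes\mathcal A),FC)$ and the evaluation cone of $\mathbf{Cat}(\mathcal A,FC)$. **Bi-representation.** A bi-representation of $F$ is a pair $(I,\rho)$ of an object $I\in\mathbf C$ and a pseudo-natural adjoint equivalence $\rho\colon \mathbf C(-,I)\Rightarrow F$, i.e. an adjoint equivalence in $\mathbf{Ps}(\mathbf C^{\mathrm{op}},\mathbf{Cat})$. **The $2$-category of elements** $\mathbf{el}(F)$ has objects $(C,x)$ with $C\in\mathbf C$, $x\in FC$; morphisms $(C',x')\to (C,x)$ pairs $(c,\psi)$ of a morphism $c\colon C\to C'$ of $\mathbf C$ and an isomorphism $\psi\colon x\cong (Fc)x'$ in $FC$ (composed using the compositors of $F$: $(c',\psi')\colon (C'',x'')\to(C',x')$ followed by $(c,\psi)$ is $c'c$ with $x\xrightarrow{\psi}(Fc)x'\xrightarrow{(Fc)\psi'}(Fc)(Fc')x''\cong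 F(c'c)x''$); $2$-morphisms $(c,\psi)\Rightarrow(d,\varphi)\colon (C',x')\to(C,x)$ the $2$-morphisms $\gamma\colon c\Rightarrow d$ of $\mathbf C$ with $\varphi=(F\gamma)_{x'}\circ\psi$. **Bi-initial object.** For an object $I$ of a $2$-category $\mathbf A$, the pseudo-slice $2$-category $I\downarrow\mathbf A$ has objects $(A,f\colon I\to A)$; morphisms $(A,f)\to(A',f')$ pairs $(a,\psi)$ of $a\colon A\to A'$ and an invertible $\psi\colon f'\Rightarrow af$; $2$-morphisms $(a,\psi)\Rightarrow(b,\varphi)$ the $2$-morphisms $\beta\colon a\Rightarrow b$ with $(\beta f)\circ\psi=\varphi$. A $2$-functor is a trivial fibration if it is surjective on objects, full on morphisms (every morphism $FA\to FA'$ is the image of some morphism $A\to A'$) and fully faithful on $2$-morphisms. $I$ is bi-initial if the projection $I\downarrow\mathbf A\to\mathbf A$ is a trivial fibration. *)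

theory Defs
  imports "HOL-Library.FuncSet"
begin

section \<open>Categories, functors, natural transformations\<close>

record ('o, 'a) cat =
  Ob :: "'o set"
  Ar :: "'a set"
  Dom :: "'a \<Rightarrow> 'o"
  Cod :: "'a \<Rightarrow> 'o"
  Ide :: "'o \<Rightarrow> 'a"
  Comp :: "'a \<Rightarrow> 'a \<Rightarrow> 'a"

definition hom :: "('o, 'a) cat \<Rightarrow> 'o \<Rightarrow> 'o \<Rightarrow> 'a set" where
  "hom A x y = {f \<in> Ar A. Dom A f = x \<and> Cod A f = y}"

locale category =
  fixes A :: "('o, 'a) cat"
  assumes dom_closed: "f \<in> Ar A \<Longrightarrow> Dom A f \<in> Ob A"
    and cod_closed: "f \<in> Ar A \<Longrightarrow> Cod A f \<in> Ob A"
    and ide_closed: "x \<in> Ob A \<Longrightarrow> Ide A x \<in> hom A x x"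
    and comp_closed: "f \<in> hom A x y \<Longrightarrow> g \<in> hom A y z \<Longrightarrow> Comp A g f \<in> hom A x z"
    and comp_ide: "f \<in> hom A x y \<Longrightarrow> Comp A f (Ide A x) = f"
    and ide_comp: "f \<in> hom A x y \<Longrightarrow> Comp A (Ide A y) f = f"
    and comp_assoc: "f \<in> hom A w x \<Longrightarrow> g \<in> hom A x y \<Longrightarrow> h \<in> hom A y z \<Longrightarrow>
      Comp A (Comp A h g) f = Comp A h (Comp A g f)"

definition iso_in :: "('o, 'a) cat \<Rightarrow> 'o \<Rightarrow> 'o \<Rightarrow> 'a \<Rightarrow> bool" where
  "iso_in A x y f \<longleftrightarrow> f \<in> hom A x y \<and>
     (\<exists>g \<in> hom A y x. Comp A g f = Ide A x \<and> Comp A f g = Ide A y)"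

text \<open>Functors and natural transformations are extensional (fixed to \<^term>\<open>undefined\<close> off the
  carriers of their domain), so that HOL equality is equality of functors and of transformations.\<close>

record ('o, 'a, 'p, 'b) ftr =
  FOb :: "'o \<Rightarrow> 'p"
  FAr :: "'a \<Rightarrow> 'b"

locale cat_functor =
  fixes A :: "('o, 'a) cat" and B :: "('p, 'b) cat" and F :: "('o, 'a, 'p, 'b) ftr"
  assumes fob_closed: "x \<in> Ob A \<Longrightarrow> FOb F x \<in> Ob B"
    and far_closed: "f \<in> hom A x y \<Longrightarrow> FAr F f \<in> hom B (FOb F x) (FOb F y)"
    and far_ide: "x \<in> Ob A \<Longrightarrow> FAr F (Ide A x) = Ide B (FOb F x)"
    and far_comp: "f \<in> hom A x y \<Longrightarrow> g \<in> hom A y z \<Longrightarrow>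
      FAr F (Comp A g f) = Comp B (FAr F g) (FAr F f)"
    and fob_ext: "FOb F \<in> extensional (Ob A)"
    and far_ext: "FAr F \<in> extensional (Ar A)"

definition id_ftr :: "('o, 'a) cat \<Rightarrow> ('o, 'a, 'o, 'a) ftr" where
  "id_ftr A = \<lparr>FOb = (\<lambda>x\<in>Ob A. x), FAr = (\<lambda>f\<in>Ar A. f)\<rparr>"

definition comp_ftr ::
  "('o, 'a) cat \<Rightarrow> ('p, 'b, 'q, 'c) ftr \<Rightarrow> ('o, 'a, 'p, 'b) ftr \<Rightarrow> ('o, 'a, 'q, 'c) ftr" where
  "comp_ftr A G F = \<lparr>FOb = (\<lambda>x\<in>Ob A. FOb G (FOb F x)), FAr = (\<lambda>f\<in>Ar A. FAr G (FAr F f))\<rparr>"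

definition cat_iso :: "('o, 'a) cat \<Rightarrow> ('p, 'b) cat \<Rightarrow> ('o, 'a, 'p, 'b) ftr \<Rightarrow> bool" where
  "cat_iso A B F \<longleftrightarrow> cat_functor A B F \<and>
     (\<exists>G. cat_functor B A G \<and> comp_ftr A G F = id_ftr A \<and> comp_ftr B F G = id_ftr B)"

record ('o, 'a, 'p, 'b) ntr =
  NDom :: "('o, 'a, 'p, 'b) ftr"
  NCod :: "('o, 'a, 'p, 'b) ftr"
  NAt :: "'o \<Rightarrow> 'b"

locale nat_trans =
  fixes A :: "('o, 'a) cat" and B :: "('p, 'b) cat" and \<alpha> :: "('o, 'a, 'p, 'b) ntr"
  assumes ndom: "cat_functor A B (NDom \<alpha>)"
    and ncod: "cat_functor A B (NCod \<alpha>)"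
    and nat_closed: "x \<in> Ob A \<Longrightarrow> NAt \<alpha> x \<in> hom B (FOb (NDom \<alpha>) x) (FOb (NCod \<alpha>) x)"
    and naturality: "f \<in> hom A x y \<Longrightarrow>
      Comp B (NAt \<alpha> y) (FAr (NDom \<alpha>) f) = Comp B (FAr (NCod \<alpha>) f) (NAt \<alpha> x)"
    and nat_ext: "NAt \<alpha> \<in> extensional (Ob A)"

definition functor_cat ::
  "('o, 'a) cat \<Rightarrow> ('p, 'b) cat \<Rightarrow> (('o, 'a, 'p, 'b) ftr, ('o, 'a, 'p, 'b) ntr) cat" where
  "functor_cat A B = \<lparr>
     Ob = {F. cat_functor A B F},
     Ar = {\<alpha>. nat_trans A B \<alpha>},
     Dom = NDom,
     Cod = NCod,
     Ide = (\<lambda>F. \<lparr>NDom = F, NCod = F, NAt = (\<lambda>x\<in>Ob A. Ide B (FOb F x))\<rparr>),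
     Comp = (\<lambda>\<beta> \<alpha>. \<lparr>NDom = NDom \<alpha>, NCod = NCod \<beta>,
                      NAt = (\<lambda>x\<in>Ob A. Comp B (NAt \<beta> x) (NAt \<alpha> x))\<rparr>)\<rparr>"

text \<open>For \<open>\<alpha> : F \<Rightarrow> F'\<close> between functors \<open>A \<rightarrow> B\<close> and \<open>\<beta> : G \<Rightarrow> G'\<close> between functors \<open>B \<rightarrow> C\<close>,
  \<open>hcomp_nat A C \<beta> \<alpha> : G F \<Rightarrow> G' F'\<close> is the horizontal composite.\<close>

definition hcomp_nat ::
  "('o, 'a) cat \<Rightarrow> ('q, 'c) cat \<Rightarrow> ('p, 'b, 'q, 'c) ntr \<Rightarrow> ('o, 'a, 'p, 'b) ntr
    \<Rightarrow> ('o, 'a, 'q, 'c) ntr" where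
  "hcomp_nat A C \<beta> \<alpha> = \<lparr>
     NDom = comp_ftr A (NDom \<beta>) (NDom \<alpha>),
     NCod = comp_ftr A (NCod \<beta>) (NCod \<alpha>),
     NAt = (\<lambda>x\<in>Ob A. Comp C (NAt \<beta> (FOb (NCod \<alpha>) x)) (FAr (NDom \<beta>) (NAt \<alpha> x)))\<rparr>"

text \<open>The category \<open>0 \<rightarrow> 1\<close>; its objects are \<open>False\<close> and \<open>True\<close>.\<close>

definition arrow_cat :: "(bool, bool \<times> bool) cat" where
  "arrow_cat = \<lparr>Ob = UNIV, Ar = {(a, b). a \<le> b}, Dom = fst, Cod = snd,
     Ide = (\<lambda>a. (a, a)), Comp = (\<lambda>g f. (fst f, snd g))\<rparr>"

section \<open>Strict 2-categories\<close>

text \<open>Hom-categories are not required to be disjoint, so horizontal composition is indexed: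
  for \<open>f : X \<rightarrow> Y\<close> and \<open>g : Y \<rightarrow> Z\<close>, \<open>HC1 K X Y Z g f\<close> is \<open>g f : X \<rightarrow> Z\<close>, and
  \<open>HC2 K X Y Z \<beta> \<alpha>\<close> is the corresponding operation on 2-morphisms.\<close>

record ('o, 'm, 't) twocat =
  Obj :: "'o set"
  Hom :: "'o \<Rightarrow> 'o \<Rightarrow> ('m, 't) cat"
  One :: "'o \<Rightarrow> 'm"
  HC1 :: "'o \<Rightarrow> 'o \<Rightarrow> 'o \<Rightarrow> 'm \<Rightarrow> 'm \<Rightarrow> 'm"
  HC2 :: "'o \<Rightarrow> 'o \<Rightarrow> 'o \<Rightarrow> 't \<Rightarrow> 't \<Rightarrow> 't"

locale two_category =
  fixes K :: "('o, 'm, 't) twocat"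
  assumes hom_category: "X \<in> Obj K \<Longrightarrow> Y \<in> Obj K \<Longrightarrow> category (Hom K X Y)"
    and one_closed: "X \<in> Obj K \<Longrightarrow> One K X \<in> Ob (Hom K X X)"
    and hc1_closed: "X \<in> Obj K \<Longrightarrow> Y \<in> Obj K \<Longrightarrow> Z \<in> Obj K \<Longrightarrow>
      f \<in> Ob (Hom K X Y) \<Longrightarrow> g \<in> Ob (Hom K Y Z) \<Longrightarrow> HC1 K X Y Z g f \<in> Ob (Hom K X Z)"
    and hc2_closed: "X \<in> Obj K \<Longrightarrow> Y \<in> Obj K \<Longrightarrow> Z \<in> Obj K \<Longrightarrow>
      \<alpha> \<in> hom (Hom K X Y) f f' \<Longrightarrow> \<beta> \<in> hom (Hom K Y Z) g g' \<Longrightarrow>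
      HC2 K X Y Z \<beta> \<alpha> \<in> hom (Hom K X Z) (HC1 K X Y Z g f) (HC1 K X Y Z g' f')"
    and hc2_ide: "X \<in> Obj K \<Longrightarrow> Y \<in> Obj K \<Longrightarrow> Z \<in> Obj K \<Longrightarrow>
      f \<in> Ob (Hom K X Y) \<Longrightarrow> g \<in> Ob (Hom K Y Z) \<Longrightarrow>
      HC2 K X Y Z (Ide (Hom K Y Z) g) (Ide (Hom K X Y) f) = Ide (Hom K X Z) (HC1 K X Y Z g f)"
    and interchange: "X \<in> Obj K \<Longrightarrow> Y \<in> Obj K \<Longrightarrow> Z \<in> Obj K \<Longrightarrow>
      \<alpha> \<in> hom (Hom K X Y) f f' \<Longrightarrow> \<alpha>' \<in> hom (Hom K X Y) f' f'' \<Longrightarrow>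
      \<beta> \<in> hom (Hom K Y Z) g g' \<Longrightarrow> \<beta>' \<in> hom (Hom K Y Z) g' g'' \<Longrightarrow>
      HC2 K X Y Z (Comp (Hom K Y Z) \<beta>' \<beta>) (Comp (Hom K X Y) \<alpha>' \<alpha>)
        = Comp (Hom K X Z) (HC2 K X Y Z \<beta>' \<alpha>') (HC2 K X Y Z \<beta> \<alpha>)"
    and hc1_assoc: "W \<in> Obj K \<Longrightarrow> X \<in> Obj K \<Longrightarrow> Y \<in> Obj K \<Longrightarrow> Z \<in> Obj K \<Longrightarrow>
      f \<in> Ob (Hom K W X) \<Longrightarrow> g \<in> Ob (Hom K X Y) \<Longrightarrow> h \<in> Ob (Hom K Y Z) \<Longrightarrow>
      HC1 K W X Z (HC1 K X Y Z h g) f = HC1 K W Y Z h (HC1 K W X Y g f)"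
    and hc2_assoc: "W \<in> Obj K \<Longrightarrow> X \<in> Obj K \<Longrightarrow> Y \<in> Obj K \<Longrightarrow> Z \<in> Obj K \<Longrightarrow>
      \<alpha> \<in> Ar (Hom K W X) \<Longrightarrow> \<beta> \<in> Ar (Hom K X Y) \<Longrightarrow> \<gamma> \<in> Ar (Hom K Y Z) \<Longrightarrow>
      HC2 K W X Z (HC2 K X Y Z \<gamma> \<beta>) \<alpha> = HC2 K W Y Z \<gamma> (HC2 K W X Y \<beta> \<alpha>)"
    and hc1_one: "X \<in> Obj K \<Longrightarrow> Y \<in> Obj K \<Longrightarrow> f \<in> Ob (Hom K X Y) \<Longrightarrow>
      HC1 K X X Y f (One K X) = f"
    and one_hc1: "X \<in> Obj K \<Longrightarrow> Y \<in> Obj K \<Longrightarrow> f \<in> Ob (Hom K X Y) \<Longrightarrow>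
      HC1 K X Y Y (One K Y) f = f"
    and hc2_one: "X \<in> Obj K \<Longrightarrow> Y \<in> Obj K \<Longrightarrow> \<alpha> \<in> Ar (Hom K X Y) \<Longrightarrow>
      HC2 K X X Y \<alpha> (Ide (Hom K X X) (One K X)) = \<alpha>"
    and one_hc2: "X \<in> Obj K \<Longrightarrow> Y \<in> Obj K \<Longrightarrow> \<alpha> \<in> Ar (Hom K X Y) \<Longrightarrow>
      HC2 K X Y Y (Ide (Hom K Y Y) (One K Y)) \<alpha> = \<alpha>"

text \<open>Whiskerings: \<open>lwh K X Y Z g \<alpha>\<close> is \<open>g \<alpha>\<close> for \<open>g : Y \<rightarrow> Z\<close> and \<open>\<alpha>\<close> a 2-morphism in
  \<open>Hom K X Y\<close>; \<open>rwh K X Y Z \<beta> f\<close> is \<open>\<beta> f\<close> for \<open>f : X \<rightarrow> Y\<close> and \<open>\<beta>\<close> in \<open>Hom K Y Z\<close>.\<close>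

definition lwh :: "('o, 'm, 't) twocat \<Rightarrow> 'o \<Rightarrow> 'o \<Rightarrow> 'o \<Rightarrow> 'm \<Rightarrow> 't \<Rightarrow> 't" where
  "lwh K X Y Z g \<alpha> = HC2 K X Y Z (Ide (Hom K Y Z) g) \<alpha>"

definition rwh :: "('o, 'm, 't) twocat \<Rightarrow> 'o \<Rightarrow> 'o \<Rightarrow> 'o \<Rightarrow> 't \<Rightarrow> 'm \<Rightarrow> 't" where
  "rwh K X Y Z \<beta> f = HC2 K X Y Z \<beta> (Ide (Hom K X Y) f)"

definition op2 :: "('o, 'm, 't) twocat \<Rightarrow> ('o, 'm, 't) twocat" where
  "op2 K = \<lparr>Obj = Obj K,
     Hom = (\<lambda>X Y. Hom K Y X),
     One = One K,
     HC1 = (\<lambda>X Y Z g f. HC1 K Z Y X f g),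
     HC2 = (\<lambda>X Y Z \<beta> \<alpha>. HC2 K Z Y X \<alpha> \<beta>)\<rparr>"

text \<open>The type parameters of \<open>Cat\<close> play the role of the universe: its objects are the categories
  with objects in \<^typ>\<open>'o\<close> and arrows in \<^typ>\<open>'a\<close>, carriers being arbitrary subsets.\<close>

definition Cat :: "(('o, 'a) cat, ('o, 'a, 'o, 'a) ftr, ('o, 'a, 'o, 'a) ntr) twocat" where
  "Cat = \<lparr>Obj = {A. category A},
     Hom = functor_cat,
     One = id_ftr,
     HC1 = (\<lambda>A B C G F. comp_ftr A G F),
     HC2 = (\<lambda>A B C \<beta> \<alpha>. hcomp_nat A C \<beta> \<alpha>)\<rparr>"

definition adjoint_equivalence :: "('o, 'm, 't) twocat \<Rightarrow> 'o \<Rightarrow> 'o \<Rightarrow> 'm \<Rightarrow> bool" where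
  "adjoint_equivalence K X Y f \<longleftrightarrow> X \<in> Obj K \<and> Y \<in> Obj K \<and> f \<in> Ob (Hom K X Y) \<and>
     (\<exists>g \<in> Ob (Hom K Y X). \<exists>\<eta> \<epsilon>.
        iso_in (Hom K X X) (One K X) (HC1 K X Y X g f) \<eta> \<and>
        iso_in (Hom K Y Y) (HC1 K Y X Y f g) (One K Y) \<epsilon> \<and>
        Comp (Hom K X Y) (rwh K X Y Y \<epsilon> f) (lwh K X X Y f \<eta>) = Ide (Hom K X Y) f \<and>
        Comp (Hom K Y X) (lwh K Y Y X g \<epsilon>) (rwh K Y X X \<eta> g) = Ide (Hom K Y X) g)"

section \<open>2-functors and trivial fibrations\<close>

record ('o, 'm, 't, 'p, 'n, 's) tfun =
  TO :: "'o \<Rightarrow> 'p"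
  TF :: "'o \<Rightarrow> 'o \<Rightarrow> ('m, 't, 'n, 's) ftr"

locale two_functor =
  fixes A :: "('o, 'm, 't) twocat" and B :: "('p, 'n, 's) twocat"
    and P :: "('o, 'm, 't, 'p, 'n, 's) tfun"
  assumes to_closed: "X \<in> Obj A \<Longrightarrow> TO P X \<in> Obj B"
    and tf_functor: "X \<in> Obj A \<Longrightarrow> Y \<in> Obj A \<Longrightarrow>
      cat_functor (Hom A X Y) (Hom B (TO P X) (TO P Y)) (TF P X Y)"
    and tf_one: "X \<in> Obj A \<Longrightarrow> FOb (TF P X X) (One A X) = One B (TO P X)"
    and tf_hc1: "X \<in> Obj A \<Longrightarrow> Y \<in> Obj A \<Longrightarrow> Z \<in> Obj A \<Longrightarrow>
      f \<in> Ob (Hom A X Y) \<Longrightarrow> g \<in> Ob (Hom A Y Z) \<Longrightarrow>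
      FOb (TF P X Z) (HC1 A X Y Z g f)
        = HC1 B (TO P X) (TO P Y) (TO P Z) (FOb (TF P Y Z) g) (FOb (TF P X Y) f)"
    and tf_hc2: "X \<in> Obj A \<Longrightarrow> Y \<in> Obj A \<Longrightarrow> Z \<in> Obj A \<Longrightarrow>
      \<alpha> \<in> Ar (Hom A X Y) \<Longrightarrow> \<beta> \<in> Ar (Hom A Y Z) \<Longrightarrow>
      FAr (TF P X Z) (HC2 A X Y Z \<beta> \<alpha>)
        = HC2 B (TO P X) (TO P Y) (TO P Z) (FAr (TF P Y Z) \<beta>) (FAr (TF P X Y) \<alpha>)"

definition trivial_fibration ::
  "('o, 'm, 't) twocat \<Rightarrow> ('p, 'n, 's) twocat \<Rightarrow> ('o, 'm, 't, 'p, 'n, 's) tfun \<Rightarrow> bool" where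
  "trivial_fibration A B P \<longleftrightarrow> two_functor A B P \<and>
     (\<forall>Y \<in> Obj B. \<exists>X \<in> Obj A. TO P X = Y) \<and>
     (\<forall>X \<in> Obj A. \<forall>Y \<in> Obj A. \<forall>g \<in> Ob (Hom B (TO P X) (TO P Y)).
        \<exists>f \<in> Ob (Hom A X Y). FOb (TF P X Y) f = g) \<and>
     (\<forall>X \<in> Obj A. \<forall>Y \<in> Obj A. \<forall>f \<in> Ob (Hom A X Y). \<forall>g \<in> Ob (Hom A X Y).
        bij_betw (FAr (TF P X Y)) (hom (Hom A X Y) f g)
          (hom (Hom B (TO P X) (TO P Y)) (FOb (TF P X Y) f) (FOb (TF P X Y) g)))"

section \<open>Normal pseudo-functors and the 2-category they form\<close>

text \<open>\<open>PC F X Y Z b a\<close> is the compositor \<open>(F b) (F a) \<Rightarrow> F (b a)\<close> for \<open>a : X \<rightarrow> Y\<close>, \<open>b : Y \<rightarrow> Z\<close>.\<close>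

record ('o, 'm, 't, 'p, 'n, 's) psf =
  PO :: "'o \<Rightarrow> 'p"
  PF :: "'o \<Rightarrow> 'o \<Rightarrow> ('m, 't, 'n, 's) ftr"
  PC :: "'o \<Rightarrow> 'o \<Rightarrow> 'o \<Rightarrow> 'm \<Rightarrow> 'm \<Rightarrow> 's"

locale normal_pseudo_functor =
  fixes A :: "('o, 'm, 't) twocat" and B :: "('p, 'n, 's) twocat"
    and F :: "('o, 'm, 't, 'p, 'n, 's) psf"
  assumes po_closed: "X \<in> Obj A \<Longrightarrow> PO F X \<in> Obj B"
    and pf_functor: "X \<in> Obj A \<Longrightarrow> Y \<in> Obj A \<Longrightarrow>
      cat_functor (Hom A X Y) (Hom B (PO F X) (PO F Y)) (PF F X Y)"
    and pf_one: "X \<in> Obj A \<Longrightarrow> FOb (PF F X X) (One A X) = One B (PO F X)"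
    and pc_iso: "X \<in> Obj A \<Longrightarrow> Y \<in> Obj A \<Longrightarrow> Z \<in> Obj A \<Longrightarrow>
      a \<in> Ob (Hom A X Y) \<Longrightarrow> b \<in> Ob (Hom A Y Z) \<Longrightarrow>
      iso_in (Hom B (PO F X) (PO F Z))
        (HC1 B (PO F X) (PO F Y) (PO F Z) (FOb (PF F Y Z) b) (FOb (PF F X Y) a))
        (FOb (PF F X Z) (HC1 A X Y Z b a)) (PC F X Y Z b a)"
    and pc_natural: "X \<in> Obj A \<Longrightarrow> Y \<in> Obj A \<Longrightarrow> Z \<in> Obj A \<Longrightarrow>
      \<alpha> \<in> hom (Hom A X Y) a a' \<Longrightarrow> \<beta> \<in> hom (Hom A Y Z) b b' \<Longrightarrow>
      Comp (Hom B (PO F X) (PO F Z)) (FAr (PF F X Z) (HC2 A X Y Z \<beta> \<alpha>)) (PC F X Y Z b a)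
        = Comp (Hom B (PO F X) (PO F Z)) (PC F X Y Z b' a')
            (HC2 B (PO F X) (PO F Y) (PO F Z) (FAr (PF F Y Z) \<beta>) (FAr (PF F X Y) \<alpha>))"
    and pc_assoc: "W \<in> Obj A \<Longrightarrow> X \<in> Obj A \<Longrightarrow> Y \<in> Obj A \<Longrightarrow> Z \<in> Obj A \<Longrightarrow>
      a \<in> Ob (Hom A W X) \<Longrightarrow> b \<in> Ob (Hom A X Y) \<Longrightarrow> c \<in> Ob (Hom A Y Z) \<Longrightarrow>
      Comp (Hom B (PO F W) (PO F Z)) (PC F W X Z (HC1 A X Y Z c b) a)
          (rwh B (PO F W) (PO F X) (PO F Z) (PC F X Y Z c b) (FOb (PF F W X) a))
        = Comp (Hom B (PO F W) (PO F Z)) (PC F W Y Z c (HC1 A W X Y b a))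
          (lwh B (PO F W) (PO F Y) (PO F Z) (FOb (PF F Y Z) c) (PC F W X Y b a))"
    and pc_one: "X \<in> Obj A \<Longrightarrow> Y \<in> Obj A \<Longrightarrow> a \<in> Ob (Hom A X Y) \<Longrightarrow>
      PC F X X Y a (One A X) = Ide (Hom B (PO F X) (PO F Y)) (FOb (PF F X Y) a)"
    and one_pc: "X \<in> Obj A \<Longrightarrow> Y \<in> Obj A \<Longrightarrow> a \<in> Ob (Hom A X Y) \<Longrightarrow>
      PC F X Y Y (One A Y) a = Ide (Hom B (PO F X) (PO F Y)) (FOb (PF F X Y) a)"

text \<open>For a pseudo-natural transformation \<open>\<sigma> : F \<Rightarrow> G\<close> the 2-morphism component at \<open>a : X \<rightarrow> Y\<close> is
  \<open>SAr \<sigma> X Y a : (G a) (SOb \<sigma> X) \<Rightarrow> (SOb \<sigma> Y) (F a)\<close>.\<close>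

record ('o, 'm, 'n, 's) pnt =
  SOb :: "'o \<Rightarrow> 'n"
  SAr :: "'o \<Rightarrow> 'o \<Rightarrow> 'm \<Rightarrow> 's"

locale pseudo_natural =
  fixes A :: "('o, 'm, 't) twocat" and B :: "('p, 'n, 's) twocat"
    and F G :: "('o, 'm, 't, 'p, 'n, 's) psf" and \<sigma> :: "('o, 'm, 'n, 's) pnt"
  assumes sob_closed: "X \<in> Obj A \<Longrightarrow> SOb \<sigma> X \<in> Ob (Hom B (PO F X) (PO G X))"
    and sar_iso: "X \<in> Obj A \<Longrightarrow> Y \<in> Obj A \<Longrightarrow> a \<in> Ob (Hom A X Y) \<Longrightarrow>
      iso_in (Hom B (PO F X) (PO G Y))
        (HC1 B (PO F X) (PO G X) (PO G Y) (FOb (PF G X Y) a) (SOb \<sigma> X))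
        (HC1 B (PO F X) (PO F Y) (PO G Y) (SOb \<sigma> Y) (FOb (PF F X Y) a)) (SAr \<sigma> X Y a)"
    and sar_natural: "X \<in> Obj A \<Longrightarrow> Y \<in> Obj A \<Longrightarrow> \<alpha> \<in> hom (Hom A X Y) a b \<Longrightarrow>
      Comp (Hom B (PO F X) (PO G Y)) (SAr \<sigma> X Y b)
          (rwh B (PO F X) (PO G X) (PO G Y) (FAr (PF G X Y) \<alpha>) (SOb \<sigma> X))
        = Comp (Hom B (PO F X) (PO G Y))
          (lwh B (PO F X) (PO F Y) (PO G Y) (SOb \<sigma> Y) (FAr (PF F X Y) \<alpha>)) (SAr \<sigma> X Y a)"
    and sar_one: "X \<in> Obj A \<Longrightarrow>
      SAr \<sigma> X X (One A X) = Ide (Hom B (PO F X) (PO G X)) (SOb \<sigma> X)"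
    and sar_comp: "X \<in> Obj A \<Longrightarrow> Y \<in> Obj A \<Longrightarrow> Z \<in> Obj A \<Longrightarrow>
      a \<in> Ob (Hom A X Y) \<Longrightarrow> b \<in> Ob (Hom A Y Z) \<Longrightarrow>
      Comp (Hom B (PO F X) (PO G Z)) (SAr \<sigma> X Z (HC1 A X Y Z b a))
          (rwh B (PO F X) (PO G X) (PO G Z) (PC G X Y Z b a) (SOb \<sigma> X))
        = Comp (Hom B (PO F X) (PO G Z))
            (lwh B (PO F X) (PO F Z) (PO G Z) (SOb \<sigma> Z) (PC F X Y Z b a))
            (Comp (Hom B (PO F X) (PO G Z))
              (rwh B (PO F X) (PO F Y) (PO G Z) (SAr \<sigma> Y Z b) (FOb (PF F X Y) a))
              (lwh B (PO F X) (PO G Y) (PO G Z) (FOb (PF G Y Z) b) (SAr \<sigma> X Y a)))"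
    and sob_ext: "SOb \<sigma> \<in> extensional (Obj A)"
    and sar_ext: "\<not> (X \<in> Obj A \<and> Y \<in> Obj A \<and> a \<in> Ob (Hom A X Y)) \<Longrightarrow> SAr \<sigma> X Y a = undefined"

record ('o, 'm, 'n, 's) mdf =
  MDom :: "('o, 'm, 'n, 's) pnt"
  MCod :: "('o, 'm, 'n, 's) pnt"
  MAt :: "'o \<Rightarrow> 's"

locale modification =
  fixes A :: "('o, 'm, 't) twocat" and B :: "('p, 'n, 's) twocat"
    and F G :: "('o, 'm, 't, 'p, 'n, 's) psf" and \<Gamma> :: "('o, 'm, 'n, 's) mdf"
  assumes mdom: "pseudo_natural A B F G (MDom \<Gamma>)"
    and mcod: "pseudo_natural A B F G (MCod \<Gamma>)"
    and mat_closed: "X \<in> Obj A \<Longrightarrow>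
      MAt \<Gamma> X \<in> hom (Hom B (PO F X) (PO G X)) (SOb (MDom \<Gamma>) X) (SOb (MCod \<Gamma>) X)"
    and mat_natural: "X \<in> Obj A \<Longrightarrow> Y \<in> Obj A \<Longrightarrow> a \<in> Ob (Hom A X Y) \<Longrightarrow>
      Comp (Hom B (PO F X) (PO G Y)) (SAr (MCod \<Gamma>) X Y a)
          (lwh B (PO F X) (PO G X) (PO G Y) (FOb (PF G X Y) a) (MAt \<Gamma> X))
        = Comp (Hom B (PO F X) (PO G Y))
          (rwh B (PO F X) (PO F Y) (PO G Y) (MAt \<Gamma> Y) (FOb (PF F X Y) a)) (SAr (MDom \<Gamma>) X Y a)"
    and mat_ext: "MAt \<Gamma> \<in> extensional (Obj A)"

definition pnt_cat ::
  "('o, 'm, 't) twocat \<Rightarrow> ('p, 'n, 's) twocat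
    \<Rightarrow> ('o, 'm, 't, 'p, 'n, 's) psf \<Rightarrow> ('o, 'm, 't, 'p, 'n, 's) psf
    \<Rightarrow> (('o, 'm, 'n, 's) pnt, ('o, 'm, 'n, 's) mdf) cat" where
  "pnt_cat A B F G = \<lparr>
     Ob = {\<sigma>. pseudo_natural A B F G \<sigma>},
     Ar = {\<Gamma>. modification A B F G \<Gamma>},
     Dom = MDom,
     Cod = MCod,
     Ide = (\<lambda>\<sigma>. \<lparr>MDom = \<sigma>, MCod = \<sigma>,
                  MAt = (\<lambda>X\<in>Obj A. Ide (Hom B (PO F X) (PO G X)) (SOb \<sigma> X))\<rparr>),
     Comp = (\<lambda>\<Delta> \<Gamma>. \<lparr>MDom = MDom \<Gamma>, MCod = MCod \<Delta>,
                  MAt = (\<lambda>X\<in>Obj A. Comp (Hom B (PO F X) (PO G X)) (MAt \<Delta> X) (MAt \<Gamma> X))\<rparr>)\<rparr>"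

definition id_pnt ::
  "('o, 'm, 't) twocat \<Rightarrow> ('p, 'n, 's) twocat \<Rightarrow> ('o, 'm, 't, 'p, 'n, 's) psf
    \<Rightarrow> ('o, 'm, 'n, 's) pnt" where
  "id_pnt A B F = \<lparr>
     SOb = (\<lambda>X\<in>Obj A. One B (PO F X)),
     SAr = (\<lambda>X Y a. if X \<in> Obj A \<and> Y \<in> Obj A \<and> a \<in> Ob (Hom A X Y)
             then Ide (Hom B (PO F X) (PO F Y)) (FOb (PF F X Y) a) else undefined)\<rparr>"

text \<open>The composite of \<open>\<sigma> : F \<Rightarrow> G\<close> and \<open>\<tau> : G \<Rightarrow> H\<close>; its component at \<open>a : X \<rightarrow> Y\<close> is
  \<open>(H a) \<tau>\<^sub>X \<sigma>\<^sub>X \<Rightarrow> \<tau>\<^sub>Y (G a) \<sigma>\<^sub>X \<Rightarrow> \<tau>\<^sub>Y \<sigma>\<^sub>Y (F a)\<close>.\<close>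

definition comp_pnt ::
  "('o, 'm, 't) twocat \<Rightarrow> ('p, 'n, 's) twocat
    \<Rightarrow> ('o, 'm, 't, 'p, 'n, 's) psf \<Rightarrow> ('o, 'm, 't, 'p, 'n, 's) psf
    \<Rightarrow> ('o, 'm, 't, 'p, 'n, 's) psf
    \<Rightarrow> ('o, 'm, 'n, 's) pnt \<Rightarrow> ('o, 'm, 'n, 's) pnt \<Rightarrow> ('o, 'm, 'n, 's) pnt" where
  "comp_pnt A B F G H \<tau> \<sigma> = \<lparr>
     SOb = (\<lambda>X\<in>Obj A. HC1 B (PO F X) (PO G X) (PO H X) (SOb \<tau> X) (SOb \<sigma> X)),
     SAr = (\<lambda>X Y a. if X \<in> Obj A \<and> Y \<in> Obj A \<and> a \<in> Ob (Hom A X Y)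
             then Comp (Hom B (PO F X) (PO H Y))
               (lwh B (PO F X) (PO G Y) (PO H Y) (SOb \<tau> Y) (SAr \<sigma> X Y a))
               (rwh B (PO F X) (PO G X) (PO H Y) (SAr \<tau> X Y a) (SOb \<sigma> X))
             else undefined)\<rparr>"

definition hcomp_mdf ::
  "('o, 'm, 't) twocat \<Rightarrow> ('p, 'n, 's) twocat
    \<Rightarrow> ('o, 'm, 't, 'p, 'n, 's) psf \<Rightarrow> ('o, 'm, 't, 'p, 'n, 's) psf
    \<Rightarrow> ('o, 'm, 't, 'p, 'n, 's) psf
    \<Rightarrow> ('o, 'm, 'n, 's) mdf \<Rightarrow> ('o, 'm, 'n, 's) mdf \<Rightarrow> ('o, 'm, 'n, 's) mdf" where
  "hcomp_mdf A B F G H \<Delta> \<Gamma> = \<lparr>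
     MDom = comp_pnt A B F G H (MDom \<Delta>) (MDom \<Gamma>),
     MCod = comp_pnt A B F G H (MCod \<Delta>) (MCod \<Gamma>),
     MAt = (\<lambda>X\<in>Obj A. HC2 B (PO F X) (PO G X) (PO H X) (MAt \<Delta> X) (MAt \<Gamma> X))\<rparr>"

definition Ps ::
  "('o, 'm, 't) twocat \<Rightarrow> ('p, 'n, 's) twocat
    \<Rightarrow> (('o, 'm, 't, 'p, 'n, 's) psf, ('o, 'm, 'n, 's) pnt, ('o, 'm, 'n, 's) mdf) twocat" where
  "Ps A B = \<lparr>
     Obj = {F. normal_pseudo_functor A B F},
     Hom = pnt_cat A B,
     One = id_pnt A B,
     HC1 = comp_pnt A B,
     HC2 = hcomp_mdf A B\<rparr>"

section \<open>Tensors and their preservation\<close>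

text \<open>The functor \<open>Hom K T Y \<rightarrow> Cat(A, Hom K X Y)\<close>, \<open>h \<mapsto> (h \<circ> -) \<circ> \<zeta>\<close>.\<close>

definition tensor_ob ::
  "('o, 'm, 't) twocat \<Rightarrow> ('p, 'b) cat \<Rightarrow> 'o \<Rightarrow> 'o \<Rightarrow> ('p, 'b, 'm, 't) ftr \<Rightarrow> 'o \<Rightarrow> 'm
    \<Rightarrow> ('p, 'b, 'm, 't) ftr" where
  "tensor_ob K A X T \<zeta> Y h = \<lparr>
     FOb = (\<lambda>a\<in>Ob A. HC1 K X T Y h (FOb \<zeta> a)),
     FAr = (\<lambda>u\<in>Ar A. lwh K X T Y h (FAr \<zeta> u))\<rparr>"

definition tensor_comparison ::
  "('o, 'm, 't) twocat \<Rightarrow> ('p, 'b) cat \<Rightarrow> 'o \<Rightarrow> 'o \<Rightarrow> ('p, 'b, 'm, 't) ftr \<Rightarrow> 'o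
    \<Rightarrow> ('m, 't, ('p, 'b, 'm, 't) ftr, ('p, 'b, 'm, 't) ntr) ftr" where
  "tensor_comparison K A X T \<zeta> Y = \<lparr>
     FOb = (\<lambda>h\<in>Ob (Hom K T Y). tensor_ob K A X T \<zeta> Y h),
     FAr = (\<lambda>\<theta>\<in>Ar (Hom K T Y). \<lparr>
       NDom = tensor_ob K A X T \<zeta> Y (Dom (Hom K T Y) \<theta>),
       NCod = tensor_ob K A X T \<zeta> Y (Cod (Hom K T Y) \<theta>),
       NAt = (\<lambda>a\<in>Ob A. rwh K X T Y \<theta> (FOb \<zeta> a))\<rparr>)\<rparr>"

definition is_tensor ::
  "('o, 'm, 't) twocat \<Rightarrow> ('p, 'b) cat \<Rightarrow> 'o \<Rightarrow> 'o \<Rightarrow> ('p, 'b, 'm, 't) ftr \<Rightarrow> bool" where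
  "is_tensor K A X T \<zeta> \<longleftrightarrow> T \<in> Obj K \<and> cat_functor A (Hom K X T) \<zeta> \<and>
     (\<forall>Y \<in> Obj K. cat_iso (Hom K T Y) (functor_cat A (Hom K X Y)) (tensor_comparison K A X T \<zeta> Y))"

text \<open>\<open>has_tensors K A T Z\<close>: \<open>K\<close> has tensors by \<open>A\<close>, the tensor of \<open>X\<close> being \<open>(T X, Z X)\<close>. The
  tensors are named because their preservation by a pseudo-functor, stated up to isomorphism (not
  equivalence) of categories, refers to them.\<close>

definition has_tensors ::
  "('o, 'm, 't) twocat \<Rightarrow> ('p, 'b) cat \<Rightarrow> ('o \<Rightarrow> 'o) \<Rightarrow> ('o \<Rightarrow> ('p, 'b, 'm, 't) ftr) \<Rightarrow> bool" where
  "has_tensors K A T Z \<longleftrightarrow> (\<forall>X \<in> Obj K. is_tensor K A X (T X) (Z X))"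

text \<open>The evaluation cone of the power \<open>Cat(A, B)\<close>, as a functor \<open>A \<rightarrow> Cat(Cat(A, B), B)\<close>.\<close>

definition eval_ob ::
  "('p, 'b) cat \<Rightarrow> ('q, 'c) cat \<Rightarrow> 'p
    \<Rightarrow> (('p, 'b, 'q, 'c) ftr, ('p, 'b, 'q, 'c) ntr, 'q, 'c) ftr" where
  "eval_ob A B a = \<lparr>
     FOb = (\<lambda>G\<in>Ob (functor_cat A B). FOb G a),
     FAr = (\<lambda>\<alpha>\<in>Ar (functor_cat A B). NAt \<alpha> a)\<rparr>"

definition eval_cone ::
  "('p, 'b) cat \<Rightarrow> ('q, 'c) cat
    \<Rightarrow> ('p, 'b, (('p, 'b, 'q, 'c) ftr, ('p, 'b, 'q, 'c) ntr, 'q, 'c) ftr,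
              (('p, 'b, 'q, 'c) ftr, ('p, 'b, 'q, 'c) ntr, 'q, 'c) ntr) ftr" where
  "eval_cone A B = \<lparr>
     FOb = (\<lambda>a\<in>Ob A. eval_ob A B a),
     FAr = (\<lambda>u\<in>Ar A. \<lparr>
       NDom = eval_ob A B (Dom A u),
       NCod = eval_ob A B (Cod A u),
       NAt = (\<lambda>G\<in>Ob (functor_cat A B). FAr G u)\<rparr>)\<rparr>"

text \<open>Precomposition with \<open>\<Theta> : D \<rightarrow> E\<close>, as a functor \<open>Cat(E, B) \<rightarrow> Cat(D, B)\<close>.\<close>

definition precomp ::
  "('o, 'a) cat \<Rightarrow> ('p, 'b) cat \<Rightarrow> ('q, 'c) cat \<Rightarrow> ('o, 'a, 'p, 'b) ftr
    \<Rightarrow> (('p, 'b, 'q, 'c) ftr, ('p, 'b, 'q, 'c) ntr, ('o, 'a, 'q, 'c) ftr, ('o, 'a, 'q, 'c) ntr) ftr"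
  where
  "precomp D E B \<Theta> = \<lparr>
     FOb = (\<lambda>G\<in>Ob (functor_cat E B). comp_ftr D G \<Theta>),
     FAr = (\<lambda>\<alpha>\<in>Ar (functor_cat E B). hcomp_nat D B \<alpha> (Ide (functor_cat D E) \<Theta>))\<rparr>"

definition preserves_tensors ::
  "('o, 'm, 't) twocat \<Rightarrow> ('p, 'b) cat \<Rightarrow> ('o \<Rightarrow> 'o) \<Rightarrow> ('o \<Rightarrow> ('p, 'b, 'm, 't) ftr)
    \<Rightarrow> ('o, 'm, 't, ('q, 'c) cat, ('q, 'c, 'q, 'c) ftr, ('q, 'c, 'q, 'c) ntr) psf \<Rightarrow> bool" where
  "preserves_tensors K A T Z F \<longleftrightarrow>
     (\<forall>X \<in> Obj K. \<exists>\<Theta>.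
        cat_iso (PO F (T X)) (functor_cat A (PO F X)) \<Theta> \<and>
        comp_ftr A (precomp (PO F (T X)) (functor_cat A (PO F X)) (PO F X) \<Theta>)
            (eval_cone A (PO F X))
          = comp_ftr A (PF F (T X) X) (Z X))"

section \<open>Bi-representations\<close>

text \<open>The contravariant representable \<open>Hom K (-, I)\<close>, a strict 2-functor \<open>op2 K \<rightarrow> Cat\<close>. A morphism
  \<open>c : Y \<rightarrow> X\<close> of \<open>K\<close> belongs to \<open>Hom (op2 K) X Y\<close>.\<close>

definition repr_ob :: "('o, 'm, 't) twocat \<Rightarrow> 'o \<Rightarrow> 'o \<Rightarrow> 'o \<Rightarrow> 'm \<Rightarrow> ('m, 't, 'm, 't) ftr" where
  "repr_ob K I X Y c = \<lparr>
     FOb = (\<lambda>f\<in>Ob (Hom K X I). HC1 K Y X I f c),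
     FAr = (\<lambda>\<theta>\<in>Ar (Hom K X I). rwh K Y X I \<theta> c)\<rparr>"

definition repr_hom ::
  "('o, 'm, 't) twocat \<Rightarrow> 'o \<Rightarrow> 'o \<Rightarrow> 'o
    \<Rightarrow> ('m, 't, ('m, 't, 'm, 't) ftr, ('m, 't, 'm, 't) ntr) ftr" where
  "repr_hom K I X Y = \<lparr>
     FOb = (\<lambda>c\<in>Ob (Hom K Y X). repr_ob K I X Y c),
     FAr = (\<lambda>\<gamma>\<in>Ar (Hom K Y X). \<lparr>
       NDom = repr_ob K I X Y (Dom (Hom K Y X) \<gamma>),
       NCod = repr_ob K I X Y (Cod (Hom K Y X) \<gamma>),
       NAt = (\<lambda>f\<in>Ob (Hom K X I). lwh K Y X I f \<gamma>)\<rparr>)\<rparr>"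

definition representable ::
  "('o, 'm, 't) twocat \<Rightarrow> 'o
    \<Rightarrow> ('o, 'm, 't, ('m, 't) cat, ('m, 't, 'm, 't) ftr, ('m, 't, 'm, 't) ntr) psf" where
  "representable K I = \<lparr>
     PO = (\<lambda>X. Hom K X I),
     PF = repr_hom K I,
     PC = (\<lambda>X Y Z b a. Ide (functor_cat (Hom K X I) (Hom K Z I))
                         (FOb (repr_hom K I X Z) (HC1 (op2 K) X Y Z b a)))\<rparr>"

definition bi_representation ::
  "('o, 'm, 't) twocat
    \<Rightarrow> ('o, 'm, 't, ('m, 't) cat, ('m, 't, 'm, 't) ftr, ('m, 't, 'm, 't) ntr) psf
    \<Rightarrow> 'o \<Rightarrow> ('o, 'm, ('m, 't, 'm, 't) ftr, ('m, 't, 'm, 't) ntr) pnt \<Rightarrow> bool" where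
  "bi_representation K F I \<rho> \<longleftrightarrow> I \<in> Obj K \<and>
     adjoint_equivalence (Ps (op2 K) Cat) (representable K I) F \<rho>"

section \<open>The 2-category of elements\<close>

text \<open>A 2-morphism of the 2-category of elements, or of a pseudo-slice, is a 2-morphism of the
  underlying 2-category together with its source and target.\<close>

record ('n, 's) tcell =
  Src :: 'n
  Tgt :: 'n
  Und :: 's

definition el_hom ::
  "('o, 'm, 't) twocat
    \<Rightarrow> ('o, 'm, 't, ('q, 'c) cat, ('q, 'c, 'q, 'c) ftr, ('q, 'c, 'q, 'c) ntr) psf
    \<Rightarrow> 'o \<times> 'q \<Rightarrow> 'o \<times> 'q \<Rightarrow> ('m \<times> 'c, ('m \<times> 'c, 't) tcell) cat" where
  "el_hom K F = (\<lambda>(X', x') (X, x).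
     let mor = {(c, \<psi>). c \<in> Ob (Hom K X X') \<and>
                  iso_in (PO F X) x (FOb (FOb (PF F X' X) c) x') \<psi>}
     in \<lparr>
       Ob = mor,
       Ar = {\<gamma>. Src \<gamma> \<in> mor \<and> Tgt \<gamma> \<in> mor \<and>
               Und \<gamma> \<in> hom (Hom K X X') (fst (Src \<gamma>)) (fst (Tgt \<gamma>)) \<and>
               snd (Tgt \<gamma>) = Comp (PO F X) (NAt (FAr (PF F X' X) (Und \<gamma>)) x') (snd (Src \<gamma>))},
       Dom = Src,
       Cod = Tgt,
       Ide = (\<lambda>p. \<lparr>Src = p, Tgt = p, Und = Ide (Hom K X X') (fst p)\<rparr>),
       Comp = (\<lambda>\<delta> \<gamma>. \<lparr>Src = Src \<gamma>, Tgt = Tgt \<delta>, Und = Comp (Hom K X X') (Und \<delta>) (Und \<gamma>)\<rparr>)\<rparr>)"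

text \<open>\<open>el_comp\<close> composes \<open>(c', \<psi>') : (X'', x'') \<rightarrow> (X', x')\<close> with \<open>(c, \<psi>) : (X', x') \<rightarrow> (X, x)\<close>.\<close>

definition el_comp ::
  "('o, 'm, 't) twocat
    \<Rightarrow> ('o, 'm, 't, ('q, 'c) cat, ('q, 'c, 'q, 'c) ftr, ('q, 'c, 'q, 'c) ntr) psf
    \<Rightarrow> 'o \<times> 'q \<Rightarrow> 'o \<times> 'q \<Rightarrow> 'o \<times> 'q \<Rightarrow> 'm \<times> 'c \<Rightarrow> 'm \<times> 'c \<Rightarrow> 'm \<times> 'c" where
  "el_comp K F = (\<lambda>(X'', x'') (X', x') (X, x) (c, \<psi>) (c', \<psi>').
     (HC1 K X X' X'' c' c,
      Comp (PO F X) (NAt (PC F X'' X' X c c') x'')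
        (Comp (PO F X) (FAr (FOb (PF F X' X) c) \<psi>') \<psi>)))"

definition el ::
  "('o, 'm, 't) twocat
    \<Rightarrow> ('o, 'm, 't, ('q, 'c) cat, ('q, 'c, 'q, 'c) ftr, ('q, 'c, 'q, 'c) ntr) psf
    \<Rightarrow> ('o \<times> 'q, 'm \<times> 'c, ('m \<times> 'c, 't) tcell) twocat" where
  "el K F = \<lparr>
     Obj = {(X, x). X \<in> Obj K \<and> x \<in> Ob (PO F X)},
     Hom = el_hom K F,
     One = (\<lambda>(X, x). (One K X, Ide (PO F X) x)),
     HC1 = el_comp K F,
     HC2 = (\<lambda>p q r \<gamma> \<gamma>'. \<lparr>
       Src = el_comp K F p q r (Src \<gamma>) (Src \<gamma>'),
       Tgt = el_comp K F p q r (Tgt \<gamma>) (Tgt \<gamma>'),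
       Und = HC2 K (fst r) (fst q) (fst p) (Und \<gamma>') (Und \<gamma>)\<rparr>)\<rparr>"

section \<open>Pseudo-slices and bi-initial objects\<close>

definition pslice_hom ::
  "('o, 'm, 't) twocat \<Rightarrow> 'o \<Rightarrow> 'o \<times> 'm \<Rightarrow> 'o \<times> 'm \<Rightarrow> ('m \<times> 't, ('m \<times> 't, 't) tcell) cat" where
  "pslice_hom K I = (\<lambda>(X, f) (X', f').
     let mor = {(a, \<psi>). a \<in> Ob (Hom K X X') \<and> iso_in (Hom K I X') f' (HC1 K I X X' a f) \<psi>}
     in \<lparr>
       Ob = mor,
       Ar = {\<beta>. Src \<beta> \<in> mor \<and> Tgt \<beta> \<in> mor \<and>
               Und \<beta> \<in> hom (Hom K X X') (fst (Src \<beta>)) (fst (Tgt \<beta>)) \<and>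
               Comp (Hom K I X') (rwh K I X X' (Und \<beta>) f) (snd (Src \<beta>)) = snd (Tgt \<beta>)},
       Dom = Src,
       Cod = Tgt,
       Ide = (\<lambda>p. \<lparr>Src = p, Tgt = p, Und = Ide (Hom K X X') (fst p)\<rparr>),
       Comp = (\<lambda>\<beta>' \<beta>. \<lparr>Src = Src \<beta>, Tgt = Tgt \<beta>', Und = Comp (Hom K X X') (Und \<beta>') (Und \<beta>)\<rparr>)\<rparr>)"

text \<open>The composite of \<open>(a, \<psi>) : (X, f) \<rightarrow> (X', f')\<close> and \<open>(a', \<psi>') : (X', f') \<rightarrow> (X'', f'')\<close> carries
  the 2-morphism \<open>f'' \<Rightarrow> a' f' \<Rightarrow> a' a f\<close>.\<close>

definition pslice_comp ::
  "('o, 'm, 't) twocat \<Rightarrow> 'o \<Rightarrow> 'o \<times> 'm \<Rightarrow> 'o \<times> 'm \<Rightarrow> 'o \<times> 'm \<Rightarrow> 'm \<times> 't \<Rightarrow> 'm \<times> 't \<Rightarrow> 'm \<times> 't"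
  where
  "pslice_comp K I = (\<lambda>(X, f) (X', f') (X'', f'') (a', \<psi>') (a, \<psi>).
     (HC1 K X X' X'' a' a, Comp (Hom K I X'') (lwh K I X' X'' a' \<psi>) \<psi>'))"

definition pslice ::
  "('o, 'm, 't) twocat \<Rightarrow> 'o \<Rightarrow> ('o \<times> 'm, 'm \<times> 't, ('m \<times> 't, 't) tcell) twocat" where
  "pslice K I = \<lparr>
     Obj = {(X, f). X \<in> Obj K \<and> f \<in> Ob (Hom K I X)},
     Hom = pslice_hom K I,
     One = (\<lambda>(X, f). (One K X, Ide (Hom K I X) f)),
     HC1 = pslice_comp K I,
     HC2 = (\<lambda>p q r \<beta>' \<beta>. \<lparr>
       Src = pslice_comp K I p q r (Src \<beta>') (Src \<beta>),
       Tgt = pslice_comp K I p q r (Tgt \<beta>') (Tgt \<beta>),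
       Und = HC2 K (fst p) (fst q) (fst r) (Und \<beta>') (Und \<beta>)\<rparr>)\<rparr>"

definition pslice_proj ::
  "('o, 'm, 't) twocat \<Rightarrow> 'o
    \<Rightarrow> ('o \<times> 'm, 'm \<times> 't, ('m \<times> 't, 't) tcell, 'o, 'm, 't) tfun" where
  "pslice_proj K I = \<lparr>
     TO = fst,
     TF = (\<lambda>p q. \<lparr>FOb = (\<lambda>f\<in>Ob (pslice_hom K I p q). fst f),
                  FAr = (\<lambda>\<beta>\<in>Ar (pslice_hom K I p q). Und \<beta>)\<rparr>)\<rparr>"

definition bi_initial :: "('o, 'm, 't) twocat \<Rightarrow> 'o \<Rightarrow> bool" where
  "bi_initial K I \<longleftrightarrow> I \<in> Obj K \<and> trivial_fibration (pslice K I) K (pslice_proj K I)"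

end

theory Submission
  imports Defs
begin

text \<open>
  An element \<open>i \<in> F I\<close> names, for every object \<open>X\<close>, the functor \<open>E X : C(X, I) \<rightarrow> F X\<close> that sends
  \<open>c\<close> to \<open>(F c) i\<close> and \<open>\<gamma>\<close> to \<open>(F \<gamma>) i\<close>; it is called \<open>evaluation\<close> below. Both sides of the
  equivalence say that, for a suitable \<open>(I, i)\<close>, every \<open>E X\<close> is an equivalence of categories.

  Bi-initiality of an object \<open>J\<close> of a 2-category means that every hom-category out of \<open>J\<close> is
  nonempty with exactly one arrow between any two of its objects (\<open>bi_initial_iff\<close>). An object of
  the hom-category of the 2-category of elements from \<open>(I, i)\<close> to \<open>(X, x)\<close> is a morphism \<open>c\<close> with
  an isomorphism \<open>x \<cong> (F c) i\<close>, so for \<open>J = (I, i)\<close> this becomes: every \<open>E X\<close> is essentially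
  surjective, and every isomorphism between values of \<open>E X\<close> lifts to exactly one arrow
  (\<open>bi_initial_el_iff\<close>). Nothing is said about arrows that are not invertible, because the
  2-category of elements records isomorphisms only.

  The tensors by the arrow category repair this (\<open>evaluation_fully_faithful\<close>). An arrow \<open>u\<close> of \<open>F X\<close>
  is an object of the power of \<open>F X\<close> by the arrow category, that is, of \<open>F (T X)\<close>, where \<open>T X\<close> is
  the tensor of \<open>X\<close>; likewise a 2-morphism into \<open>I\<close> is a 1-morphism \<open>T X \<rightarrow> I\<close>. Fullness of \<open>E X\<close>
  thus comes from essential surjectivity of \<open>E (T X)\<close>, and faithfulness of \<open>E X\<close> from the lifting
  of isomorphisms along \<open>E (T X)\<close>.

  If all \<open>E X\<close> are equivalences, they are the components of a pseudo-natural transformation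
  \<open>C(-, I) \<Rightarrow> F\<close>, whose 2-morphism components are the compositors of \<open>F\<close> (\<open>cat_pnt_yoneda\<close>). A
  pseudo-natural transformation between category-valued pseudo-functors that is an equivalence at
  every object is an adjoint equivalence (locale \<open>pointwise_equivalence\<close>): choose a couniversal
  arrow \<open>R (Q y) \<rightarrow> y\<close> for every \<open>y\<close>, and let its universal property produce the functors, the
  2-morphism components, the unit, and all equations between them. Conversely a bi-representation
  \<open>\<rho>\<close> consists of equivalences \<open>\<rho> X\<close> (\<open>adjoint_equivalence_pointwise\<close>), and for the element
  \<open>i = \<rho> I (id)\<close> the 2-morphism components of \<open>\<rho>\<close> are a natural isomorphism \<open>E X \<cong> \<rho> X\<close>, so every
  \<open>E X\<close> is an equivalence too (\<open>bi_representation_bi_initial\<close>).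
\<close>

section \<open>Calculating with arrows\<close>

abbreviation comp_in :: "'a \<Rightarrow> ('o, 'a) cat \<Rightarrow> 'a \<Rightarrow> 'a"  (\<open>_ \<cdot>[_]/ _\<close> [66, 0, 65] 65) where
  "g \<cdot>[A] f \<equiv> Comp A g f"

text \<open>Typing is tracked by domain and codomain functions rather than by hom-sets, so that the
  simplifier can discharge all side conditions by rewriting.\<close>

lemma in_hom: "f \<in> hom A x y \<longleftrightarrow> f \<in> Ar A \<and> Dom A f = x \<and> Cod A f = y"
  by (simp add: hom_def)

lemma Dom_Ob [simp]: "category A \<Longrightarrow> f \<in> Ar A \<Longrightarrow> Dom A f \<in> Ob A"
  and Cod_Ob [simp]: "category A \<Longrightarrow> f \<in> Ar A \<Longrightarrow> Cod A f \<in> Ob A"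
  by (simp_all add: category.dom_closed category.cod_closed)

lemma Ide_arr [simp]:
  assumes "category A" "x \<in> Ob A"
  shows "Ide A x \<in> Ar A" "Dom A (Ide A x) = x" "Cod A (Ide A x) = x"
  using category.ide_closed[OF assms] by (auto simp: in_hom)

lemma Comp_arr [simp]:
  assumes "category A" "f \<in> Ar A" "g \<in> Ar A" "Cod A f = Dom A g"
  shows "g \<cdot>[A] f \<in> Ar A" "Dom A (g \<cdot>[A] f) = Dom A f" "Cod A (g \<cdot>[A] f) = Cod A g"
  using category.comp_closed[OF assms(1), of f "Dom A f" "Cod A f" g "Cod A g"] assms
  by (auto simp: in_hom)

lemma Comp_Ide [simp]:
  "category A \<Longrightarrow> f \<in> Ar A \<Longrightarrow> Dom A f = x \<Longrightarrow> f \<cdot>[A] Ide A x = f"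
  by (rule category.comp_ide[of A f x "Cod A f"]) (auto simp: in_hom)

lemma Ide_Comp [simp]:
  "category A \<Longrightarrow> f \<in> Ar A \<Longrightarrow> Cod A f = y \<Longrightarrow> Ide A y \<cdot>[A] f = f"
  by (rule category.ide_comp[of A f "Dom A f" y]) (auto simp: in_hom)

lemma Comp_assoc [simp]:
  "category A \<Longrightarrow> f \<in> Ar A \<Longrightarrow> g \<in> Ar A \<Longrightarrow> h \<in> Ar A \<Longrightarrow> Cod A f = Dom A g \<Longrightarrow> Cod A g = Dom A h \<Longrightarrow>
    (h \<cdot>[A] g) \<cdot>[A] f = h \<cdot>[A] (g \<cdot>[A] f)"
  by (rule category.comp_assoc[of A f "Dom A f" "Cod A f" g "Cod A g" h "Cod A h"]) (auto simp: in_hom)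

text \<open>The form in which an equation between composites is used inside a longer, right-associated
  composite.\<close>

lemma comp_extend:
  "g \<cdot>[A] f = h \<Longrightarrow> category A \<Longrightarrow> f \<in> Ar A \<Longrightarrow> g \<in> Ar A \<Longrightarrow> k \<in> Ar A \<Longrightarrow>
    Cod A k = Dom A f \<Longrightarrow> Cod A f = Dom A g \<Longrightarrow> g \<cdot>[A] (f \<cdot>[A] k) = h \<cdot>[A] k"
  using Comp_assoc[of A k f g] by simp

definition inv_in :: "('o, 'a) cat \<Rightarrow> 'a \<Rightarrow> 'a" where
  "inv_in A f = (SOME g. g \<in> hom A (Cod A f) (Dom A f) \<and>
     g \<cdot>[A] f = Ide A (Dom A f) \<and> f \<cdot>[A] g = Ide A (Cod A f))"

definition is_iso :: "('o, 'a) cat \<Rightarrow> 'a \<Rightarrow> bool" where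
  "is_iso A f \<longleftrightarrow> iso_in A (Dom A f) (Cod A f) f"

lemma iso_in_iff: "iso_in A x y f \<longleftrightarrow> f \<in> Ar A \<and> Dom A f = x \<and> Cod A f = y \<and> is_iso A f"
  by (auto simp: iso_in_def is_iso_def in_hom)

lemma is_isoI:
  "f \<in> Ar A \<Longrightarrow> g \<in> Ar A \<Longrightarrow> Dom A g = Cod A f \<Longrightarrow> Cod A g = Dom A f \<Longrightarrow>
    g \<cdot>[A] f = Ide A (Dom A f) \<Longrightarrow> f \<cdot>[A] g = Ide A (Cod A f) \<Longrightarrow> is_iso A f"
  unfolding is_iso_def iso_in_def by (auto simp: in_hom intro!: bexI[of _ g])

lemma is_iso_arr: "is_iso A f \<Longrightarrow> f \<in> Ar A"
  by (auto simp: is_iso_def iso_in_def in_hom)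

lemma inv_in:
  assumes "is_iso A f"
  shows inv_in_arr [simp]: "inv_in A f \<in> Ar A" "Dom A (inv_in A f) = Cod A f"
      "Cod A (inv_in A f) = Dom A f"
    and inv_in_left [simp]: "inv_in A f \<cdot>[A] f = Ide A (Dom A f)"
    and inv_in_right [simp]: "f \<cdot>[A] inv_in A f = Ide A (Cod A f)"
proof -
  have "\<exists>g. g \<in> hom A (Cod A f) (Dom A f) \<and>
     g \<cdot>[A] f = Ide A (Dom A f) \<and> f \<cdot>[A] g = Ide A (Cod A f)"
    using assms unfolding is_iso_def iso_in_def by blast
  then have "inv_in A f \<in> hom A (Cod A f) (Dom A f) \<and>
     inv_in A f \<cdot>[A] f = Ide A (Dom A f) \<and> f \<cdot>[A] inv_in A f = Ide A (Cod A f)"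
    unfolding inv_in_def by (rule someI_ex)
  then show "inv_in A f \<in> Ar A" "Dom A (inv_in A f) = Cod A f"
      "Cod A (inv_in A f) = Dom A f" "inv_in A f \<cdot>[A] f = Ide A (Dom A f)"
      "f \<cdot>[A] inv_in A f = Ide A (Cod A f)"
    by (auto simp: in_hom)
qed

lemma inv_in_left_comp [simp]:
  "category A \<Longrightarrow> is_iso A f \<Longrightarrow> k \<in> Ar A \<Longrightarrow> Cod A k = Dom A f \<Longrightarrow> inv_in A f \<cdot>[A] (f \<cdot>[A] k) = k"
  by (subst comp_extend[OF inv_in_left]) (auto simp: is_iso_arr)

lemma inv_in_right_comp [simp]:
  "category A \<Longrightarrow> is_iso A f \<Longrightarrow> k \<in> Ar A \<Longrightarrow> Cod A k = Cod A f \<Longrightarrow> f \<cdot>[A] (inv_in A f \<cdot>[A] k) = k"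
  by (subst comp_extend[OF inv_in_right]) (auto simp: is_iso_arr)

lemma is_iso_inv [simp]: "is_iso A f \<Longrightarrow> is_iso A (inv_in A f)"
  by (rule is_isoI[where g = f]) (auto simp: is_iso_arr)

lemma is_iso_Ide [simp]: "category A \<Longrightarrow> x \<in> Ob A \<Longrightarrow> is_iso A (Ide A x)"
  by (rule is_isoI[where g = "Ide A x"]) auto

lemma is_iso_Comp [simp]:
  assumes "category A" "is_iso A f" "is_iso A g" "Cod A f = Dom A g"
  shows "is_iso A (g \<cdot>[A] f)"
  using assms is_iso_arr[OF assms(2)] is_iso_arr[OF assms(3)]
  by (intro is_isoI[where g = "inv_in A f \<cdot>[A] inv_in A g"]) auto

lemma iso_cancel_left:
  assumes "f \<cdot>[A] g = f \<cdot>[A] h" "category A" "is_iso A f" "g \<in> Ar A" "h \<in> Ar A"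
    "Cod A g = Dom A f" "Cod A h = Dom A f"
  shows "g = h"
proof -
  have "inv_in A f \<cdot>[A] (f \<cdot>[A] g) = inv_in A f \<cdot>[A] (f \<cdot>[A] h)"
    by (simp only: assms(1))
  then show ?thesis
    using assms(2-) by simp
qed

lemma iso_cancel_right:
  assumes "g \<cdot>[A] f = h \<cdot>[A] f" "category A" "is_iso A f" "g \<in> Ar A" "h \<in> Ar A"
    "Dom A g = Cod A f" "Dom A h = Cod A f"
  shows "g = h"
proof -
  have "(g \<cdot>[A] f) \<cdot>[A] inv_in A f = (h \<cdot>[A] f) \<cdot>[A] inv_in A f"
    by (simp only: assms(1))
  then show ?thesis
    using assms(2-) is_iso_arr[OF assms(3)] by simp
qed

lemma inv_in_eqI:
  assumes "category A" "is_iso A f" "g \<in> Ar A" "Dom A g = Cod A f" "Cod A g = Dom A f"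
    "g \<cdot>[A] f = Ide A (Dom A f)"
  shows "inv_in A f = g"
  by (rule iso_cancel_right[where A = A and f = f]) (use assms in auto)

section \<open>Functors, and when they are equivalences\<close>

lemma functor_arr:
  assumes "cat_functor A B F"
  shows "x \<in> Ob A \<Longrightarrow> FOb F x \<in> Ob B"
    and "u \<in> Ar A \<Longrightarrow> FAr F u \<in> Ar B"
    and "u \<in> Ar A \<Longrightarrow> Dom B (FAr F u) = FOb F (Dom A u)"
    and "u \<in> Ar A \<Longrightarrow> Cod B (FAr F u) = FOb F (Cod A u)"
    and "x \<in> Ob A \<Longrightarrow> FAr F (Ide A x) = Ide B (FOb F x)"
    and "u \<in> Ar A \<Longrightarrow> v \<in> Ar A \<Longrightarrow> Cod A u = Dom A v \<Longrightarrow>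
      FAr F (v \<cdot>[A] u) = FAr F v \<cdot>[B] FAr F u"
  using cat_functor.fob_closed[OF assms] cat_functor.far_closed[OF assms, of u "Dom A u" "Cod A u"]
    cat_functor.far_ide[OF assms]
    cat_functor.far_comp[OF assms, of u "Dom A u" "Cod A u" v "Cod A v"]
  by (auto simp: in_hom)

lemma functorI:
  assumes "\<And>x. x \<in> Ob A \<Longrightarrow> FOb F x \<in> Ob B"
    and "\<And>u. u \<in> Ar A \<Longrightarrow> FAr F u \<in> Ar B \<and> Dom B (FAr F u) = FOb F (Dom A u) \<and>
      Cod B (FAr F u) = FOb F (Cod A u)"
    and "\<And>x. x \<in> Ob A \<Longrightarrow> FAr F (Ide A x) = Ide B (FOb F x)"
    and "\<And>u v. u \<in> Ar A \<Longrightarrow> v \<in> Ar A \<Longrightarrow> Cod A u = Dom A v \<Longrightarrow>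
      FAr F (v \<cdot>[A] u) = FAr F v \<cdot>[B] FAr F u"
    and "FOb F \<in> extensional (Ob A)" "FAr F \<in> extensional (Ar A)"
  shows "cat_functor A B F"
  by unfold_locales (use assms in \<open>auto simp: in_hom\<close>)

lemma functor_eqI:
  assumes "cat_functor A B F" "cat_functor A B G"
    and "\<And>x. x \<in> Ob A \<Longrightarrow> FOb F x = FOb G x" "\<And>u. u \<in> Ar A \<Longrightarrow> FAr F u = FAr G u"
  shows "F = G"
proof -
  interpret F: cat_functor A B F by fact
  interpret G: cat_functor A B G by fact
  have "FOb F = FOb G" using F.fob_ext G.fob_ext assms(3) by (rule extensionalityI)
  moreover have "FAr F = FAr G" using F.far_ext G.far_ext assms(4) by (rule extensionalityI)
  ultimately show ?thesis by simp
qed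

lemma functor_iso:
  assumes "cat_functor A B F" "category A" "category B" "is_iso A f"
  shows "is_iso B (FAr F f)"
proof -
  note [simp] = assms functor_arr(1-5)[OF assms(1)]
  have f [simp]: "f \<in> Ar A" by (rule is_iso_arr) fact
  show ?thesis
    by (intro is_isoI[where g = "FAr F (inv_in A f)"])
      (simp_all flip: functor_arr(6)[OF assms(1)])
qed

lemma id_ftr_simps [simp]:
  "x \<in> Ob A \<Longrightarrow> FOb (id_ftr A) x = x" "u \<in> Ar A \<Longrightarrow> FAr (id_ftr A) u = u"
  by (simp_all add: id_ftr_def)

lemma comp_ftr_simps [simp]:
  "x \<in> Ob A \<Longrightarrow> FOb (comp_ftr A G F) x = FOb G (FOb F x)"
  "u \<in> Ar A \<Longrightarrow> FAr (comp_ftr A G F) u = FAr G (FAr F u)"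
  by (simp_all add: comp_ftr_def)

lemma id_functor [simp]: "category A \<Longrightarrow> cat_functor A A (id_ftr A)"
  by (rule functorI) (auto simp: id_ftr_def)

lemma comp_functor:
  assumes "category A" "cat_functor A B F" "cat_functor B C G"
  shows "cat_functor A C (comp_ftr A G F)"
  by (rule functorI)
    (use assms(1) functor_arr[OF assms(2)] functor_arr[OF assms(3)] in \<open>auto simp: comp_ftr_def\<close>)

lemma comp_ftr_id:
  assumes "category A" "category B" "cat_functor A B F"
  shows "comp_ftr A F (id_ftr A) = F" "comp_ftr A (id_ftr B) F = F"
proof -
  note [simp] = assms functor_arr[OF assms(3)]
  show "comp_ftr A F (id_ftr A) = F"
    by (rule functor_eqI[OF comp_functor[OF assms(1) id_functor[OF assms(1)] assms(3)] assms(3)]) auto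
  show "comp_ftr A (id_ftr B) F = F"
    by (rule functor_eqI[OF comp_functor[OF assms(1,3) id_functor[OF assms(2)]] assms(3)]) auto
qed

lemma comp_ftr_assoc:
  assumes "category A" "cat_functor A B F"
  shows "comp_ftr A (comp_ftr B H G) F = comp_ftr A H (comp_ftr A G F)"
  using assms functor_arr[OF assms(2)] by (auto simp: comp_ftr_def fun_eq_iff restrict_def)

definition fully_faithful :: "('o, 'a) cat \<Rightarrow> ('p, 'b) cat \<Rightarrow> ('o, 'a, 'p, 'b) ftr \<Rightarrow> bool" where
  "fully_faithful A B F \<longleftrightarrow> (\<forall>x \<in> Ob A. \<forall>y \<in> Ob A.
     bij_betw (FAr F) (hom A x y) (hom B (FOb F x) (FOb F y)))"

definition essentially_surjective ::
  "('o, 'a) cat \<Rightarrow> ('p, 'b) cat \<Rightarrow> ('o, 'a, 'p, 'b) ftr \<Rightarrow> bool" where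
  "essentially_surjective A B F \<longleftrightarrow> (\<forall>y \<in> Ob B. \<exists>x \<in> Ob A. \<exists>e. iso_in B (FOb F x) y e)"

text \<open>What bi-initiality in the 2-category of elements says about arrows; it constrains neither the
  existence of lifts of arrows that are not invertible nor their uniqueness.\<close>

definition iso_lifting :: "('o, 'a) cat \<Rightarrow> ('p, 'b) cat \<Rightarrow> ('o, 'a, 'p, 'b) ftr \<Rightarrow> bool" where
  "iso_lifting A B F \<longleftrightarrow> (\<forall>x \<in> Ob A. \<forall>y \<in> Ob A. \<forall>\<theta>. iso_in B (FOb F x) (FOb F y) \<theta> \<longrightarrow>
     (\<exists>!u. u \<in> hom A x y \<and> FAr F u = \<theta>))"

lemma fully_faithfulI:
  assumes "\<And>u v. u \<in> Ar A \<Longrightarrow> v \<in> Ar A \<Longrightarrow> Dom A u = Dom A v \<Longrightarrow> Cod A u = Cod A v \<Longrightarrow>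
      FAr F u = FAr F v \<Longrightarrow> u = v"
    and "\<And>x y w. x \<in> Ob A \<Longrightarrow> y \<in> Ob A \<Longrightarrow> w \<in> Ar B \<Longrightarrow> Dom B w = FOb F x \<Longrightarrow> Cod B w = FOb F y \<Longrightarrow>
      \<exists>u. u \<in> Ar A \<and> Dom A u = x \<and> Cod A u = y \<and> FAr F u = w"
    and "cat_functor A B F"
  shows "fully_faithful A B F"
  unfolding fully_faithful_def bij_betw_def
proof (intro ballI conjI)
  fix x y assume xy: "x \<in> Ob A" "y \<in> Ob A"
  show "inj_on (FAr F) (hom A x y)"
    using assms(1) by (auto simp: inj_on_def in_hom)
  show "FAr F ` hom A x y = hom B (FOb F x) (FOb F y)"
  proof
    show "FAr F ` hom A x y \<subseteq> hom B (FOb F x) (FOb F y)"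
      using functor_arr[OF assms(3)] by (auto simp: in_hom)
    show "hom B (FOb F x) (FOb F y) \<subseteq> FAr F ` hom A x y"
    proof
      fix w assume "w \<in> hom B (FOb F x) (FOb F y)"
      then obtain u where "u \<in> Ar A \<and> Dom A u = x \<and> Cod A u = y \<and> FAr F u = w"
        using assms(2)[OF xy, of w] by (auto simp: in_hom)
      then show "w \<in> FAr F ` hom A x y" by (auto simp: in_hom)
    qed
  qed
qed

lemma fully_faithful_inj:
  assumes "fully_faithful A B F" "category A" "FAr F u = FAr F v" "u \<in> Ar A" "v \<in> Ar A"
    "Dom A u = Dom A v" "Cod A u = Cod A v"
  shows "u = v"
proof -
  have "inj_on (FAr F) (hom A (Dom A u) (Cod A u))"
    using assms(1,2,4,5) by (auto simp: fully_faithful_def bij_betw_def)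
  then show ?thesis
    using assms(3-) by (auto simp: inj_on_def in_hom)
qed

lemma fully_faithful_surj:
  assumes "fully_faithful A B F" "x \<in> Ob A" "y \<in> Ob A" "w \<in> Ar B" "Dom B w = FOb F x"
    "Cod B w = FOb F y"
  obtains u where "u \<in> Ar A" "Dom A u = x" "Cod A u = y" "FAr F u = w"
proof -
  have "FAr F ` hom A x y = hom B (FOb F x) (FOb F y)"
    using assms by (auto simp: fully_faithful_def bij_betw_def)
  moreover have "w \<in> hom B (FOb F x) (FOb F y)"
    using assms by (simp add: in_hom)
  ultimately obtain u where "u \<in> hom A x y" "w = FAr F u" by blast
  then show ?thesis using that by (auto simp: in_hom)
qed

lemma fully_faithful_iso_lifting:
  assumes "fully_faithful A B F" "category A"
  shows "iso_lifting A B F"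
  unfolding iso_lifting_def
proof (intro ballI allI impI)
  fix x y \<theta> assume "x \<in> Ob A" "y \<in> Ob A" "iso_in B (FOb F x) (FOb F y) \<theta>"
  then obtain u where u: "u \<in> Ar A" "Dom A u = x" "Cod A u = y" "FAr F u = \<theta>"
    using fully_faithful_surj[OF assms(1)] unfolding iso_in_iff by blast
  then show "\<exists>!u. u \<in> hom A x y \<and> FAr F u = \<theta>"
    by (intro ex1I[of _ u]) (auto simp: in_hom intro: fully_faithful_inj[OF assms])
qed

text \<open>The inverse of \<open>F u\<close> lifts, and both composites of the lift with \<open>u\<close> are sent to identities.\<close>

lemma fully_faithful_reflects_iso:
  assumes ff: "fully_faithful A B F" and F: "cat_functor A B F" and A: "category A" "category B"
    and u: "u \<in> Ar A" "is_iso B (FAr F u)"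
  shows "is_iso A u"
proof -
  note [simp] = A u functor_arr[OF F]
  obtain v where v [simp]: "v \<in> Ar A" "Dom A v = Cod A u" "Cod A v = Dom A u"
      "FAr F v = inv_in B (FAr F u)"
    by (rule fully_faithful_surj[OF ff, of "Cod A u" "Dom A u" "inv_in B (FAr F u)"])
      auto
  show ?thesis
    by (rule is_isoI[OF u(1) v(1)]; (rule fully_faithful_inj[OF ff A(1)])?)
      auto
qed

text \<open>Naturality of \<open>\<eta>\<close> makes \<open>F\<close> faithful, and naturality of \<open>\<epsilon>\<close> makes \<open>G\<close> faithful. The
  preimage of \<open>w\<close> under \<open>F\<close> is \<open>(\<eta> y)\<^sup>-\<^sup>1 (G w) (\<eta> x)\<close>: by naturality of \<open>\<eta>\<close> its image under \<open>G F\<close>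
  is \<open>G w\<close>, and \<open>G\<close> is faithful.\<close>

lemma equivalence_fully_faithful:
  assumes A: "category A" "category B" and F: "cat_functor A B F" and G: "cat_functor B A G"
    and \<eta>: "\<And>x. x \<in> Ob A \<Longrightarrow> iso_in A x (FOb G (FOb F x)) (\<eta> x)"
      "\<And>u. u \<in> Ar A \<Longrightarrow> \<eta> (Cod A u) \<cdot>[A] u = FAr G (FAr F u) \<cdot>[A] \<eta> (Dom A u)"
    and \<epsilon>: "\<And>y. y \<in> Ob B \<Longrightarrow> iso_in B (FOb F (FOb G y)) y (\<epsilon> y)"
      "\<And>v. v \<in> Ar B \<Longrightarrow> \<epsilon> (Cod B v) \<cdot>[B] FAr F (FAr G v) = v \<cdot>[B] \<epsilon> (Dom B v)"
  shows "fully_faithful A B F" "essentially_surjective A B F"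
proof -
  note [simp] = A functor_arr[OF F] functor_arr[OF G]
  have [simp]: "\<eta> x \<in> Ar A" "Dom A (\<eta> x) = x" "Cod A (\<eta> x) = FOb G (FOb F x)" "is_iso A (\<eta> x)"
    if "x \<in> Ob A" for x using \<eta>(1)[OF that] by (auto simp: iso_in_iff)
  have [simp]: "\<epsilon> y \<in> Ar B" "Cod B (\<epsilon> y) = y" "Dom B (\<epsilon> y) = FOb F (FOb G y)" "is_iso B (\<epsilon> y)"
    if "y \<in> Ob B" for y using \<epsilon>(1)[OF that] by (auto simp: iso_in_iff)
  have F_inj: "u = v" if "u \<in> Ar A" "v \<in> Ar A" "Dom A u = Dom A v" "Cod A u = Cod A v"
      "FAr F u = FAr F v" for u v
    by (rule iso_cancel_left[where A = A and f = "\<eta> (Cod A u)"])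
      (use that \<eta>(2)[of u] \<eta>(2)[of v] in auto)
  have G_inj: "u = v" if "u \<in> Ar B" "v \<in> Ar B" "Dom B u = Dom B v" "Cod B u = Cod B v"
      "FAr G u = FAr G v" for u v
    by (rule iso_cancel_right[where A = B and f = "\<epsilon> (Dom B u)"])
      (use that \<epsilon>(2)[of u] \<epsilon>(2)[of v] in auto)
  show "fully_faithful A B F"
  proof (rule fully_faithfulI[OF F_inj _ F])
    fix x y w
    assume xy [simp]: "x \<in> Ob A" "y \<in> Ob A"
      and w [simp]: "w \<in> Ar B" "Dom B w = FOb F x" "Cod B w = FOb F y"
    obtain u where u [simp]: "u \<in> Ar A" "Dom A u = x" "Cod A u = y"
      and eq: "\<eta> y \<cdot>[A] u = FAr G w \<cdot>[A] \<eta> x"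
    proof
      let ?u = "inv_in A (\<eta> y) \<cdot>[A] FAr G w \<cdot>[A] \<eta> x"
      show "?u \<in> Ar A" "Dom A ?u = x" "Cod A ?u = y" "\<eta> y \<cdot>[A] ?u = FAr G w \<cdot>[A] \<eta> x"
        by auto
    qed
    have "FAr G (FAr F u) \<cdot>[A] \<eta> x = FAr G w \<cdot>[A] \<eta> x"
      using \<eta>(2)[OF u(1)] eq by simp
    then have "FAr G (FAr F u) = FAr G w"
      by (rule iso_cancel_right) auto
    then have "FAr F u = w"
      by (intro G_inj) auto
    then show "\<exists>u. u \<in> Ar A \<and> Dom A u = x \<and> Cod A u = y \<and> FAr F u = w"
      using u by blast
  qed
  show "essentially_surjective A B F"
    using \<epsilon>(1) functor_arr(1)[OF G] unfolding essentially_surjective_def by blast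
qed

text \<open>Arrows \<open>G x \<rightarrow> G y\<close> and arrows \<open>F x \<rightarrow> F y\<close> correspond by conjugation with \<open>s\<close>.\<close>

lemma equivalence_transport:
  assumes A: "category A" "category B" and F: "cat_functor A B F" and G: "cat_functor A B G"
    and s: "\<And>x. x \<in> Ob A \<Longrightarrow> iso_in B (FOb G x) (FOb F x) (s x)"
      "\<And>u. u \<in> Ar A \<Longrightarrow> s (Cod A u) \<cdot>[B] FAr G u = FAr F u \<cdot>[B] s (Dom A u)"
    and ff: "fully_faithful A B F" and es: "essentially_surjective A B F"
  shows "fully_faithful A B G" "essentially_surjective A B G"
proof -
  note [simp] = A functor_arr[OF F] functor_arr[OF G]
  have [simp]: "s x \<in> Ar B" "Dom B (s x) = FOb G x" "Cod B (s x) = FOb F x" "is_iso B (s x)"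
    if "x \<in> Ob A" for x using s(1)[OF that] by (auto simp: iso_in_iff)
  show "fully_faithful A B G"
  proof (rule fully_faithfulI[OF _ _ G])
    fix u v assume uv [simp]: "u \<in> Ar A" "v \<in> Ar A" "Dom A u = Dom A v" "Cod A u = Cod A v"
      "FAr G u = FAr G v"
    have "FAr F u \<cdot>[B] s (Dom A u) = FAr F v \<cdot>[B] s (Dom A u)"
      using s(2)[of u] s(2)[of v] by simp
    then have "FAr F u = FAr F v" by (rule iso_cancel_right) auto
    then show "u = v" by (rule fully_faithful_inj[OF ff A(1)]) auto
  next
    fix x y w
    assume xy [simp]: "x \<in> Ob A" "y \<in> Ob A"
      and w [simp]: "w \<in> Ar B" "Dom B w = FOb G x" "Cod B w = FOb G y"
    obtain u where u [simp]: "u \<in> Ar A" "Dom A u = x" "Cod A u = y"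
        "FAr F u = s y \<cdot>[B] w \<cdot>[B] inv_in B (s x)"
      by (rule fully_faithful_surj[OF ff xy, of "s y \<cdot>[B] w \<cdot>[B] inv_in B (s x)"]) auto
    have "s y \<cdot>[B] FAr G u = s y \<cdot>[B] w"
      using s(2)[of u] by simp
    then have "FAr G u = w" by (rule iso_cancel_left) auto
    then show "\<exists>u. u \<in> Ar A \<and> Dom A u = x \<and> Cod A u = y \<and> FAr G u = w"
      using u by blast
  qed
  show "essentially_surjective A B G"
    unfolding essentially_surjective_def
  proof
    fix y assume "y \<in> Ob B"
    then obtain x e where "x \<in> Ob A" "iso_in B (FOb F x) y e"
      using es unfolding essentially_surjective_def by blast
    then have "x \<in> Ob A" "iso_in B (FOb G x) y (e \<cdot>[B] s x)"
      by (auto simp: iso_in_iff)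
    then show "\<exists>x\<in>Ob A. \<exists>e. iso_in B (FOb G x) y e" by blast
  qed
qed

section \<open>Functor categories and the 2-category of categories\<close>

lemma functor_cat_simps [simp]:
  "F \<in> Ob (functor_cat A B) \<longleftrightarrow> cat_functor A B F"
  "\<alpha> \<in> Ar (functor_cat A B) \<longleftrightarrow> nat_trans A B \<alpha>"
  "Dom (functor_cat A B) = NDom" "Cod (functor_cat A B) = NCod"
  "NDom (Ide (functor_cat A B) F) = F" "NCod (Ide (functor_cat A B) F) = F"
  "x \<in> Ob A \<Longrightarrow> NAt (Ide (functor_cat A B) F) x = Ide B (FOb F x)"
  "NDom (\<beta> \<cdot>[functor_cat A B] \<alpha>) = NDom \<alpha>" "NCod (\<beta> \<cdot>[functor_cat A B] \<alpha>) = NCod \<beta>"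
  "x \<in> Ob A \<Longrightarrow> NAt (\<beta> \<cdot>[functor_cat A B] \<alpha>) x = NAt \<beta> x \<cdot>[B] NAt \<alpha> x"
  by (simp_all add: functor_cat_def)

lemma nat_trans_arr:
  assumes "nat_trans A B \<alpha>"
  shows "cat_functor A B (NDom \<alpha>)" "cat_functor A B (NCod \<alpha>)"
    and "x \<in> Ob A \<Longrightarrow> NAt \<alpha> x \<in> Ar B"
    and "x \<in> Ob A \<Longrightarrow> Dom B (NAt \<alpha> x) = FOb (NDom \<alpha>) x"
    and "x \<in> Ob A \<Longrightarrow> Cod B (NAt \<alpha> x) = FOb (NCod \<alpha>) x"
    and "u \<in> Ar A \<Longrightarrow> Dom A u = x \<Longrightarrow> Cod A u = y \<Longrightarrow>
      NAt \<alpha> y \<cdot>[B] FAr (NDom \<alpha>) u = FAr (NCod \<alpha>) u \<cdot>[B] NAt \<alpha> x"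
  using nat_trans.ndom[OF assms] nat_trans.ncod[OF assms] nat_trans.nat_closed[OF assms, of x]
    nat_trans.naturality[OF assms, of u x y]
  by (auto simp: in_hom)

lemma nat_transI:
  assumes "cat_functor A B (NDom \<alpha>)" "cat_functor A B (NCod \<alpha>)"
    and "\<And>x. x \<in> Ob A \<Longrightarrow> NAt \<alpha> x \<in> Ar B \<and> Dom B (NAt \<alpha> x) = FOb (NDom \<alpha>) x \<and>
      Cod B (NAt \<alpha> x) = FOb (NCod \<alpha>) x"
    and "\<And>u. u \<in> Ar A \<Longrightarrow> NAt \<alpha> (Cod A u) \<cdot>[B] FAr (NDom \<alpha>) u = FAr (NCod \<alpha>) u \<cdot>[B] NAt \<alpha> (Dom A u)"
    and "NAt \<alpha> \<in> extensional (Ob A)"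
  shows "nat_trans A B \<alpha>"
  by (rule nat_trans.intro) (use assms in \<open>auto simp: in_hom\<close>)

lemma nat_trans_eqI:
  assumes "nat_trans A B \<alpha>" "nat_trans A B \<beta>" "NDom \<alpha> = NDom \<beta>" "NCod \<alpha> = NCod \<beta>"
    and "\<And>x. x \<in> Ob A \<Longrightarrow> NAt \<alpha> x = NAt \<beta> x"
  shows "\<alpha> = \<beta>"
proof -
  have "NAt \<alpha> = NAt \<beta>"
    by (rule extensionalityI[OF nat_trans.nat_ext[OF assms(1)] nat_trans.nat_ext[OF assms(2)] assms(5)])
  then show ?thesis using assms(3,4) by simp
qed

lemma nat_trans_Ide:
  assumes "category A" "category B" "cat_functor A B F"
  shows "nat_trans A B (Ide (functor_cat A B) F)"
proof -
  note [simp] = assms functor_arr[OF assms(3)]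
  show ?thesis
    by (rule nat_transI) (auto simp: functor_cat_def)
qed

lemma nat_trans_Comp:
  assumes A: "category A" "category B" and \<alpha>: "nat_trans A B \<alpha>" and \<beta>: "nat_trans A B \<beta>"
    and m: "NCod \<alpha> = NDom \<beta>"
  shows "nat_trans A B (\<beta> \<cdot>[functor_cat A B] \<alpha>)"
proof -
  note [simp] = A nat_trans_arr(1-5)[OF \<alpha>] nat_trans_arr(1-5)[OF \<beta>] m
    functor_arr[OF nat_trans_arr(1)[OF \<alpha>]] functor_arr[OF nat_trans_arr(2)[OF \<beta>]]
    functor_arr[OF nat_trans_arr(1)[OF \<beta>]]
  show ?thesis
  proof (rule nat_transI)
    fix u assume [simp]: "u \<in> Ar A"
    have 1: "NAt \<alpha> (Cod A u) \<cdot>[B] FAr (NDom \<alpha>) u = FAr (NDom \<beta>) u \<cdot>[B] NAt \<alpha> (Dom A u)"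
      using nat_trans_arr(6)[OF \<alpha>] by simp
    have 2: "NAt \<beta> (Cod A u) \<cdot>[B] FAr (NDom \<beta>) u = FAr (NCod \<beta>) u \<cdot>[B] NAt \<beta> (Dom A u)"
      using nat_trans_arr(6)[OF \<beta>] by simp
    show "NAt (\<beta> \<cdot>[functor_cat A B] \<alpha>) (Cod A u) \<cdot>[B] FAr (NDom (\<beta> \<cdot>[functor_cat A B] \<alpha>)) u =
        FAr (NCod (\<beta> \<cdot>[functor_cat A B] \<alpha>)) u \<cdot>[B] NAt (\<beta> \<cdot>[functor_cat A B] \<alpha>) (Dom A u)"
      by (simp add: 1 comp_extend[OF 2])
  qed (auto simp: functor_cat_def)
qed

lemma category_functor_cat [simp]:
  assumes A: "category A" "category B"
  shows "category (functor_cat A B)"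
proof
  fix F assume F: "F \<in> Ob (functor_cat A B)"
  then show "Ide (functor_cat A B) F \<in> hom (functor_cat A B) F F"
    using nat_trans_Ide[OF A] by (simp add: in_hom)
next
  fix \<alpha> \<beta> F G H
  assume a: "\<alpha> \<in> hom (functor_cat A B) F G" "\<beta> \<in> hom (functor_cat A B) G H"
  then show "\<beta> \<cdot>[functor_cat A B] \<alpha> \<in> hom (functor_cat A B) F H"
    using nat_trans_Comp[OF A] by (auto simp: in_hom)
next
  fix \<alpha> F G assume a: "\<alpha> \<in> hom (functor_cat A B) F G"
  then have \<alpha>: "nat_trans A B \<alpha>" "NDom \<alpha> = F" "NCod \<alpha> = G" by (auto simp: in_hom)
  note [simp] = A nat_trans_arr[OF \<alpha>(1)] nat_trans_Ide[OF A] nat_trans_Comp[OF A]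
  show "\<alpha> \<cdot>[functor_cat A B] Ide (functor_cat A B) F = \<alpha>"
    by (rule nat_trans_eqI[where A = A and B = B]) (use \<alpha> in auto)
  show "Ide (functor_cat A B) G \<cdot>[functor_cat A B] \<alpha> = \<alpha>"
    by (rule nat_trans_eqI[where A = A and B = B]) (use \<alpha> in auto)
next
  fix \<alpha> \<beta> \<gamma> F G H J
  assume "\<alpha> \<in> hom (functor_cat A B) F G" "\<beta> \<in> hom (functor_cat A B) G H"
    "\<gamma> \<in> hom (functor_cat A B) H J"
  then have *: "nat_trans A B \<alpha>" "nat_trans A B \<beta>" "nat_trans A B \<gamma>"
      "NCod \<alpha> = NDom \<beta>" "NCod \<beta> = NDom \<gamma>" by (auto simp: in_hom)
  note [simp] = A *  nat_trans_Comp[OF A]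
    nat_trans_arr(3-5)[OF *(1)] nat_trans_arr(3-5)[OF *(2)] nat_trans_arr(3-5)[OF *(3)]
  show "(\<gamma> \<cdot>[functor_cat A B] \<beta>) \<cdot>[functor_cat A B] \<alpha> = \<gamma> \<cdot>[functor_cat A B] \<beta> \<cdot>[functor_cat A B] \<alpha>"
    by (rule nat_trans_eqI[where A = A and B = B]) auto
qed (auto simp: nat_trans.ndom nat_trans.ncod)

lemma is_iso_component:
  assumes "is_iso (functor_cat A B) \<alpha>" "x \<in> Ob A"
  shows "is_iso B (NAt \<alpha> x)"
proof -
  have \<alpha>: "nat_trans A B \<alpha>" using is_iso_arr[OF assms(1)] by simp
  let ?\<beta> = "inv_in (functor_cat A B) \<alpha>"
  have \<beta>: "nat_trans A B ?\<beta>" "NDom ?\<beta> = NCod \<alpha>" "NCod ?\<beta> = NDom \<alpha>"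
    using inv_in_arr[OF assms(1)] by auto
  have "NAt (?\<beta> \<cdot>[functor_cat A B] \<alpha>) x = NAt (Ide (functor_cat A B) (NDom \<alpha>)) x"
    using inv_in_left[OF assms(1)] by simp
  moreover have "NAt (\<alpha> \<cdot>[functor_cat A B] ?\<beta>) x = NAt (Ide (functor_cat A B) (NCod \<alpha>)) x"
    using inv_in_right[OF assms(1)] by simp
  ultimately show ?thesis
    using assms(2) \<beta> nat_trans_arr(3-5)[OF \<alpha>] nat_trans_arr(3-5)[OF \<beta>(1)]
    by (intro is_isoI[where g = "NAt ?\<beta> x"]) auto
qed

text \<open>The inverses of the components are natural: a naturality square of isomorphisms can be read
  in the opposite direction.\<close>

lemma is_iso_nat_transI:
  assumes A: "category A" "category B" and \<alpha>: "nat_trans A B \<alpha>"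
    and iso: "\<And>x. x \<in> Ob A \<Longrightarrow> is_iso B (NAt \<alpha> x)"
  shows "is_iso (functor_cat A B) \<alpha>"
proof -
  note [simp] = A nat_trans_arr(1-5)[OF \<alpha>] iso \<alpha> nat_trans_Ide[OF A] nat_trans_Comp[OF A]
    functor_arr[OF nat_trans_arr(1)[OF \<alpha>]] functor_arr[OF nat_trans_arr(2)[OF \<alpha>]]
  define \<beta> where "\<beta> = \<lparr>NDom = NCod \<alpha>, NCod = NDom \<alpha>, NAt = (\<lambda>x\<in>Ob A. inv_in B (NAt \<alpha> x))\<rparr>"
  have [simp]: "NDom \<beta> = NCod \<alpha>" "NCod \<beta> = NDom \<alpha>" "\<And>x. x \<in> Ob A \<Longrightarrow> NAt \<beta> x = inv_in B (NAt \<alpha> x)"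
    by (simp_all add: \<beta>_def)
  have \<beta> [simp]: "nat_trans A B \<beta>"
  proof (rule nat_transI)
    fix u assume [simp]: "u \<in> Ar A"
    have 1: "NAt \<alpha> (Cod A u) \<cdot>[B] FAr (NDom \<alpha>) u = FAr (NCod \<alpha>) u \<cdot>[B] NAt \<alpha> (Dom A u)"
      using nat_trans_arr(6)[OF \<alpha>] by simp
    have "NAt \<alpha> (Cod A u) \<cdot>[B] (inv_in B (NAt \<alpha> (Cod A u)) \<cdot>[B] FAr (NCod \<alpha>) u) \<cdot>[B] NAt \<alpha> (Dom A u)
        = NAt \<alpha> (Cod A u) \<cdot>[B] (FAr (NDom \<alpha>) u \<cdot>[B] inv_in B (NAt \<alpha> (Dom A u))) \<cdot>[B] NAt \<alpha> (Dom A u)"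
      using 1 by simp
    then have "(inv_in B (NAt \<alpha> (Cod A u)) \<cdot>[B] FAr (NCod \<alpha>) u) \<cdot>[B] NAt \<alpha> (Dom A u)
        = (FAr (NDom \<alpha>) u \<cdot>[B] inv_in B (NAt \<alpha> (Dom A u))) \<cdot>[B] NAt \<alpha> (Dom A u)"
      by (rule iso_cancel_left[where A = B and f = "NAt \<alpha> (Cod A u)"]) auto
    then have "inv_in B (NAt \<alpha> (Cod A u)) \<cdot>[B] FAr (NCod \<alpha>) u =
        FAr (NDom \<alpha>) u \<cdot>[B] inv_in B (NAt \<alpha> (Dom A u))"
      by (rule iso_cancel_right[where A = B and f = "NAt \<alpha> (Dom A u)"]) auto
    then show "NAt \<beta> (Cod A u) \<cdot>[B] FAr (NDom \<beta>) u = FAr (NCod \<beta>) u \<cdot>[B] NAt \<beta> (Dom A u)"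
      by simp
  qed (auto simp: \<beta>_def)
  show ?thesis
    by (rule is_isoI[where g = \<beta>]; (rule nat_trans_eqI[where A = A and B = B])?) auto
qed

lemma Cat_simps [simp]:
  "A \<in> Obj Cat \<longleftrightarrow> category A" "Hom Cat = functor_cat" "One Cat = id_ftr"
  "HC1 Cat A B C G F = comp_ftr A G F" "HC2 Cat A B C \<beta> \<alpha> = hcomp_nat A C \<beta> \<alpha>"
  by (simp_all add: Cat_def)

lemma hcomp_nat_simps [simp]:
  "NDom (hcomp_nat A C \<beta> \<alpha>) = comp_ftr A (NDom \<beta>) (NDom \<alpha>)"
  "NCod (hcomp_nat A C \<beta> \<alpha>) = comp_ftr A (NCod \<beta>) (NCod \<alpha>)"
  "x \<in> Ob A \<Longrightarrow> NAt (hcomp_nat A C \<beta> \<alpha>) x = NAt \<beta> (FOb (NCod \<alpha>) x) \<cdot>[C] FAr (NDom \<beta>) (NAt \<alpha> x)"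
  by (simp_all add: hcomp_nat_def)

lemma nat_trans_hcomp:
  assumes A: "category A" "category B" "category C" and \<alpha>: "nat_trans A B \<alpha>" and \<beta>: "nat_trans B C \<beta>"
  shows "nat_trans A C (hcomp_nat A C \<beta> \<alpha>)"
proof -
  note [simp] = A nat_trans_arr(1-5)[OF \<alpha>] nat_trans_arr(1-5)[OF \<beta>]
    functor_arr[OF nat_trans_arr(1)[OF \<alpha>]] functor_arr[OF nat_trans_arr(2)[OF \<alpha>]]
    functor_arr[OF nat_trans_arr(1)[OF \<beta>]] functor_arr[OF nat_trans_arr(2)[OF \<beta>]]
  show ?thesis
  proof (rule nat_transI)
    fix u assume [simp]: "u \<in> Ar A"
    have "FAr (NDom \<beta>) (NAt \<alpha> (Cod A u) \<cdot>[B] FAr (NDom \<alpha>) u) =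
        FAr (NDom \<beta>) (FAr (NCod \<alpha>) u \<cdot>[B] NAt \<alpha> (Dom A u))"
      using nat_trans_arr(6)[OF \<alpha>] by simp
    then have 1: "FAr (NDom \<beta>) (NAt \<alpha> (Cod A u)) \<cdot>[C] FAr (NDom \<beta>) (FAr (NDom \<alpha>) u) =
        FAr (NDom \<beta>) (FAr (NCod \<alpha>) u) \<cdot>[C] FAr (NDom \<beta>) (NAt \<alpha> (Dom A u))"
      by simp
    have 2: "NAt \<beta> (FOb (NCod \<alpha>) (Cod A u)) \<cdot>[C] FAr (NDom \<beta>) (FAr (NCod \<alpha>) u) =
        FAr (NCod \<beta>) (FAr (NCod \<alpha>) u) \<cdot>[C] NAt \<beta> (FOb (NCod \<alpha>) (Dom A u))"
      by (rule nat_trans_arr(6)[OF \<beta>]) auto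
    show "NAt (hcomp_nat A C \<beta> \<alpha>) (Cod A u) \<cdot>[C] FAr (NDom (hcomp_nat A C \<beta> \<alpha>)) u =
        FAr (NCod (hcomp_nat A C \<beta> \<alpha>)) u \<cdot>[C] NAt (hcomp_nat A C \<beta> \<alpha>) (Dom A u)"
      by (simp add: 1 comp_extend[OF 2])
  qed (auto simp: hcomp_nat_def
      comp_functor[OF A(1) nat_trans_arr(1)[OF \<alpha>] nat_trans_arr(1)[OF \<beta>]]
      comp_functor[OF A(1) nat_trans_arr(2)[OF \<alpha>] nat_trans_arr(2)[OF \<beta>]])
qed

lemma whisker_Cat_dom [simp]:
  "NDom (lwh Cat A B C G \<alpha>) = comp_ftr A G (NDom \<alpha>)" "NCod (lwh Cat A B C G \<alpha>) = comp_ftr A G (NCod \<alpha>)"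
  "NDom (rwh Cat A B C \<beta> F) = comp_ftr A (NDom \<beta>) F" "NCod (rwh Cat A B C \<beta> F) = comp_ftr A (NCod \<beta>) F"
  by (simp_all add: lwh_def rwh_def)

lemma lwh_Cat_at:
  assumes "category B" "category C" "cat_functor B C G" "nat_trans A B \<alpha>" "x \<in> Ob A"
  shows "NAt (lwh Cat A B C G \<alpha>) x = FAr G (NAt \<alpha> x)"
  using assms(1,2,5) functor_arr[OF assms(3)] nat_trans_arr(1-5)[OF assms(4)]
    functor_arr[OF nat_trans_arr(2)[OF assms(4)]]
  by (simp add: lwh_def)

lemma rwh_Cat_at:
  assumes "category B" "category C" "cat_functor A B F" "nat_trans B C \<beta>" "x \<in> Ob A"
  shows "NAt (rwh Cat A B C \<beta> F) x = NAt \<beta> (FOb F x)"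
  using assms(1,2,5) functor_arr[OF assms(3)] nat_trans_arr(1-5)[OF assms(4)]
    functor_arr[OF nat_trans_arr(1)[OF assms(4)]]
  by (simp add: rwh_def)

lemma nat_trans_lwh:
  "category A \<Longrightarrow> category B \<Longrightarrow> category C \<Longrightarrow> cat_functor B C G \<Longrightarrow> nat_trans A B \<alpha> \<Longrightarrow>
    nat_trans A C (lwh Cat A B C G \<alpha>)"
  unfolding lwh_def Cat_simps by (intro nat_trans_hcomp[of A B C] nat_trans_Ide)

lemma nat_trans_rwh:
  "category A \<Longrightarrow> category B \<Longrightarrow> category C \<Longrightarrow> cat_functor A B F \<Longrightarrow> nat_trans B C \<beta> \<Longrightarrow>
    nat_trans A C (rwh Cat A B C \<beta> F)"
  unfolding rwh_def Cat_simps by (intro nat_trans_hcomp[of A B C] nat_trans_Ide)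

section \<open>2-categories\<close>

context two_category
begin

lemmas hom_category [simp] = hom_category
lemmas one_closed [simp] = one_closed
lemmas hc1_closed [simp] = hc1_closed

lemma HC2_arr [simp]:
  assumes "X \<in> Obj K" "Y \<in> Obj K" "Z \<in> Obj K" "\<alpha> \<in> Ar (Hom K X Y)" "\<beta> \<in> Ar (Hom K Y Z)"
  shows "HC2 K X Y Z \<beta> \<alpha> \<in> Ar (Hom K X Z)"
    "Dom (Hom K X Z) (HC2 K X Y Z \<beta> \<alpha>) = HC1 K X Y Z (Dom (Hom K Y Z) \<beta>) (Dom (Hom K X Y) \<alpha>)"
    "Cod (Hom K X Z) (HC2 K X Y Z \<beta> \<alpha>) = HC1 K X Y Z (Cod (Hom K Y Z) \<beta>) (Cod (Hom K X Y) \<alpha>)"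
  using hc2_closed[of X Y Z \<alpha> "Dom (Hom K X Y) \<alpha>" "Cod (Hom K X Y) \<alpha>" \<beta>
      "Dom (Hom K Y Z) \<beta>" "Cod (Hom K Y Z) \<beta>"] assms
  by (auto simp: in_hom)

lemma HC2_Comp:
  assumes "X \<in> Obj K" "Y \<in> Obj K" "Z \<in> Obj K" "\<alpha> \<in> Ar (Hom K X Y)" "\<beta> \<in> Ar (Hom K Y Z)"
    "\<alpha>' \<in> Ar (Hom K X Y)" "\<beta>' \<in> Ar (Hom K Y Z)"
    "Cod (Hom K X Y) \<alpha> = Dom (Hom K X Y) \<alpha>'" "Cod (Hom K Y Z) \<beta> = Dom (Hom K Y Z) \<beta>'"
  shows "HC2 K X Y Z (\<beta>' \<cdot>[Hom K Y Z] \<beta>) (\<alpha>' \<cdot>[Hom K X Y] \<alpha>)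
    = HC2 K X Y Z \<beta>' \<alpha>' \<cdot>[Hom K X Z] HC2 K X Y Z \<beta> \<alpha>"
  by (rule interchange) (use assms in \<open>auto simp: in_hom\<close>)

lemma lwh_arr [simp]:
  assumes "X \<in> Obj K" "Y \<in> Obj K" "Z \<in> Obj K" "\<alpha> \<in> Ar (Hom K X Y)" "g \<in> Ob (Hom K Y Z)"
  shows "lwh K X Y Z g \<alpha> \<in> Ar (Hom K X Z)"
    "Dom (Hom K X Z) (lwh K X Y Z g \<alpha>) = HC1 K X Y Z g (Dom (Hom K X Y) \<alpha>)"
    "Cod (Hom K X Z) (lwh K X Y Z g \<alpha>) = HC1 K X Y Z g (Cod (Hom K X Y) \<alpha>)"
  using assms by (simp_all add: lwh_def)

lemma rwh_arr [simp]:
  assumes "X \<in> Obj K" "Y \<in> Obj K" "Z \<in> Obj K" "f \<in> Ob (Hom K X Y)" "\<beta> \<in> Ar (Hom K Y Z)"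
  shows "rwh K X Y Z \<beta> f \<in> Ar (Hom K X Z)"
    "Dom (Hom K X Z) (rwh K X Y Z \<beta> f) = HC1 K X Y Z (Dom (Hom K Y Z) \<beta>) f"
    "Cod (Hom K X Z) (rwh K X Y Z \<beta> f) = HC1 K X Y Z (Cod (Hom K Y Z) \<beta>) f"
  using assms by (simp_all add: rwh_def)

lemma lwh_Ide [simp]:
  "X \<in> Obj K \<Longrightarrow> Y \<in> Obj K \<Longrightarrow> Z \<in> Obj K \<Longrightarrow> f \<in> Ob (Hom K X Y) \<Longrightarrow> g \<in> Ob (Hom K Y Z) \<Longrightarrow>
    lwh K X Y Z g (Ide (Hom K X Y) f) = Ide (Hom K X Z) (HC1 K X Y Z g f)"
  by (simp add: lwh_def hc2_ide)

lemma rwh_Ide [simp]: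
  "X \<in> Obj K \<Longrightarrow> Y \<in> Obj K \<Longrightarrow> Z \<in> Obj K \<Longrightarrow> f \<in> Ob (Hom K X Y) \<Longrightarrow> g \<in> Ob (Hom K Y Z) \<Longrightarrow>
    rwh K X Y Z (Ide (Hom K Y Z) g) f = Ide (Hom K X Z) (HC1 K X Y Z g f)"
  by (simp add: rwh_def hc2_ide)

lemma lwh_Comp:
  assumes "X \<in> Obj K" "Y \<in> Obj K" "Z \<in> Obj K" "\<alpha> \<in> Ar (Hom K X Y)" "\<alpha>' \<in> Ar (Hom K X Y)"
    "Cod (Hom K X Y) \<alpha> = Dom (Hom K X Y) \<alpha>'" "g \<in> Ob (Hom K Y Z)"
  shows "lwh K X Y Z g (\<alpha>' \<cdot>[Hom K X Y] \<alpha>) = lwh K X Y Z g \<alpha>' \<cdot>[Hom K X Z] lwh K X Y Z g \<alpha>"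
  using HC2_Comp[of X Y Z \<alpha> "Ide (Hom K Y Z) g" \<alpha>' "Ide (Hom K Y Z) g"] assms
  by (simp add: lwh_def)

lemma rwh_Comp:
  assumes "X \<in> Obj K" "Y \<in> Obj K" "Z \<in> Obj K" "\<beta> \<in> Ar (Hom K Y Z)" "\<beta>' \<in> Ar (Hom K Y Z)"
    "Cod (Hom K Y Z) \<beta> = Dom (Hom K Y Z) \<beta>'" "f \<in> Ob (Hom K X Y)"
  shows "rwh K X Y Z (\<beta>' \<cdot>[Hom K Y Z] \<beta>) f = rwh K X Y Z \<beta>' f \<cdot>[Hom K X Z] rwh K X Y Z \<beta> f"
  using HC2_Comp[of X Y Z "Ide (Hom K X Y) f" \<beta> "Ide (Hom K X Y) f" \<beta>'] assms
  by (simp add: rwh_def)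

text \<open>The two ways of building a horizontal composite from whiskerings; that they agree is the
  naturality of whiskering.\<close>

lemma HC2_whisker:
  assumes "X \<in> Obj K" "Y \<in> Obj K" "Z \<in> Obj K" "\<alpha> \<in> Ar (Hom K X Y)" "\<beta> \<in> Ar (Hom K Y Z)"
  shows "rwh K X Y Z \<beta> (Cod (Hom K X Y) \<alpha>) \<cdot>[Hom K X Z] lwh K X Y Z (Dom (Hom K Y Z) \<beta>) \<alpha> = HC2 K X Y Z \<beta> \<alpha>"
    "lwh K X Y Z (Cod (Hom K Y Z) \<beta>) \<alpha> \<cdot>[Hom K X Z] rwh K X Y Z \<beta> (Dom (Hom K X Y) \<alpha>) = HC2 K X Y Z \<beta> \<alpha>"
  using HC2_Comp[of X Y Z \<alpha> "Ide (Hom K Y Z) (Dom (Hom K Y Z) \<beta>)" "Ide (Hom K X Y) (Cod (Hom K X Y) \<alpha>)" \<beta>]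
    HC2_Comp[of X Y Z "Ide (Hom K X Y) (Dom (Hom K X Y) \<alpha>)" \<beta> \<alpha> "Ide (Hom K Y Z) (Cod (Hom K Y Z) \<beta>)"] assms
  by (simp_all add: rwh_def lwh_def)

lemma lwh_iso [simp]:
  assumes "X \<in> Obj K" "Y \<in> Obj K" "Z \<in> Obj K" "is_iso (Hom K X Y) \<alpha>" "g \<in> Ob (Hom K Y Z)"
  shows "is_iso (Hom K X Z) (lwh K X Y Z g \<alpha>)"
proof -
  note [simp] = assms is_iso_arr[OF assms(4)]
  show ?thesis
    by (rule is_isoI[where g = "lwh K X Y Z g (inv_in (Hom K X Y) \<alpha>)"])
      (simp_all flip: lwh_Comp)
qed

end

lemma op2_simps [simp]:
  "Obj (op2 K) = Obj K" "Hom (op2 K) X Y = Hom K Y X" "One (op2 K) = One K"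
  "HC1 (op2 K) X Y Z g f = HC1 K Z Y X f g" "HC2 (op2 K) X Y Z \<beta> \<alpha> = HC2 K Z Y X \<alpha> \<beta>"
  "lwh (op2 K) X Y Z g \<alpha> = rwh K Z Y X \<alpha> g" "rwh (op2 K) X Y Z \<beta> f = lwh K Z Y X f \<beta>"
  by (simp_all add: op2_def lwh_def rwh_def)

lemma two_category_op2: "two_category K \<Longrightarrow> two_category (op2 K)"
proof -
  assume "two_category K"
  then interpret two_category K .
  show ?thesis
    by (rule two_category.intro)
      (auto simp: hc2_ide hc1_assoc hc2_assoc hc1_one one_hc1 hc2_one one_hc2
        intro: interchange hc2_closed)
qed

section \<open>Bi-initial objects\<close>

lemma pslice_simps [simp]:
  "(X, f) \<in> Obj (pslice K I) \<longleftrightarrow> X \<in> Obj K \<and> f \<in> Ob (Hom K I X)"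
  "Hom (pslice K I) = pslice_hom K I"
  "One (pslice K I) (X, f) = (One K X, Ide (Hom K I X) f)"
  "HC1 (pslice K I) = pslice_comp K I"
  "HC2 (pslice K I) p q r \<beta>' \<beta> = \<lparr>
       Src = pslice_comp K I p q r (Src \<beta>') (Src \<beta>),
       Tgt = pslice_comp K I p q r (Tgt \<beta>') (Tgt \<beta>),
       Und = HC2 K (fst p) (fst q) (fst r) (Und \<beta>') (Und \<beta>)\<rparr>"
  by (simp_all add: pslice_def)

lemma pslice_comp_simp [simp]:
  "pslice_comp K I (X, f) (X', f') (X'', f'') (a', \<psi>') (a, \<psi>) =
     (HC1 K X X' X'' a' a, lwh K I X' X'' a' \<psi> \<cdot>[Hom K I X''] \<psi>')"
  by (simp add: pslice_comp_def)

lemma pslice_hom_simps [simp]: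
  "(a, \<psi>) \<in> Ob (pslice_hom K I (X, f) (X', f')) \<longleftrightarrow>
     a \<in> Ob (Hom K X X') \<and> iso_in (Hom K I X') f' (HC1 K I X X' a f) \<psi>"
  "\<beta> \<in> Ar (pslice_hom K I (X, f) (X', f')) \<longleftrightarrow>
     Src \<beta> \<in> Ob (pslice_hom K I (X, f) (X', f')) \<and> Tgt \<beta> \<in> Ob (pslice_hom K I (X, f) (X', f')) \<and>
     Und \<beta> \<in> hom (Hom K X X') (fst (Src \<beta>)) (fst (Tgt \<beta>)) \<and>
     rwh K I X X' (Und \<beta>) f \<cdot>[Hom K I X'] snd (Src \<beta>) = snd (Tgt \<beta>)"
  "Dom (pslice_hom K I (X, f) (X', f')) = Src" "Cod (pslice_hom K I (X, f) (X', f')) = Tgt"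
  "Ide (pslice_hom K I (X, f) (X', f')) s = \<lparr>Src = s, Tgt = s, Und = Ide (Hom K X X') (fst s)\<rparr>"
  "\<beta>' \<cdot>[pslice_hom K I (X, f) (X', f')] \<beta> = \<lparr>Src = Src \<beta>, Tgt = Tgt \<beta>', Und = Und \<beta>' \<cdot>[Hom K X X'] Und \<beta>\<rparr>"
  by (auto simp: pslice_hom_def Let_def)

lemma pslice_proj_simps [simp]:
  "TO (pslice_proj K I) = fst"
  "s \<in> Ob (pslice_hom K I p q) \<Longrightarrow> FOb (TF (pslice_proj K I) p q) s = fst s"
  "\<beta> \<in> Ar (pslice_hom K I p q) \<Longrightarrow> FAr (TF (pslice_proj K I) p q) \<beta> = Und \<beta>"
  "FOb (TF (pslice_proj K I) p q) \<in> extensional (Ob (pslice_hom K I p q))"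
  "FAr (TF (pslice_proj K I) p q) \<in> extensional (Ar (pslice_hom K I p q))"
  by (simp_all add: pslice_proj_def)

context two_category
begin

lemma pslice_comp_closed:
  assumes p: "(X, f) \<in> Obj (pslice K I)" "(X', f') \<in> Obj (pslice K I)" "(X'', f'') \<in> Obj (pslice K I)"
    and I: "I \<in> Obj K"
    and s: "s \<in> Ob (pslice_hom K I (X, f) (X', f'))" "s' \<in> Ob (pslice_hom K I (X', f') (X'', f''))"
  shows "pslice_comp K I (X, f) (X', f') (X'', f'') s' s \<in> Ob (pslice_hom K I (X, f) (X'', f''))"
  using assms by (cases s; cases s') (auto simp: iso_in_iff hc1_assoc)

lemma rwh_HC2:
  assumes "W \<in> Obj K" "X \<in> Obj K" "Y \<in> Obj K" "Z \<in> Obj K" "f \<in> Ob (Hom K W X)"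
    "\<alpha> \<in> Ar (Hom K X Y)" "\<beta> \<in> Ar (Hom K Y Z)"
  shows "rwh K W X Z (HC2 K X Y Z \<beta> \<alpha>) f = HC2 K W Y Z \<beta> (rwh K W X Y \<alpha> f)"
  using assms by (simp add: rwh_def hc2_assoc)

text \<open>By interchange, both \<open>(\<beta>' * \<beta>) f\<close> after \<open>a' \<psi>\<close> and \<open>b' \<phi>\<close> after \<open>\<beta>' f'\<close> are the
  horizontal composite of \<open>\<beta>'\<close> with \<open>\<phi>\<close>.\<close>

lemma pslice_hc2_closed:
  assumes p: "(X, f) \<in> Obj (pslice K I)" "(X', f') \<in> Obj (pslice K I)" "(X'', f'') \<in> Obj (pslice K I)"
    and I: "I \<in> Obj K"
    and \<beta>: "\<beta> \<in> Ar (pslice_hom K I (X, f) (X', f'))" "\<beta>' \<in> Ar (pslice_hom K I (X', f') (X'', f''))"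
  shows "HC2 (pslice K I) (X, f) (X', f') (X'', f'') \<beta>' \<beta> \<in> Ar (pslice_hom K I (X, f) (X'', f''))"
proof -
  obtain a \<psi> b \<phi> where ab: "Src \<beta> = (a, \<psi>)" "Tgt \<beta> = (b, \<phi>)" by fastforce
  obtain a' \<psi>' b' \<phi>' where ab': "Src \<beta>' = (a', \<psi>')" "Tgt \<beta>' = (b', \<phi>')" by fastforce
  note [simp] = ab ab' I
  have [simp]: "X \<in> Obj K" "X' \<in> Obj K" "X'' \<in> Obj K" "f \<in> Ob (Hom K I X)" "f' \<in> Ob (Hom K I X')"
      "f'' \<in> Ob (Hom K I X'')"
    using p by auto
  have [simp]: "a \<in> Ob (Hom K X X')" "b \<in> Ob (Hom K X X')" "\<psi> \<in> Ar (Hom K I X')"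
      "Dom (Hom K I X') \<psi> = f'" "Cod (Hom K I X') \<psi> = HC1 K I X X' a f"
      "\<phi> \<in> Ar (Hom K I X')"
      "Dom (Hom K I X') \<phi> = f'" "Cod (Hom K I X') \<phi> = HC1 K I X X' b f"
      "Und \<beta> \<in> Ar (Hom K X X')" "Dom (Hom K X X') (Und \<beta>) = a" "Cod (Hom K X X') (Und \<beta>) = b"
    and eq: "rwh K I X X' (Und \<beta>) f \<cdot>[Hom K I X'] \<psi> = \<phi>"
    using \<beta>(1) by (auto simp: iso_in_iff in_hom)
  have [simp]: "a' \<in> Ob (Hom K X' X'')" "b' \<in> Ob (Hom K X' X'')" "\<psi>' \<in> Ar (Hom K I X'')"
      "Dom (Hom K I X'') \<psi>' = f''" "Cod (Hom K I X'') \<psi>' = HC1 K I X' X'' a' f'"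
      "Und \<beta>' \<in> Ar (Hom K X' X'')" "Dom (Hom K X' X'') (Und \<beta>') = a'" "Cod (Hom K X' X'') (Und \<beta>') = b'"
    and eq': "rwh K I X' X'' (Und \<beta>') f' \<cdot>[Hom K I X''] \<psi>' = \<phi>'"
    using \<beta>(2) by (auto simp: iso_in_iff in_hom)
  have 1: "rwh K I X X'' (HC2 K X X' X'' (Und \<beta>') (Und \<beta>)) f \<cdot>[Hom K I X''] lwh K I X' X'' a' \<psi>
      = HC2 K I X' X'' (Und \<beta>') \<phi>"
    using HC2_Comp[of I X' X'' \<psi> "Ide (Hom K X' X'') a'" "rwh K I X X' (Und \<beta>) f" "Und \<beta>'"]
    by (simp add: rwh_HC2 eq lwh_def)
  have 2: "lwh K I X' X'' b' \<phi> \<cdot>[Hom K I X''] rwh K I X' X'' (Und \<beta>') f' = HC2 K I X' X'' (Und \<beta>') \<phi>"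
    using HC2_whisker(2)[of I X' X'' \<phi> "Und \<beta>'"] by simp
  have "rwh K I X X'' (HC2 K X X' X'' (Und \<beta>') (Und \<beta>)) f \<cdot>[Hom K I X''] (lwh K I X' X'' a' \<psi> \<cdot>[Hom K I X''] \<psi>')
      = lwh K I X' X'' b' \<phi> \<cdot>[Hom K I X''] \<phi>'"
    by (simp add: comp_extend[OF 1] comp_extend[OF 2] hc1_assoc flip: eq')
  moreover have "pslice_comp K I (X, f) (X', f') (X'', f'') (Src \<beta>') (Src \<beta>) \<in> Ob (pslice_hom K I (X, f) (X'', f''))"
    by (rule pslice_comp_closed[OF p I]) (use \<beta> in auto)
  moreover have "pslice_comp K I (X, f) (X', f') (X'', f'') (Tgt \<beta>') (Tgt \<beta>) \<in> Ob (pslice_hom K I (X, f) (X'', f''))"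
    by (rule pslice_comp_closed[OF p I]) (use \<beta> in auto)
  ultimately show ?thesis
    by (auto simp: in_hom)
qed

lemma two_functor_pslice_proj:
  assumes I: "I \<in> Obj K"
  shows "two_functor (pslice K I) K (pslice_proj K I)"
proof -
  let ?S = "pslice K I" and ?P = "pslice_proj K I"
  show ?thesis
  proof (rule two_functor.intro)
  fix p assume p: "p \<in> Obj ?S"
  then obtain X f where pX: "p = (X, f)" "X \<in> Obj K" "f \<in> Ob (Hom K I X)" by (cases p) auto
  then show "TO ?P p \<in> Obj K" by simp
  have "One ?S p \<in> Ob (pslice_hom K I p p)"
    using pX I by (auto simp: iso_in_iff one_hc1)
  then show "FOb (TF ?P p p) (One ?S p) = One K (TO ?P p)"
    using pX by simp
next
  fix p q assume "p \<in> Obj ?S" "q \<in> Obj ?S"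
  then obtain X f X' f' where pX: "p = (X, f)" "X \<in> Obj K" "f \<in> Ob (Hom K I X)"
    "q = (X', f')" "X' \<in> Obj K" "f' \<in> Ob (Hom K I X')" by (cases p; cases q) auto
  show "cat_functor (Hom ?S p q) (Hom K (TO ?P p) (TO ?P q))
      (TF ?P p q)"
  proof (rule functorI)
    fix s assume s: "s \<in> Ob (Hom ?S p q)"
    then show "FOb (TF ?P p q) s \<in> Ob (Hom K (TO ?P p) (TO ?P q))"
      using pX by (cases s) auto
    have "Ide (Hom ?S p q) s \<in> Ar (Hom ?S p q)"
      using pX s I by (cases s) (auto simp: in_hom iso_in_iff)
    then show "FAr (TF ?P p q) (Ide (Hom ?S p q) s) =
         Ide (Hom K (TO ?P p) (TO ?P q)) (FOb (TF ?P p q) s)"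
      using pX s by simp
  next
    fix \<beta> \<beta>' assume \<beta>: "\<beta> \<in> Ar (Hom ?S p q)" "\<beta>' \<in> Ar (Hom ?S p q)"
      "Cod (Hom ?S p q) \<beta> = Dom (Hom ?S p q) \<beta>'"
    obtain a \<psi> b \<phi> c \<chi> where ab: "Src \<beta> = (a, \<psi>)" "Tgt \<beta> = (b, \<phi>)" "Tgt \<beta>' = (c, \<chi>)" by fastforce
    have [simp]: "Src \<beta>' = (b, \<phi>)" using \<beta>(3) ab pX by simp
    have 1: "rwh K I X X' (Und \<beta>) f \<cdot>[Hom K I X'] \<psi> = \<phi>" "rwh K I X X' (Und \<beta>') f \<cdot>[Hom K I X'] \<phi> = \<chi>"
      using \<beta> ab pX by auto
    have [simp]: "X \<in> Obj K" "X' \<in> Obj K" "I \<in> Obj K" "f \<in> Ob (Hom K I X)"  "Und \<beta> \<in> Ar (Hom K X X')"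
      "Und \<beta>' \<in> Ar (Hom K X X')" "Cod (Hom K X X') (Und \<beta>) = b" "Dom (Hom K X X') (Und \<beta>') = b"
      "\<psi> \<in> Ar (Hom K I X')" "Cod (Hom K I X') \<psi> = HC1 K I X X' a f" "Dom (Hom K X X') (Und \<beta>) = a"
      using \<beta> ab pX I by (auto simp: in_hom iso_in_iff)
    have "rwh K I X X' (Und \<beta>' \<cdot>[Hom K X X'] Und \<beta>) f \<cdot>[Hom K I X'] \<psi> = \<chi>"
      by (simp add: rwh_Comp 1)
    then have "\<beta>' \<cdot>[Hom ?S p q] \<beta> \<in> Ar (Hom ?S p q)"
      using pX \<beta> ab by (auto simp: in_hom)
    then show "FAr (TF ?P p q) (\<beta>' \<cdot>[Hom ?S p q] \<beta>) =
        FAr (TF ?P p q) \<beta>'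
          \<cdot>[Hom K (TO ?P p) (TO ?P q)] FAr (TF ?P p q) \<beta>"
      using pX \<beta> by simp
  qed (use pX in \<open>auto simp: in_hom\<close>)
next
  fix p q r assume *: "p \<in> Obj ?S" "q \<in> Obj ?S" "r \<in> Obj ?S"
  then obtain X f X' f' X'' f'' where pX: "p = (X, f)" "q = (X', f')" "r = (X'', f'')" by fastforce
    fix s s' assume s: "s \<in> Ob (Hom ?S p q)" "s' \<in> Ob (Hom ?S q r)"
    then have "HC1 ?S p q r s' s \<in> Ob (Hom ?S p r)"
      using pslice_comp_closed I * unfolding pX by auto
    then show "FOb (TF ?P p r) (HC1 ?S p q r s' s) =
        HC1 K (TO ?P p) (TO ?P q) (TO ?P r)
          (FOb (TF ?P q r) s') (FOb (TF ?P p q) s)"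
      using pX s by (cases s; cases s') simp
next
  fix p q r assume *: "p \<in> Obj ?S" "q \<in> Obj ?S" "r \<in> Obj ?S"
  then obtain X f X' f' X'' f'' where pX: "p = (X, f)" "q = (X', f')" "r = (X'', f'')" by fastforce
    fix \<beta> \<beta>' assume \<beta>: "\<beta> \<in> Ar (Hom ?S p q)" "\<beta>' \<in> Ar (Hom ?S q r)"
    then have "HC2 ?S p q r \<beta>' \<beta> \<in> Ar (Hom ?S p r)"
      using pslice_hc2_closed I * unfolding pX by (simp only: pslice_simps(2))
    then show "FAr (TF ?P p r) (HC2 ?S p q r \<beta>' \<beta>) =
        HC2 K (TO ?P p) (TO ?P q) (TO ?P r)
          (FAr (TF ?P q r) \<beta>') (FAr (TF ?P p q) \<beta>)"
      using pX \<beta> by (simp del: pslice_hom_simps)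
qed
qed

text \<open>The hom-categories out of a bi-initial object are equivalent to the terminal category.
  Fullness of the projection on morphisms, applied to \<open>g : I \<rightarrow> X\<close> between the objects \<open>(I, id)\<close>
  and \<open>(X, f)\<close> of the slice, gives an invertible \<open>\<psi> : f \<Rightarrow> g\<close>. Every \<open>\<beta> : f \<Rightarrow> g\<close> underlies a
  2-morphism of the slice from \<open>(f, id)\<close> to \<open>(g, \<psi>)\<close>, and the equation which that 2-morphism
  satisfies is \<open>\<beta> = \<psi>\<close>. Conversely, if parallel 2-morphisms out of \<open>I\<close> exist and are unique, then
  they are invertible, they provide the lifts of morphisms, and all equations between them hold.\<close>

lemma bi_initial_iff:
  assumes I: "I \<in> Obj K"
  shows "bi_initial K I \<longleftrightarrow> (\<forall>X \<in> Obj K. Ob (Hom K I X) \<noteq> {} \<and>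
    (\<forall>f \<in> Ob (Hom K I X). \<forall>g \<in> Ob (Hom K I X). \<exists>!\<beta>. \<beta> \<in> hom (Hom K I X) f g))"
    (is "_ \<longleftrightarrow> ?R")
proof -
  let ?S = "pslice K I" and ?P = "pslice_proj K I" and ?H = "pslice_hom K I"
  show ?thesis
  proof
  assume "bi_initial K I"
  then have triv: "trivial_fibration ?S K ?P"
    by (simp add: bi_initial_def)
  then have surj: "\<exists>p \<in> Obj ?S. fst p = X" if "X \<in> Obj K" for X
    using that by (simp add: trivial_fibration_def)
  have full: "\<exists>s \<in> Ob (?H (X, f) (X', f')). fst s = g"
    if "(X, f) \<in> Obj ?S" "(X', f') \<in> Obj ?S" "g \<in> Ob (Hom K X X')" for X f X' f' g
  proof -
    have "\<exists>s \<in> Ob (?H (X, f) (X', f')). FOb (TF ?P (X, f) (X', f')) s = g"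
      using triv that unfolding trivial_fibration_def pslice_proj_simps(1) pslice_simps(2)
      by (metis fst_conv)
    then show ?thesis using pslice_proj_simps(2) by metis
  qed
  have ff: "bij_betw (FAr (TF ?P (X, f) (X', f')))
        (hom (?H (X, f) (X', f')) s s') (hom (Hom K X X') (fst s) (fst s'))"
    if "(X, f) \<in> Obj ?S" "(X', f') \<in> Obj ?S"
      "s \<in> Ob (?H (X, f) (X', f'))" "s' \<in> Ob (?H (X, f) (X', f'))" for X f X' f' s s'
    using triv that unfolding trivial_fibration_def pslice_proj_simps(1) pslice_simps(2)
    by (metis fst_conv pslice_proj_simps(2))
  show ?R
  proof (intro ballI conjI)
    fix X assume X [simp]: "X \<in> Obj K"
    then show "Ob (Hom K I X) \<noteq> {}" using surj[OF X] by auto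
    fix f g assume f [simp]: "f \<in> Ob (Hom K I X)" and g [simp]: "g \<in> Ob (Hom K I X)"
    note [simp] = I
    obtain \<psi> where \<psi>: "iso_in (Hom K I X) f g \<psi>"
      using full[of I "One K I" X f g] by (auto simp: hc1_one)
    have "\<beta> = \<psi>" if "\<beta> \<in> hom (Hom K I X) f g" for \<beta>
    proof -
      have "(f, Ide (Hom K I X) f) \<in> Ob (?H (I, One K I) (X, f))"
          "(g, \<psi>) \<in> Ob (?H (I, One K I) (X, f))"
        using \<psi> by (auto simp: hc1_one iso_in_iff)
      then have "bij_betw (FAr (TF ?P (I, One K I) (X, f)))
          (hom (?H (I, One K I) (X, f)) (f, Ide (Hom K I X) f) (g, \<psi>)) (hom (Hom K I X) f g)"
        using ff[of I "One K I" X f "(f, Ide (Hom K I X) f)" "(g, \<psi>)"] by simp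
      then have "\<beta> \<in> FAr (TF ?P (I, One K I) (X, f)) `
          hom (?H (I, One K I) (X, f)) (f, Ide (Hom K I X) f) (g, \<psi>)"
        using that by (simp only: bij_betw_def)
      then obtain \<beta>' where \<beta>': "\<beta>' \<in> hom (?H (I, One K I) (X, f)) (f, Ide (Hom K I X) f) (g, \<psi>)"
          "FAr (TF ?P (I, One K I) (X, f)) \<beta>' = \<beta>"
        by blast
      moreover have "\<beta>' \<in> Ar (?H (I, One K I) (X, f))" using \<beta>'(1) by (simp only: in_hom)
      ultimately have "\<beta>' \<in> Ar (?H (I, One K I) (X, f))" "Und \<beta>' = \<beta>"
          "Src \<beta>' = (f, Ide (Hom K I X) f)" "Tgt \<beta>' = (g, \<psi>)"
        by (simp_all only: in_hom pslice_hom_simps(3,4) pslice_proj_simps(3))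
      then have "rwh K I I X \<beta> (One K I) = \<psi>"
        using that by (auto simp: in_hom hc1_one)
      then show ?thesis
        using that by (auto simp: rwh_def hc2_one in_hom)
    qed
    then show "\<exists>!\<beta>. \<beta> \<in> hom (Hom K I X) f g"
      using \<psi> by (auto simp: iso_in_def)
  qed
next
  assume R: ?R
  have iso: "iso_in (Hom K I X) f g \<beta>" if "\<beta> \<in> hom (Hom K I X) f g" "X \<in> Obj K" for X f g \<beta>
  proof -
    have [simp]: "f \<in> Ob (Hom K I X)" "g \<in> Ob (Hom K I X)" "X \<in> Obj K" "I \<in> Obj K" and
      \<beta> [simp]: "\<beta> \<in> Ar (Hom K I X)" "Dom (Hom K I X) \<beta> = f" "Cod (Hom K I X) \<beta> = g"
      using that I by (auto simp: in_hom)
    obtain \<gamma> where \<gamma> [simp]: "\<gamma> \<in> Ar (Hom K I X)" "Dom (Hom K I X) \<gamma> = g" "Cod (Hom K I X) \<gamma> = f"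
    proof -
      have "\<exists>!\<delta>. \<delta> \<in> hom (Hom K I X) g f" using R by auto
      then show thesis using that by (auto simp: in_hom)
    qed
    have "\<exists>!\<delta>. \<delta> \<in> hom (Hom K I X) f f" "\<exists>!\<delta>. \<delta> \<in> hom (Hom K I X) g g"
      using R by auto
    moreover have "\<gamma> \<cdot>[Hom K I X] \<beta> \<in> hom (Hom K I X) f f" "Ide (Hom K I X) f \<in> hom (Hom K I X) f f"
       "\<beta> \<cdot>[Hom K I X] \<gamma> \<in> hom (Hom K I X) g g" "Ide (Hom K I X) g \<in> hom (Hom K I X) g g"
      by (simp_all add: in_hom)
    ultimately have "\<gamma> \<cdot>[Hom K I X] \<beta> = Ide (Hom K I X) f" "\<beta> \<cdot>[Hom K I X] \<gamma> = Ide (Hom K I X) g"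
      by auto
    then show ?thesis
      unfolding iso_in_def using that(1) \<gamma> by (auto simp: in_hom intro!: bexI[of _ \<gamma>])
  qed
  have "trivial_fibration ?S K ?P"
    unfolding trivial_fibration_def
  proof (intro conjI ballI)
    show "two_functor ?S K ?P"
      by (rule two_functor_pslice_proj[OF I])
  next
    fix X assume X: "X \<in> Obj K"
    then obtain f where "f \<in> Ob (Hom K I X)" using R by blast
    then show "\<exists>p\<in>Obj ?S. TO ?P p = X"
      using X by (intro bexI[of _ "(X, f)"]) auto
  next
    fix p q g
    assume "p \<in> Obj ?S" "q \<in> Obj ?S"
      and g: "g \<in> Ob (Hom K (TO ?P p) (TO ?P q))"
    then obtain X f X' f' where pX: "p = (X, f)" "X \<in> Obj K" "f \<in> Ob (Hom K I X)"
      "q = (X', f')" "X' \<in> Obj K" "f' \<in> Ob (Hom K I X')" by (cases p; cases q) auto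
    then have "HC1 K I X X' g f \<in> Ob (Hom K I X')" using g I by simp
    then obtain \<psi> where "\<psi> \<in> hom (Hom K I X') f' (HC1 K I X X' g f)" using R pX by blast
    then have "(g, \<psi>) \<in> Ob (?H (X, f) (X', f'))" using iso pX g by simp
    then show "\<exists>s\<in>Ob (Hom ?S p q). FOb (TF ?P p q) s = g"
      using pX by (intro bexI[of _ "(g, \<psi>)"]) (simp_all del: pslice_hom_simps)
  next
    fix p q s s'
    assume "p \<in> Obj ?S" "q \<in> Obj ?S"
    then obtain X f X' f' where pX: "p = (X, f)" "X \<in> Obj K" "f \<in> Ob (Hom K I X)"
      "q = (X', f')" "X' \<in> Obj K" "f' \<in> Ob (Hom K I X')" by (cases p; cases q) auto
    assume s: "s \<in> Ob (Hom ?S p q)" "s' \<in> Ob (Hom ?S p q)"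
    obtain a \<psi> b \<phi> where ab: "s = (a, \<psi>)" "s' = (b, \<phi>)" by fastforce
    have [simp]: "X \<in> Obj K" "X' \<in> Obj K" "I \<in> Obj K" "f \<in> Ob (Hom K I X)" "f' \<in> Ob (Hom K I X')"
      "a \<in> Ob (Hom K X X')" "b \<in> Ob (Hom K X X')"
      "\<psi> \<in> Ar (Hom K I X')" "Dom (Hom K I X') \<psi> = f'" "Cod (Hom K I X') \<psi> = HC1 K I X X' a f"
      "\<phi> \<in> Ar (Hom K I X')" "Dom (Hom K I X') \<phi> = f'" "Cod (Hom K I X') \<phi> = HC1 K I X X' b f"
      using s pX ab I by (auto simp: iso_in_iff)
    have "\<exists>!\<delta>. \<delta> \<in> hom (Hom K I X') f' (HC1 K I X X' b f)" using R by auto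
    then have eq: "rwh K I X X' \<beta> f \<cdot>[Hom K I X'] \<psi> = \<phi>"
      if "\<beta> \<in> Ar (Hom K X X')" "Dom (Hom K X X') \<beta> = a" "Cod (Hom K X X') \<beta> = b" for \<beta>
      using that by (auto simp: in_hom)
    have lift: "\<lparr>Src = s, Tgt = s', Und = \<beta>\<rparr> \<in> Ar (Hom ?S p q)"
      if "\<beta> \<in> Ar (Hom K X X')" "Dom (Hom K X X') \<beta> = a" "Cod (Hom K X X') \<beta> = b" for \<beta>
      using s that eq[OF that] by (auto simp: ab pX in_hom)
    have FAr: "FAr (TF ?P p q) \<beta> = Und \<beta>" if "\<beta> \<in> hom (Hom ?S p q) s s'" for \<beta>
      using that by (simp add: in_hom)
    have "bij_betw (FAr (TF ?P p q)) (hom (Hom ?S p q) s s') (hom (Hom K X X') a b)"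
    proof (rule bij_betwI[where g = "\<lambda>\<beta>. \<lparr>Src = s, Tgt = s', Und = \<beta>\<rparr>"])
      have "Und \<beta> \<in> hom (Hom K X X') a b" if "\<beta> \<in> hom (Hom ?S p q) s s'" for \<beta>
        using that by (auto simp: in_hom pX ab)
      then show "FAr (TF ?P p q) \<in> hom (Hom ?S p q) s s' \<rightarrow> hom (Hom K X X') a b"
        using FAr by auto
      have into: "\<lparr>Src = s, Tgt = s', Und = \<beta>\<rparr> \<in> hom (Hom ?S p q) s s'" if "\<beta> \<in> hom (Hom K X X') a b" for \<beta>
        using lift[of \<beta>] that by (auto simp: in_hom) (auto simp: pX)
      then show "(\<lambda>\<beta>. \<lparr>Src = s, Tgt = s', Und = \<beta>\<rparr>) \<in> hom (Hom K X X') a b \<rightarrow> hom (Hom ?S p q) s s'" by blast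
      show "\<lparr>Src = s, Tgt = s', Und = FAr (TF ?P p q) \<beta>\<rparr> = \<beta>" if "\<beta> \<in> hom (Hom ?S p q) s s'" for \<beta>
        using FAr[OF that] that by (auto simp: in_hom pX)
      show "FAr (TF ?P p q) \<lparr>Src = s, Tgt = s', Und = \<beta>\<rparr> = \<beta>" if "\<beta> \<in> hom (Hom K X X') a b" for \<beta>
        using FAr[OF into[OF that]] by simp
    qed
    then show "bij_betw (FAr (TF ?P p q)) (hom (Hom ?S p q) s s')
        (hom (Hom K (TO ?P p) (TO ?P q)) (FOb (TF ?P p q) s) (FOb (TF ?P p q) s'))"
      using s by (simp add: ab) (simp add: pX)
  qed
  then show "bi_initial K I" using I by (simp add: bi_initial_def)
qed
qed

end

section \<open>Category-valued pseudo-functors in components\<close>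

type_synonym ('o, 'm, 't, 'p, 'b) cat_psf =
  "('o, 'm, 't, ('p, 'b) cat, ('p, 'b, 'p, 'b) ftr, ('p, 'b, 'p, 'b) ntr) psf"
type_synonym ('o, 'm, 'p, 'b) cat_tr = "('o, 'm, ('p, 'b, 'p, 'b) ftr, ('p, 'b, 'p, 'b) ntr) pnt"
type_synonym ('o, 'm, 'p, 'b) cat_mdf = "('o, 'm, ('p, 'b, 'p, 'b) ftr, ('p, 'b, 'p, 'b) ntr) mdf"

text \<open>For a pseudo-functor \<open>F\<close> into categories, a morphism \<open>a\<close> acts on objects and on arrows of
  \<open>F X\<close> (\<open>act\<close>, \<open>act_ar\<close>); 2-morphisms and compositors have components at objects of \<open>F X\<close>
  (\<open>act_cell\<close>, \<open>cmp\<close>). In these terms every axiom becomes an equation between arrows of a single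
  category.\<close>

abbreviation act :: "('o, 'm, 't, 'p, 'b) cat_psf \<Rightarrow> 'o \<Rightarrow> 'o \<Rightarrow> 'm \<Rightarrow> 'p \<Rightarrow> 'p" where
  "act F X Y a \<equiv> FOb (FOb (PF F X Y) a)"

abbreviation act_ar :: "('o, 'm, 't, 'p, 'b) cat_psf \<Rightarrow> 'o \<Rightarrow> 'o \<Rightarrow> 'm \<Rightarrow> 'b \<Rightarrow> 'b" where
  "act_ar F X Y a \<equiv> FAr (FOb (PF F X Y) a)"

abbreviation act_cell :: "('o, 'm, 't, 'p, 'b) cat_psf \<Rightarrow> 'o \<Rightarrow> 'o \<Rightarrow> 't \<Rightarrow> 'p \<Rightarrow> 'b" where
  "act_cell F X Y \<gamma> \<equiv> NAt (FAr (PF F X Y) \<gamma>)"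

abbreviation cmp :: "('o, 'm, 't, 'p, 'b) cat_psf \<Rightarrow> 'o \<Rightarrow> 'o \<Rightarrow> 'o \<Rightarrow> 'm \<Rightarrow> 'm \<Rightarrow> 'p \<Rightarrow> 'b" where
  "cmp F X Y Z b a \<equiv> NAt (PC F X Y Z b a)"

locale cat_valued = K: two_category K + normal_pseudo_functor K Cat F
  for K :: "('o, 'm, 't) twocat"
    and F :: "('o, 'm, 't, 'p, 'b) cat_psf"
begin

lemma PO_category [simp]: "X \<in> Obj K \<Longrightarrow> category (PO F X)"
  using po_closed by simp

lemma PF_functor: "X \<in> Obj K \<Longrightarrow> Y \<in> Obj K \<Longrightarrow>
    cat_functor (Hom K X Y) (functor_cat (PO F X) (PO F Y)) (PF F X Y)"
  using pf_functor by simp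

lemma act_functor: "X \<in> Obj K \<Longrightarrow> Y \<in> Obj K \<Longrightarrow> a \<in> Ob (Hom K X Y) \<Longrightarrow>
    cat_functor (PO F X) (PO F Y) (FOb (PF F X Y) a)"
  using functor_arr(1)[OF PF_functor] by simp

lemma cell_nat:
  assumes "X \<in> Obj K" "Y \<in> Obj K" "\<gamma> \<in> Ar (Hom K X Y)"
  shows "nat_trans (PO F X) (PO F Y) (FAr (PF F X Y) \<gamma>)"
    "NDom (FAr (PF F X Y) \<gamma>) = FOb (PF F X Y) (Dom (Hom K X Y) \<gamma>)"
    "NCod (FAr (PF F X Y) \<gamma>) = FOb (PF F X Y) (Cod (Hom K X Y) \<gamma>)"
  using functor_arr(2-4)[OF PF_functor[OF assms(1,2)] assms(3)] by simp_all

lemma act_simps [simp]: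
  assumes "X \<in> Obj K" "Y \<in> Obj K" "a \<in> Ob (Hom K X Y)"
  shows "x \<in> Ob (PO F X) \<Longrightarrow> act F X Y a x \<in> Ob (PO F Y)"
    "u \<in> Ar (PO F X) \<Longrightarrow> act_ar F X Y a u \<in> Ar (PO F Y)"
    "u \<in> Ar (PO F X) \<Longrightarrow> Dom (PO F Y) (act_ar F X Y a u) = act F X Y a (Dom (PO F X) u)"
    "u \<in> Ar (PO F X) \<Longrightarrow> Cod (PO F Y) (act_ar F X Y a u) = act F X Y a (Cod (PO F X) u)"
    "x \<in> Ob (PO F X) \<Longrightarrow> act_ar F X Y a (Ide (PO F X) x) = Ide (PO F Y) (act F X Y a x)"
    "u \<in> Ar (PO F X) \<Longrightarrow> v \<in> Ar (PO F X) \<Longrightarrow> Cod (PO F X) u = Dom (PO F X) v \<Longrightarrow>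
      act_ar F X Y a (v \<cdot>[PO F X] u) = act_ar F X Y a v \<cdot>[PO F Y] act_ar F X Y a u"
    "is_iso (PO F X) u \<Longrightarrow> is_iso (PO F Y) (act_ar F X Y a u)"
  using functor_arr[OF act_functor[OF assms]] functor_iso[OF act_functor[OF assms]] assms
  by simp_all

lemma act_One [simp]:
  "X \<in> Obj K \<Longrightarrow> x \<in> Ob (PO F X) \<Longrightarrow> act F X X (One K X) x = x"
  "X \<in> Obj K \<Longrightarrow> u \<in> Ar (PO F X) \<Longrightarrow> act_ar F X X (One K X) u = u"
  by (simp_all add: pf_one)

lemma cell_simps [simp]:
  assumes "X \<in> Obj K" "Y \<in> Obj K" "x \<in> Ob (PO F X)"
  shows "\<gamma> \<in> Ar (Hom K X Y) \<Longrightarrow> act_cell F X Y \<gamma> x \<in> Ar (PO F Y)"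
    "\<gamma> \<in> Ar (Hom K X Y) \<Longrightarrow> Dom (PO F Y) (act_cell F X Y \<gamma> x) = act F X Y (Dom (Hom K X Y) \<gamma>) x"
    "\<gamma> \<in> Ar (Hom K X Y) \<Longrightarrow> Cod (PO F Y) (act_cell F X Y \<gamma> x) = act F X Y (Cod (Hom K X Y) \<gamma>) x"
  using nat_trans_arr(3-5)[OF cell_nat(1)[OF assms(1,2)]] cell_nat(2,3)[OF assms(1,2)] assms(3)
  by simp_all

lemma cell_Ide [simp]:
  "X \<in> Obj K \<Longrightarrow> Y \<in> Obj K \<Longrightarrow> x \<in> Ob (PO F X) \<Longrightarrow> a \<in> Ob (Hom K X Y) \<Longrightarrow>
    act_cell F X Y (Ide (Hom K X Y) a) x = Ide (PO F Y) (act F X Y a x)"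
  using functor_arr(5)[OF PF_functor] by simp

lemma cell_Comp [simp]:
  "X \<in> Obj K \<Longrightarrow> Y \<in> Obj K \<Longrightarrow> x \<in> Ob (PO F X) \<Longrightarrow> \<gamma> \<in> Ar (Hom K X Y) \<Longrightarrow> \<delta> \<in> Ar (Hom K X Y) \<Longrightarrow>
    Cod (Hom K X Y) \<gamma> = Dom (Hom K X Y) \<delta> \<Longrightarrow>
    act_cell F X Y (\<delta> \<cdot>[Hom K X Y] \<gamma>) x = act_cell F X Y \<delta> x \<cdot>[PO F Y] act_cell F X Y \<gamma> x"
  using functor_arr(6)[OF PF_functor] by simp

lemma cell_natural:
  assumes "X \<in> Obj K" "Y \<in> Obj K" "\<gamma> \<in> Ar (Hom K X Y)" "Dom (Hom K X Y) \<gamma> = a" "Cod (Hom K X Y) \<gamma> = b"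
    "u \<in> Ar (PO F X)" "Dom (PO F X) u = x" "Cod (PO F X) u = y"
  shows "act_cell F X Y \<gamma> y \<cdot>[PO F Y] act_ar F X Y a u = act_ar F X Y b u \<cdot>[PO F Y] act_cell F X Y \<gamma> x"
  using nat_trans_arr(6)[OF cell_nat(1)[OF assms(1-3)] assms(6-8)] cell_nat(2,3)[OF assms(1-3)] assms(4,5)
  by simp

lemma cmp_nat:
  assumes "X \<in> Obj K" "Y \<in> Obj K" "Z \<in> Obj K" "a \<in> Ob (Hom K X Y)" "b \<in> Ob (Hom K Y Z)"
  shows "is_iso (functor_cat (PO F X) (PO F Z)) (PC F X Y Z b a)"
    "nat_trans (PO F X) (PO F Z) (PC F X Y Z b a)"
    "NDom (PC F X Y Z b a) = comp_ftr (PO F X) (FOb (PF F Y Z) b) (FOb (PF F X Y) a)"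
    "NCod (PC F X Y Z b a) = FOb (PF F X Z) (HC1 K X Y Z b a)"
  using pc_iso[OF assms] by (simp_all add: iso_in_iff)

lemma cmp_simps [simp]:
  assumes "X \<in> Obj K" "Y \<in> Obj K" "Z \<in> Obj K" "x \<in> Ob (PO F X)"
    "a \<in> Ob (Hom K X Y)" "b \<in> Ob (Hom K Y Z)"
  shows "cmp F X Y Z b a x \<in> Ar (PO F Z)"
    "Dom (PO F Z) (cmp F X Y Z b a x) = act F Y Z b (act F X Y a x)"
    "Cod (PO F Z) (cmp F X Y Z b a x) = act F X Z (HC1 K X Y Z b a) x"
    "is_iso (PO F Z) (cmp F X Y Z b a x)"
  using nat_trans_arr(3-5)[OF cmp_nat(2)[OF assms(1-3,5,6)] assms(4)]
    is_iso_component[OF cmp_nat(1)[OF assms(1-3,5,6)] assms(4)]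
    cmp_nat(3,4)[OF assms(1-3,5,6)] assms(4)
  by simp_all

lemma cmp_natural:
  assumes "X \<in> Obj K" "Y \<in> Obj K" "Z \<in> Obj K" "a \<in> Ob (Hom K X Y)" "b \<in> Ob (Hom K Y Z)"
    "u \<in> Ar (PO F X)" "Dom (PO F X) u = x" "Cod (PO F X) u = y"
  shows "cmp F X Y Z b a y \<cdot>[PO F Z] act_ar F Y Z b (act_ar F X Y a u) =
    act_ar F X Z (HC1 K X Y Z b a) u \<cdot>[PO F Z] cmp F X Y Z b a x"
  using nat_trans_arr(6)[OF cmp_nat(2)[OF assms(1-5)] assms(6-8)] cmp_nat(3,4)[OF assms(1-5)] assms(6)
  by simp

lemma cmp_cell:
  assumes "X \<in> Obj K" "Y \<in> Obj K" "Z \<in> Obj K" "x \<in> Ob (PO F X)"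
    "\<alpha> \<in> Ar (Hom K X Y)" "Dom (Hom K X Y) \<alpha> = a" "Cod (Hom K X Y) \<alpha> = a'"
    "\<beta> \<in> Ar (Hom K Y Z)" "Dom (Hom K Y Z) \<beta> = b" "Cod (Hom K Y Z) \<beta> = b'"
  shows "act_cell F X Z (HC2 K X Y Z \<beta> \<alpha>) x \<cdot>[PO F Z] cmp F X Y Z b a x =
    cmp F X Y Z b' a' x \<cdot>[PO F Z] (act_cell F Y Z \<beta> (act F X Y a' x) \<cdot>[PO F Z] act_ar F Y Z b (act_cell F X Y \<alpha> x))"
proof -
  have "NAt (FAr (PF F X Z) (HC2 K X Y Z \<beta> \<alpha>) \<cdot>[functor_cat (PO F X) (PO F Z)] PC F X Y Z b a) x
      = NAt (PC F X Y Z b' a' \<cdot>[functor_cat (PO F X) (PO F Z)]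
          hcomp_nat (PO F X) (PO F Z) (FAr (PF F Y Z) \<beta>) (FAr (PF F X Y) \<alpha>)) x"
    using pc_natural[of X Y Z \<alpha> a a' \<beta> b b'] assms by (simp add: in_hom)
  then show ?thesis
    using assms cell_nat(2,3)[of X Y \<alpha>] cell_nat(2,3)[of Y Z \<beta>] by simp
qed

lemma cmp_assoc:
  assumes "W \<in> Obj K" "X \<in> Obj K" "Y \<in> Obj K" "Z \<in> Obj K" "x \<in> Ob (PO F W)"
    "a \<in> Ob (Hom K W X)" "b \<in> Ob (Hom K X Y)" "c \<in> Ob (Hom K Y Z)"
  shows "cmp F W X Z (HC1 K X Y Z c b) a x \<cdot>[PO F Z] cmp F X Y Z c b (act F W X a x) =
    cmp F W Y Z c (HC1 K W X Y b a) x \<cdot>[PO F Z] act_ar F Y Z c (cmp F W X Y b a x)"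
proof -
  have "NAt (PC F W X Z (HC1 K X Y Z c b) a \<cdot>[functor_cat (PO F W) (PO F Z)]
       rwh Cat (PO F W) (PO F X) (PO F Z) (PC F X Y Z c b) (FOb (PF F W X) a)) x =
     NAt (PC F W Y Z c (HC1 K W X Y b a) \<cdot>[functor_cat (PO F W) (PO F Z)]
       lwh Cat (PO F W) (PO F Y) (PO F Z) (FOb (PF F Y Z) c) (PC F W X Y b a)) x"
    using pc_assoc[OF assms(1-4,6-8)] by simp
  then show ?thesis
    using assms act_functor[OF assms(1,2,6)] act_functor[OF assms(3,4,8)]
      cmp_nat(2)[OF assms(2-4,7,8)] cmp_nat(2)[OF assms(1-3,6,7)]
    by (simp add: lwh_Cat_at[where B = "PO F Y"] rwh_Cat_at[where B = "PO F X"])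
qed

lemma cmp_One [simp]:
  assumes "X \<in> Obj K" "Y \<in> Obj K" "x \<in> Ob (PO F X)" "a \<in> Ob (Hom K X Y)"
  shows "cmp F X X Y a (One K X) x = Ide (PO F Y) (act F X Y a x)"
    "cmp F X Y Y (One K Y) a x = Ide (PO F Y) (act F X Y a x)"
  using assms by (simp_all add: pc_one one_pc)

end

section \<open>The 2-category of elements\<close>

locale presheaf = C: two_category C + normal_pseudo_functor "op2 C" Cat F
  for C :: "('o, 'm, 't) twocat"
    and F :: "('o, 'm, 't, 'p, 'b) cat_psf"

sublocale presheaf \<subseteq> cat_valued "op2 C" F
  by (intro cat_valued.intro two_category_op2 C.two_category_axioms normal_pseudo_functor_axioms)

lemma el_simps [simp]:
  "(X, x) \<in> Obj (el K F) \<longleftrightarrow> X \<in> Obj K \<and> x \<in> Ob (PO F X)"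
  "Hom (el K F) = el_hom K F"
  "One (el K F) (X, x) = (One K X, Ide (PO F X) x)"
  "HC1 (el K F) = el_comp K F"
  "HC2 (el K F) p q r \<gamma> \<gamma>' = \<lparr>
       Src = el_comp K F p q r (Src \<gamma>) (Src \<gamma>'),
       Tgt = el_comp K F p q r (Tgt \<gamma>) (Tgt \<gamma>'),
       Und = HC2 K (fst r) (fst q) (fst p) (Und \<gamma>') (Und \<gamma>)\<rparr>"
  by (simp_all add: el_def)

lemma el_comp_simp [simp]:
  "el_comp K F (X'', x'') (X', x') (X, x) (c, \<psi>) (c', \<psi>') =
     (HC1 K X X' X'' c' c, cmp F X'' X' X c c' x'' \<cdot>[PO F X] (act_ar F X' X c \<psi>' \<cdot>[PO F X] \<psi>))"
  by (simp add: el_comp_def)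

lemma el_hom_simps [simp]:
  "(c, \<psi>) \<in> Ob (el_hom K F (X', x') (X, x)) \<longleftrightarrow>
     c \<in> Ob (Hom K X X') \<and> iso_in (PO F X) x (act F X' X c x') \<psi>"
  "\<gamma> \<in> Ar (el_hom K F (X', x') (X, x)) \<longleftrightarrow>
     Src \<gamma> \<in> Ob (el_hom K F (X', x') (X, x)) \<and> Tgt \<gamma> \<in> Ob (el_hom K F (X', x') (X, x)) \<and>
     Und \<gamma> \<in> hom (Hom K X X') (fst (Src \<gamma>)) (fst (Tgt \<gamma>)) \<and>
     snd (Tgt \<gamma>) = act_cell F X' X (Und \<gamma>) x' \<cdot>[PO F X] snd (Src \<gamma>)"
  "Dom (el_hom K F (X', x') (X, x)) = Src" "Cod (el_hom K F (X', x') (X, x)) = Tgt"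
  "Ide (el_hom K F (X', x') (X, x)) s = \<lparr>Src = s, Tgt = s, Und = Ide (Hom K X X') (fst s)\<rparr>"
  "\<delta> \<cdot>[el_hom K F (X', x') (X, x)] \<gamma> = \<lparr>Src = Src \<gamma>, Tgt = Tgt \<delta>, Und = Und \<delta> \<cdot>[Hom K X X'] Und \<gamma>\<rparr>"
  by (auto simp: el_hom_def Let_def)

context presheaf
begin

lemmas op_simps [simp] =
  act_One[unfolded op2_simps] cell_Ide[unfolded op2_simps] cell_Comp[unfolded op2_simps]
  cmp_One[unfolded op2_simps]

lemma el_comp_closed:
  assumes "(X, x) \<in> Obj (el C F)" "(X', x') \<in> Obj (el C F)" "(X'', x'') \<in> Obj (el C F)"
    "s' \<in> Ob (el_hom C F (X'', x'') (X', x'))" "s \<in> Ob (el_hom C F (X', x') (X, x))"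
  shows "el_comp C F (X'', x'') (X', x') (X, x) s s' \<in> Ob (el_hom C F (X'', x'') (X, x))"
  using assms by (cases s; cases s') (auto simp: iso_in_iff)

text \<open>Both sides carry the isomorphism obtained by transporting \<open>\<psi>1\<close>, \<open>\<psi>2\<close>, \<open>\<psi>3\<close> into \<open>F X3\<close>;
  they differ in the order in which the compositors are applied, which naturality of the
  compositor and its associativity axiom allow to exchange.\<close>

lemma el_comp_assoc:
  assumes "(X0, x0) \<in> Obj (el C F)" "(X1, x1) \<in> Obj (el C F)" "(X2, x2) \<in> Obj (el C F)" "(X3, x3) \<in> Obj (el C F)"
    "(c1, \<psi>1) \<in> Ob (el_hom C F (X0, x0) (X1, x1))" "(c2, \<psi>2) \<in> Ob (el_hom C F (X1, x1) (X2, x2))"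
    "(c3, \<psi>3) \<in> Ob (el_hom C F (X2, x2) (X3, x3))"
  shows "el_comp C F (X0, x0) (X1, x1) (X3, x3) (el_comp C F (X1, x1) (X2, x2) (X3, x3) (c3, \<psi>3) (c2, \<psi>2)) (c1, \<psi>1) =
    el_comp C F (X0, x0) (X2, x2) (X3, x3) (c3, \<psi>3) (el_comp C F (X0, x0) (X1, x1) (X2, x2) (c2, \<psi>2) (c1, \<psi>1))"
proof -
  have [simp]: "X0 \<in> Obj C" "X1 \<in> Obj C" "X2 \<in> Obj C" "X3 \<in> Obj C"
      "x0 \<in> Ob (PO F X0)" "x1 \<in> Ob (PO F X1)" "x2 \<in> Ob (PO F X2)" "x3 \<in> Ob (PO F X3)"
      "c1 \<in> Ob (Hom C X1 X0)" "c2 \<in> Ob (Hom C X2 X1)" "c3 \<in> Ob (Hom C X3 X2)"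
      "\<psi>1 \<in> Ar (PO F X1)" "Dom (PO F X1) \<psi>1 = x1" "Cod (PO F X1) \<psi>1 = act F X0 X1 c1 x0"
      "\<psi>2 \<in> Ar (PO F X2)" "Dom (PO F X2) \<psi>2 = x2" "Cod (PO F X2) \<psi>2 = act F X1 X2 c2 x1"
      "\<psi>3 \<in> Ar (PO F X3)" "Dom (PO F X3) \<psi>3 = x3" "Cod (PO F X3) \<psi>3 = act F X2 X3 c3 x2"
    using assms by (auto simp: iso_in_iff)
  have nat: "act_ar F X1 X3 (HC1 C X3 X2 X1 c2 c3) \<psi>1 \<cdot>[PO F X3] cmp F X1 X2 X3 c3 c2 x1
      = cmp F X1 X2 X3 c3 c2 (act F X0 X1 c1 x0) \<cdot>[PO F X3] act_ar F X2 X3 c3 (act_ar F X1 X2 c2 \<psi>1)"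
    using cmp_natural[of X1 X2 X3 c2 c3 \<psi>1] by simp
  have assoc: "cmp F X0 X1 X3 (HC1 C X3 X2 X1 c2 c3) c1 x0 \<cdot>[PO F X3] cmp F X1 X2 X3 c3 c2 (act F X0 X1 c1 x0) =
    cmp F X0 X2 X3 c3 (HC1 C X2 X1 X0 c1 c2) x0 \<cdot>[PO F X3] act_ar F X2 X3 c3 (cmp F X0 X1 X2 c2 c1 x0)"
    using cmp_assoc[of X0 X1 X2 X3 x0 c1 c2 c3] by simp
  show ?thesis
    by (simp add: C.hc1_assoc comp_extend[OF nat] comp_extend[OF assoc])
qed

lemma el_comp_assoc':
  assumes "(X0, x0) \<in> Obj (el C F)" "(X1, x1) \<in> Obj (el C F)" "(X2, x2) \<in> Obj (el C F)" "(X3, x3) \<in> Obj (el C F)"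
    "s1 \<in> Ob (el_hom C F (X0, x0) (X1, x1))" "s2 \<in> Ob (el_hom C F (X1, x1) (X2, x2))"
    "s3 \<in> Ob (el_hom C F (X2, x2) (X3, x3))"
  shows "el_comp C F (X0, x0) (X1, x1) (X3, x3) (el_comp C F (X1, x1) (X2, x2) (X3, x3) s3 s2) s1 =
    el_comp C F (X0, x0) (X2, x2) (X3, x3) s3 (el_comp C F (X0, x0) (X1, x1) (X2, x2) s2 s1)"
  using assms by (cases s1; cases s2; cases s3) (simp only: el_comp_assoc)

lemma el_comp_One:
  assumes "(X', x') \<in> Obj (el C F)" "(X, x) \<in> Obj (el C F)" "s \<in> Ob (el_hom C F (X', x') (X, x))"
  shows "el_comp C F (X', x') (X', x') (X, x) s (One C X', Ide (PO F X') x') = s"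
    "el_comp C F (X', x') (X, x) (X, x) (One C X, Ide (PO F X) x) s = s"
  using assms by (cases s; simp add: iso_in_iff C.one_hc1 C.hc1_one)+

text \<open>The condition on a 2-morphism of elements is stable under horizontal composition because the
  compositors are natural in 2-morphisms and \<open>F \<gamma>\<close> is natural in the objects of \<open>F X'\<close>.\<close>

lemma el_hc2_closed:
  assumes ob: "(X, x) \<in> Obj (el C F)" "(X', x') \<in> Obj (el C F)" "(X'', x'') \<in> Obj (el C F)"
    and \<gamma>: "\<gamma>' \<in> Ar (el_hom C F (X'', x'') (X', x'))" "\<gamma> \<in> Ar (el_hom C F (X', x') (X, x))"
  shows "HC2 (el C F) (X'', x'') (X', x') (X, x) \<gamma> \<gamma>' \<in> Ar (el_hom C F (X'', x'') (X, x))"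
proof -
  obtain c \<psi> d \<phi> c' \<psi>' d' \<phi>' where [simp]: "Src \<gamma> = (c, \<psi>)" "Tgt \<gamma> = (d, \<phi>)" "Src \<gamma>' = (c', \<psi>')" "Tgt \<gamma>' = (d', \<phi>')"
    by fastforce
  have [simp]: "X \<in> Obj C" "x \<in> Ob (PO F X)" "X' \<in> Obj C" "x' \<in> Ob (PO F X')" "X'' \<in> Obj C" "x'' \<in> Ob (PO F X'')"
      "c \<in> Ob (Hom C X X')" "d \<in> Ob (Hom C X X')" "c' \<in> Ob (Hom C X' X'')" "d' \<in> Ob (Hom C X' X'')"
      "\<psi> \<in> Ar (PO F X)" "Dom (PO F X) \<psi> = x" "Cod (PO F X) \<psi> = act F X' X c x'"
      "\<psi>' \<in> Ar (PO F X')" "Dom (PO F X') \<psi>' = x'" "Cod (PO F X') \<psi>' = act F X'' X' c' x''"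
      "Und \<gamma> \<in> Ar (Hom C X X')" "Dom (Hom C X X') (Und \<gamma>) = c" "Cod (Hom C X X') (Und \<gamma>) = d"
      "Und \<gamma>' \<in> Ar (Hom C X' X'')" "Dom (Hom C X' X'') (Und \<gamma>') = c'" "Cod (Hom C X' X'') (Und \<gamma>') = d'"
    and eq: "\<phi> = act_cell F X' X (Und \<gamma>) x' \<cdot>[PO F X] \<psi>" "\<phi>' = act_cell F X'' X' (Und \<gamma>') x'' \<cdot>[PO F X'] \<psi>'"
    using ob \<gamma> by (auto simp: iso_in_iff in_hom)
  have 1: "act_cell F X'' X (HC2 C X X' X'' (Und \<gamma>') (Und \<gamma>)) x'' \<cdot>[PO F X] cmp F X'' X' X c c' x''
      = cmp F X'' X' X d d' x'' \<cdot>[PO F X]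
        (act_cell F X' X (Und \<gamma>) (act F X'' X' d' x'') \<cdot>[PO F X] act_ar F X' X c (act_cell F X'' X' (Und \<gamma>') x''))"
    using cmp_cell[of X'' X' X x'' "Und \<gamma>'" c' d' "Und \<gamma>" c d] by simp
  have 2: "act_cell F X' X (Und \<gamma>) (act F X'' X' d' x'') \<cdot>[PO F X] act_ar F X' X c \<phi>'
      = act_ar F X' X d \<phi>' \<cdot>[PO F X] act_cell F X' X (Und \<gamma>) x'"
    using cell_natural[of X' X "Und \<gamma>" c d \<phi>' x' "act F X'' X' d' x''"] by (simp add: eq)
  have "cmp F X'' X' X d d' x'' \<cdot>[PO F X] (act_ar F X' X d \<phi>' \<cdot>[PO F X] \<phi>) =
     act_cell F X'' X (HC2 C X X' X'' (Und \<gamma>') (Und \<gamma>)) x'' \<cdot>[PO F X]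
       (cmp F X'' X' X c c' x'' \<cdot>[PO F X] (act_ar F X' X c \<psi>' \<cdot>[PO F X] \<psi>))"
    using comp_extend[OF 2, of \<psi>] by (simp add: comp_extend[OF 1] eq)
  moreover have "el_comp C F (X'', x'') (X', x') (X, x) (Src \<gamma>) (Src \<gamma>') \<in> Ob (el_hom C F (X'', x'') (X, x))"
    by (rule el_comp_closed) (use ob \<gamma> in auto)
  moreover have "el_comp C F (X'', x'') (X', x') (X, x) (Tgt \<gamma>) (Tgt \<gamma>') \<in> Ob (el_hom C F (X'', x'') (X, x))"
    by (rule el_comp_closed) (use ob \<gamma> in auto)
  ultimately show ?thesis
    by (auto simp: in_hom)
qed

lemma el_hom_category:
  assumes "(X', x') \<in> Obj (el C F)" "(X, x) \<in> Obj (el C F)"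
  shows "category (el_hom C F (X', x') (X, x))"
proof
  note [simp] = assms[unfolded el_simps]
  fix s assume "s \<in> Ob (el_hom C F (X', x') (X, x))"
  then show "Ide (el_hom C F (X', x') (X, x)) s \<in> hom (el_hom C F (X', x') (X, x)) s s"
    by (cases s) (auto simp: in_hom iso_in_iff)
next
  note [simp] = assms[unfolded el_simps]
  fix \<gamma> \<delta> p q r
  assume a: "\<gamma> \<in> hom (el_hom C F (X', x') (X, x)) p q" "\<delta> \<in> hom (el_hom C F (X', x') (X, x)) q r"
  obtain c \<psi> d \<phi> e \<chi> where "p = (c, \<psi>)" "q = (d, \<phi>)" "r = (e, \<chi>)" by fastforce
  then show "\<delta> \<cdot>[el_hom C F (X', x') (X, x)] \<gamma> \<in> hom (el_hom C F (X', x') (X, x)) p r"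
    using a by (auto simp: in_hom iso_in_iff)
qed (use assms in \<open>auto simp: in_hom\<close>)

theorem two_category_el: "two_category (el C F)"
proof (rule two_category.intro)
  fix p q assume "p \<in> Obj (el C F)" "q \<in> Obj (el C F)"
  then show "category (Hom (el C F) p q)" by (cases p; cases q) (simp add: el_hom_category)
next
  fix p assume "p \<in> Obj (el C F)"
  then show "One (el C F) p \<in> Ob (Hom (el C F) p p)" by (cases p) (simp add: iso_in_iff)
next
  fix p q r s s'
  assume "p \<in> Obj (el C F)" "q \<in> Obj (el C F)" "r \<in> Obj (el C F)" "s \<in> Ob (Hom (el C F) p q)"
    "s' \<in> Ob (Hom (el C F) q r)"
  then show "HC1 (el C F) p q r s' s \<in> Ob (Hom (el C F) p r)"
    using el_comp_closed by (cases p; cases q; cases r) (simp del: el_comp_simp)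
next
  fix p q r \<alpha> f f' \<beta> g g'
  assume "p \<in> Obj (el C F)" "q \<in> Obj (el C F)" "r \<in> Obj (el C F)" "\<alpha> \<in> hom (Hom (el C F) p q) f f'"
    "\<beta> \<in> hom (Hom (el C F) q r) g g'"
  moreover obtain X x X' x' X'' x'' where "p = (X, x)" "q = (X', x')" "r = (X'', x'')" by fastforce
  ultimately show "HC2 (el C F) p q r \<beta> \<alpha> \<in> hom (Hom (el C F) p r) (HC1 (el C F) p q r g f) (HC1 (el C F) p q r g' f')"
    using el_hc2_closed[of X'' x'' X' x' X x \<alpha> \<beta>] by (simp add: in_hom del: el_hom_simps(2))
next
  fix p q r f g
  assume "p \<in> Obj (el C F)" "q \<in> Obj (el C F)" "r \<in> Obj (el C F)" "f \<in> Ob (Hom (el C F) p q)" "g \<in> Ob (Hom (el C F) q r)"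
  moreover obtain X x X' x' X'' x'' where "p = (X, x)" "q = (X', x')" "r = (X'', x'')" by fastforce
  ultimately show "HC2 (el C F) p q r (Ide (Hom (el C F) q r) g) (Ide (Hom (el C F) p q) f) =
        Ide (Hom (el C F) p r) (HC1 (el C F) p q r g f)"
    by (cases f; cases g) (simp add: C.hc2_ide)
next
  fix p q r \<alpha> f f' \<alpha>' f'' \<beta> g g' \<beta>' g''
  assume "p \<in> Obj (el C F)" "q \<in> Obj (el C F)" "r \<in> Obj (el C F)" "\<alpha> \<in> hom (Hom (el C F) p q) f f'"
    "\<alpha>' \<in> hom (Hom (el C F) p q) f' f''" "\<beta> \<in> hom (Hom (el C F) q r) g g'" "\<beta>' \<in> hom (Hom (el C F) q r) g' g''"
  moreover obtain X x X' x' X'' x'' where "p = (X, x)" "q = (X', x')" "r = (X'', x'')" by fastforce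
  ultimately show "HC2 (el C F) p q r (\<beta>' \<cdot>[Hom (el C F) q r] \<beta>) (\<alpha>' \<cdot>[Hom (el C F) p q] \<alpha>) =
        HC2 (el C F) p q r \<beta>' \<alpha>' \<cdot>[Hom (el C F) p r] HC2 (el C F) p q r \<beta> \<alpha>"
    using C.HC2_Comp[of X'' X' X "Und \<beta>" "Und \<alpha>" "Und \<beta>'" "Und \<alpha>'"] by (simp add: in_hom)
next
  fix p q r s f g h
  assume "p \<in> Obj (el C F)" "q \<in> Obj (el C F)" "r \<in> Obj (el C F)" "s \<in> Obj (el C F)"
    "f \<in> Ob (Hom (el C F) p q)" "g \<in> Ob (Hom (el C F) q r)" "h \<in> Ob (Hom (el C F) r s)"
  then show "HC1 (el C F) p q s (HC1 (el C F) q r s h g) f = HC1 (el C F) p r s h (HC1 (el C F) p q r g f)"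
    by (cases p; cases q; cases r; cases s; cases f; cases g; cases h)
      (simp only: el_simps(2,4) el_comp_assoc)
next
  fix p q r s \<alpha> \<beta> \<gamma>
  assume ob: "p \<in> Obj (el C F)" "q \<in> Obj (el C F)" "r \<in> Obj (el C F)" "s \<in> Obj (el C F)"
    and cells: "\<alpha> \<in> Ar (Hom (el C F) p q)" "\<beta> \<in> Ar (Hom (el C F) q r)" "\<gamma> \<in> Ar (Hom (el C F) r s)"
  obtain X x X' x' X'' x'' X3 x3 where [simp]: "p = (X, x)" "q = (X', x')" "r = (X'', x'')" "s = (X3, x3)"
    by fastforce
  have "el_comp C F p q s (el_comp C F q r s (Src \<gamma>) (Src \<beta>)) (Src \<alpha>) =
      el_comp C F p r s (Src \<gamma>) (el_comp C F p q r (Src \<beta>) (Src \<alpha>))"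
    "el_comp C F p q s (el_comp C F q r s (Tgt \<gamma>) (Tgt \<beta>)) (Tgt \<alpha>) =
      el_comp C F p r s (Tgt \<gamma>) (el_comp C F p q r (Tgt \<beta>) (Tgt \<alpha>))"
    using el_comp_assoc' ob cells by simp_all
  moreover have "HC2 C X3 X'' X (HC2 C X'' X' X (Und \<alpha>) (Und \<beta>)) (Und \<gamma>) =
      HC2 C X3 X' X (Und \<alpha>) (HC2 C X3 X'' X' (Und \<beta>) (Und \<gamma>))"
    using ob cells by (intro C.hc2_assoc) (auto simp: in_hom)
  ultimately show "HC2 (el C F) p q s (HC2 (el C F) q r s \<gamma> \<beta>) \<alpha> = HC2 (el C F) p r s \<gamma> (HC2 (el C F) p q r \<beta> \<alpha>)"
    by simp
next
  fix p q f assume *: "p \<in> Obj (el C F)" "q \<in> Obj (el C F)" "f \<in> Ob (Hom (el C F) p q)"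
  show "HC1 (el C F) p p q f (One (el C F) p) = f"
    using * by (cases p; cases q) (simp add: el_comp_One)
  show "HC1 (el C F) p q q (One (el C F) q) f = f"
    using * by (cases p; cases q) (simp add: el_comp_One)
next
  fix p q \<alpha> assume *: "p \<in> Obj (el C F)" "q \<in> Obj (el C F)" "\<alpha> \<in> Ar (Hom (el C F) p q)"
  obtain X x X' x' where [simp]: "p = (X', x')" "q = (X, x)" by fastforce
  have [simp]: "X \<in> Obj C" "X' \<in> Obj C" "x \<in> Ob (PO F X)" "x' \<in> Ob (PO F X')"
    "Src \<alpha> \<in> Ob (el_hom C F (X', x') (X, x))" "Tgt \<alpha> \<in> Ob (el_hom C F (X', x') (X, x))" "Und \<alpha> \<in> Ar (Hom C X X')"
    using * by (simp_all add: in_hom)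
  show "HC2 (el C F) p p q \<alpha> (Ide (Hom (el C F) p p) (One (el C F) p)) = \<alpha>"
    by (simp add: el_comp_One C.one_hc2)
  show "HC2 (el C F) p q q (Ide (Hom (el C F) q q) (One (el C F) q)) \<alpha> = \<alpha>"
    by (simp add: el_comp_One C.hc2_one)
qed

end

text \<open>The component at \<open>X\<close> of the transformation \<open>Hom K (-, I) \<Rightarrow> F\<close> that the element \<open>i\<close> names.\<close>

definition evaluation ::
  "('o, 'm, 't) twocat \<Rightarrow> ('o, 'm, 't, 'p, 'b) cat_psf
    \<Rightarrow> 'o \<Rightarrow> 'p \<Rightarrow> 'o \<Rightarrow> ('m, 't, 'p, 'b) ftr" where
  "evaluation K F I i X = \<lparr>
     FOb = (\<lambda>c\<in>Ob (Hom K X I). act F I X c i),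
     FAr = (\<lambda>\<gamma>\<in>Ar (Hom K X I). act_cell F I X \<gamma> i)\<rparr>"

lemma evaluation_simps [simp]:
  "c \<in> Ob (Hom K X I) \<Longrightarrow> FOb (evaluation K F I i X) c = act F I X c i"
  "\<gamma> \<in> Ar (Hom K X I) \<Longrightarrow> FAr (evaluation K F I i X) \<gamma> = act_cell F I X \<gamma> i"
  by (simp_all add: evaluation_def)

context presheaf
begin

lemma evaluation_functor:
  assumes [simp]: "I \<in> Obj C" "X \<in> Obj C" "i \<in> Ob (PO F I)"
  shows "cat_functor (Hom C X I) (PO F X) (evaluation C F I i X)"
  by (rule functorI) (auto simp: evaluation_def)

text \<open>An object of the hom-category from \<open>(I, i)\<close> to \<open>(X, x)\<close> is a morphism \<open>c\<close> with an isomorphism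
  \<open>\<psi> : x \<cong> (F c) i\<close>, and an arrow from \<open>(c, \<psi>)\<close> to \<open>(d, \<phi>)\<close> is a lift of the isomorphism
  \<open>\<phi> \<psi>\<^sup>-\<^sup>1\<close> along the evaluation functor. Every isomorphism \<open>\<theta>\<close> arises in this way, from
  \<open>x = (F c) i\<close>, \<open>\<psi> = id\<close> and \<open>\<phi> = \<theta>\<close>.\<close>

theorem bi_initial_el_iff:
  assumes I [simp]: "I \<in> Obj C" "i \<in> Ob (PO F I)"
  shows "bi_initial (el C F) (I, i) \<longleftrightarrow> (\<forall>X \<in> Obj C.
    essentially_surjective (Hom C X I) (PO F X) (evaluation C F I i X) \<and>
    iso_lifting (Hom C X I) (PO F X) (evaluation C F I i X))" (is "_ \<longleftrightarrow> ?R")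
proof -
  interpret el: two_category "el C F" by (rule two_category_el)
  have iff: "bi_initial (el C F) (I, i) \<longleftrightarrow> (\<forall>X \<in> Obj C. \<forall>x \<in> Ob (PO F X).
      Ob (el_hom C F (I, i) (X, x)) \<noteq> {} \<and>
      (\<forall>s \<in> Ob (el_hom C F (I, i) (X, x)). \<forall>t \<in> Ob (el_hom C F (I, i) (X, x)).
        \<exists>!\<beta>. \<beta> \<in> hom (el_hom C F (I, i) (X, x)) s t))"
  proof -
    have "(I, i) \<in> Obj (el C F)" by simp
    moreover have "(\<forall>p \<in> Obj (el C F). P p) \<longleftrightarrow> (\<forall>X \<in> Obj C. \<forall>x \<in> Ob (PO F X). P (X, x))" for P
      by (auto simp: el_def)
    ultimately show ?thesis by (simp only: el.bi_initial_iff el_simps(2))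
  qed
  show ?thesis
    unfolding iff
  proof (intro iffI ballI conjI)
    fix X assume L: "\<forall>X \<in> Obj C. \<forall>x \<in> Ob (PO F X).
      Ob (el_hom C F (I, i) (X, x)) \<noteq> {} \<and>
      (\<forall>s \<in> Ob (el_hom C F (I, i) (X, x)). \<forall>t \<in> Ob (el_hom C F (I, i) (X, x)).
        \<exists>!\<beta>. \<beta> \<in> hom (el_hom C F (I, i) (X, x)) s t)"
    assume X [simp]: "X \<in> Obj C"
    show "essentially_surjective (Hom C X I) (PO F X) (evaluation C F I i X)"
      unfolding essentially_surjective_def
    proof
      fix x assume "x \<in> Ob (PO F X)"
      then have "Ob (el_hom C F (I, i) (X, x)) \<noteq> {}" using L X by blast
      then obtain c \<psi> where "(c, \<psi>) \<in> Ob (el_hom C F (I, i) (X, x))" by (metis ex_in_conv surj_pair)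
      then have "c \<in> Ob (Hom C X I)" "iso_in (PO F X) (FOb (evaluation C F I i X) c) x (inv_in (PO F X) \<psi>)"
        by (auto simp: iso_in_iff)
      then show "\<exists>c \<in> Ob (Hom C X I). \<exists>e. iso_in (PO F X) (FOb (evaluation C F I i X) c) x e" by blast
    qed
    show "iso_lifting (Hom C X I) (PO F X) (evaluation C F I i X)"
      unfolding iso_lifting_def
    proof (intro ballI allI impI)
      fix c d \<theta>
      assume [simp]: "c \<in> Ob (Hom C X I)" "d \<in> Ob (Hom C X I)"
        and "iso_in (PO F X) (FOb (evaluation C F I i X) c) (FOb (evaluation C F I i X) d) \<theta>"
      then have \<theta>: "\<theta> \<in> Ar (PO F X)" "Dom (PO F X) \<theta> = act F I X c i" "Cod (PO F X) \<theta> = act F I X d i"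
          "is_iso (PO F X) \<theta>" by (auto simp: iso_in_iff)
      let ?x = "act F I X c i"
      let ?s = "(c, Ide (PO F X) ?x)" and ?t = "(d, \<theta>)"
      have st: "?s \<in> Ob (el_hom C F (I, i) (X, ?x))" "?t \<in> Ob (el_hom C F (I, i) (X, ?x))"
        using \<theta> by (simp_all add: iso_in_iff)
      have "?x \<in> Ob (PO F X)" by simp
      then have ex: "\<exists>!\<beta>. \<beta> \<in> hom (el_hom C F (I, i) (X, ?x)) ?s ?t" using L X st by blast
      have cell: "\<lparr>Src = ?s, Tgt = ?t, Und = \<gamma>\<rparr> \<in> hom (el_hom C F (I, i) (X, ?x)) ?s ?t \<longleftrightarrow>
          \<gamma> \<in> hom (Hom C X I) c d \<and> FAr (evaluation C F I i X) \<gamma> = \<theta>" for \<gamma>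
        using st by (auto simp: in_hom)
      obtain \<beta> where \<beta>: "\<beta> \<in> hom (el_hom C F (I, i) (X, ?x)) ?s ?t" using ex by blast
      then have "\<beta> = \<lparr>Src = ?s, Tgt = ?t, Und = Und \<beta>\<rparr>" by (simp add: in_hom)
      then have 1: "Und \<beta> \<in> hom (Hom C X I) c d \<and> FAr (evaluation C F I i X) (Und \<beta>) = \<theta>"
        using cell[of "Und \<beta>"] \<beta> by simp
      show "\<exists>!\<gamma>. \<gamma> \<in> hom (Hom C X I) c d \<and> FAr (evaluation C F I i X) \<gamma> = \<theta>"
      proof (rule ex1I[of _ "Und \<beta>"])
        show "Und \<beta> \<in> hom (Hom C X I) c d \<and> FAr (evaluation C F I i X) (Und \<beta>) = \<theta>" by (rule 1)
        fix \<gamma> assume "\<gamma> \<in> hom (Hom C X I) c d \<and> FAr (evaluation C F I i X) \<gamma> = \<theta>"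
        then have "\<lparr>Src = ?s, Tgt = ?t, Und = \<gamma>\<rparr> = \<beta>" using cell ex \<beta> by blast
        then show "\<gamma> = Und \<beta>" by auto
      qed
    qed
  next
    fix X x assume R: ?R and X [simp]: "X \<in> Obj C" "x \<in> Ob (PO F X)"
    have "essentially_surjective (Hom C X I) (PO F X) (evaluation C F I i X)" using R X by blast
    then obtain c e where "c \<in> Ob (Hom C X I)" "iso_in (PO F X) (FOb (evaluation C F I i X) c) x e"
      unfolding essentially_surjective_def using X by blast
    then have "(c, inv_in (PO F X) e) \<in> Ob (el_hom C F (I, i) (X, x))"
      by (auto simp: iso_in_iff)
    then show "Ob (el_hom C F (I, i) (X, x)) \<noteq> {}" by blast
    fix s t assume s: "s \<in> Ob (el_hom C F (I, i) (X, x))" and t: "t \<in> Ob (el_hom C F (I, i) (X, x))"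
    obtain c \<psi> d \<phi> where cd: "s = (c, \<psi>)" "t = (d, \<phi>)" by fastforce
    have [simp]: "c \<in> Ob (Hom C X I)" "d \<in> Ob (Hom C X I)"
        "\<psi> \<in> Ar (PO F X)" "Dom (PO F X) \<psi> = x" "Cod (PO F X) \<psi> = act F I X c i" "is_iso (PO F X) \<psi>"
        "\<phi> \<in> Ar (PO F X)" "Dom (PO F X) \<phi> = x" "Cod (PO F X) \<phi> = act F I X d i" "is_iso (PO F X) \<phi>"
      using s t cd by (auto simp: iso_in_iff)
    let ?\<theta> = "\<phi> \<cdot>[PO F X] inv_in (PO F X) \<psi>"
    have "iso_in (PO F X) (FOb (evaluation C F I i X) c) (FOb (evaluation C F I i X) d) ?\<theta>"
      by (simp add: iso_in_iff)
    then have ex: "\<exists>!\<gamma>. \<gamma> \<in> hom (Hom C X I) c d \<and> FAr (evaluation C F I i X) \<gamma> = ?\<theta>"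
      using R[rule_format, OF X(1)] unfolding iso_lifting_def by simp
    have cell: "\<beta> \<in> hom (el_hom C F (I, i) (X, x)) s t \<longleftrightarrow> Src \<beta> = s \<and> Tgt \<beta> = t \<and>
        (Und \<beta> \<in> hom (Hom C X I) c d \<and> FAr (evaluation C F I i X) (Und \<beta>) = ?\<theta>)" for \<beta>
    proof -
      have "act_cell F I X \<gamma> i \<cdot>[PO F X] \<psi> = \<phi> \<longleftrightarrow> act_cell F I X \<gamma> i = ?\<theta>"
        if "\<gamma> \<in> Ar (Hom C X I)" "Dom (Hom C X I) \<gamma> = c" "Cod (Hom C X I) \<gamma> = d" for \<gamma>
      proof
        assume "act_cell F I X \<gamma> i \<cdot>[PO F X] \<psi> = \<phi>"
        then have "act_cell F I X \<gamma> i \<cdot>[PO F X] \<psi> = ?\<theta> \<cdot>[PO F X] \<psi>" by simp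
        then show "act_cell F I X \<gamma> i = ?\<theta>" by (rule iso_cancel_right) (use that in auto)
      qed (use that in simp)
      then show ?thesis
        using s t by (auto simp: in_hom cd)
    qed
    obtain \<gamma> where \<gamma>: "\<gamma> \<in> hom (Hom C X I) c d \<and> FAr (evaluation C F I i X) \<gamma> = ?\<theta>" using ex by blast
    show "\<exists>!\<beta>. \<beta> \<in> hom (el_hom C F (I, i) (X, x)) s t"
    proof (rule ex1I[of _ "\<lparr>Src = s, Tgt = t, Und = \<gamma>\<rparr>"])
      show "\<lparr>Src = s, Tgt = t, Und = \<gamma>\<rparr> \<in> hom (el_hom C F (I, i) (X, x)) s t"
        unfolding cell using \<gamma> by simp
      fix \<beta> assume "\<beta> \<in> hom (el_hom C F (I, i) (X, x)) s t"
      then have "Src \<beta> = s" "Tgt \<beta> = t" "Und \<beta> = \<gamma>"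
        unfolding cell using ex \<gamma> by blast+
      then show "\<beta> = \<lparr>Src = s, Tgt = t, Und = \<gamma>\<rparr>" by simp
    qed
  qed
qed

end

section \<open>Tensors by the arrow category\<close>

lemma arrow_cat_simps [simp]:
  "Ob arrow_cat = UNIV" "(a, b) \<in> Ar arrow_cat \<longleftrightarrow> a \<le> b" "Dom arrow_cat = fst" "Cod arrow_cat = snd"
  "Ide arrow_cat a = (a, a)" "g \<cdot>[arrow_cat] f = (fst f, snd g)"
  by (simp_all add: arrow_cat_def)

lemma arrow_cat_Ar: "p \<in> Ar arrow_cat \<longleftrightarrow> p = (False, False) \<or> p = (False, True) \<or> p = (True, True)"
  by (cases p) (auto simp: le_bool_def)

lemma category_arrow_cat [simp]: "category arrow_cat"
  by (rule category.intro) (auto simp: in_hom arrow_cat_Ar)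

definition arrow_functor :: "('o, 'a) cat \<Rightarrow> 'a \<Rightarrow> (bool, bool \<times> bool, 'o, 'a) ftr" where
  "arrow_functor B u = \<lparr>
     FOb = (\<lambda>a. if a then Cod B u else Dom B u),
     FAr = (\<lambda>p\<in>Ar arrow_cat. if fst p = snd p then Ide B (if fst p then Cod B u else Dom B u) else u)\<rparr>"

lemma arrow_functor_simps [simp]:
  "FOb (arrow_functor B u) False = Dom B u" "FOb (arrow_functor B u) True = Cod B u"
  "FAr (arrow_functor B u) (False, True) = u"
  by (simp_all add: arrow_functor_def)

lemma arrow_functor: "category B \<Longrightarrow> u \<in> Ar B \<Longrightarrow> cat_functor arrow_cat B (arrow_functor B u)"
  by (rule functorI) (auto simp: arrow_functor_def arrow_cat_Ar extensional_def)

lemma cat_iso_surj_ob: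
  assumes "cat_iso A B F" "y \<in> Ob B"
  obtains x where "x \<in> Ob A" "FOb F x = y"
proof -
  obtain G where G: "cat_functor B A G" "comp_ftr B F G = id_ftr B"
    using assms(1) unfolding cat_iso_def by blast
  have "FOb F (FOb G y) = y"
    using arg_cong[OF G(2), of "\<lambda>H. FOb H y"] assms(2) by simp
  then show ?thesis using that functor_arr(1)[OF G(1) assms(2)] by blast
qed

lemma cat_iso_lift_iso:
  assumes A: "category A" "category B" and F: "cat_iso A B F" and x: "x \<in> Ob A" "y \<in> Ob A"
    and w: "iso_in B (FOb F x) (FOb F y) w"
  obtains u where "iso_in A x y u" "FAr F u = w"
proof -
  obtain G where G: "cat_functor B A G" "comp_ftr B F G = id_ftr B" "comp_ftr A G F = id_ftr A"
    using F unfolding cat_iso_def by blast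
  have w': "w \<in> Ar B" "Dom B w = FOb F x" "Cod B w = FOb F y" "is_iso B w"
    using w by (auto simp: iso_in_iff)
  have "FOb G (FOb F z) = z" if "z \<in> Ob A" for z
    using arg_cong[OF G(3), of "\<lambda>H. FOb H z"] that by simp
  then have "iso_in A x y (FAr G w)"
    using functor_iso[OF G(1) A(2,1) w'(4)] functor_arr(2-4)[OF G(1) w'(1)] w' x by (simp add: iso_in_iff)
  moreover have "FAr F (FAr G w) = w"
    using arg_cong[OF G(2), of "\<lambda>H. FAr H w"] w'(1) by simp
  ultimately show ?thesis using that by blast
qed

lemma eval_ob_simps [simp]:
  "cat_functor A B G \<Longrightarrow> FOb (eval_ob A B a) G = FOb G a"
  "nat_trans A B \<alpha> \<Longrightarrow> FAr (eval_ob A B a) \<alpha> = NAt \<alpha> a"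
  by (simp_all add: eval_ob_def)

lemma eval_ob_functor:
  assumes A: "category A" "category B" and a: "a \<in> Ob A"
  shows "cat_functor (functor_cat A B) B (eval_ob A B a)"
proof (rule functorI)
  fix G assume G: "G \<in> Ob (functor_cat A B)"
  show "FOb (eval_ob A B a) G \<in> Ob B" using G functor_arr(1)[of A B G] a by simp
  show "FAr (eval_ob A B a) (Ide (functor_cat A B) G) = Ide B (FOb (eval_ob A B a) G)"
    using G nat_trans_Ide[OF A] a by simp
next
  fix \<alpha> assume "\<alpha> \<in> Ar (functor_cat A B)"
  then have \<alpha>: "nat_trans A B \<alpha>" by simp
  show "FAr (eval_ob A B a) \<alpha> \<in> Ar B \<and>
      Dom B (FAr (eval_ob A B a) \<alpha>) = FOb (eval_ob A B a) (Dom (functor_cat A B) \<alpha>) \<and>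
      Cod B (FAr (eval_ob A B a) \<alpha>) = FOb (eval_ob A B a) (Cod (functor_cat A B) \<alpha>)"
    using \<alpha> nat_trans_arr(1-5)[OF \<alpha>] a by simp
next
  fix \<alpha> \<beta> assume *: "\<alpha> \<in> Ar (functor_cat A B)" "\<beta> \<in> Ar (functor_cat A B)"
    "Cod (functor_cat A B) \<alpha> = Dom (functor_cat A B) \<beta>"
  then have "nat_trans A B (\<beta> \<cdot>[functor_cat A B] \<alpha>)" using nat_trans_Comp[OF A] by simp
  then show "FAr (eval_ob A B a) (\<beta> \<cdot>[functor_cat A B] \<alpha>) =
      FAr (eval_ob A B a) \<beta> \<cdot>[B] FAr (eval_ob A B a) \<alpha>"
    using * a by simp
qed (simp_all add: eval_ob_def)

lemma eval_cone_at:
  assumes A: "category A" "category B" and u: "u \<in> Ar A"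
  shows "nat_trans (functor_cat A B) B (FAr (eval_cone A B) u)"
    "NDom (FAr (eval_cone A B) u) = eval_ob A B (Dom A u)"
    "NCod (FAr (eval_cone A B) u) = eval_ob A B (Cod A u)"
    "cat_functor A B G \<Longrightarrow> NAt (FAr (eval_cone A B) u) G = FAr G u"
proof -
  show eq: "NDom (FAr (eval_cone A B) u) = eval_ob A B (Dom A u)"
    "NCod (FAr (eval_cone A B) u) = eval_ob A B (Cod A u)"
    "cat_functor A B G \<Longrightarrow> NAt (FAr (eval_cone A B) u) G = FAr G u" for G
    using u by (simp_all add: eval_cone_def)
  show "nat_trans (functor_cat A B) B (FAr (eval_cone A B) u)"
  proof (rule nat_transI)
    fix G assume "G \<in> Ob (functor_cat A B)"
    then have G: "cat_functor A B G" by simp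
    then show "NAt (FAr (eval_cone A B) u) G \<in> Ar B \<and>
         Dom B (NAt (FAr (eval_cone A B) u) G) = FOb (NDom (FAr (eval_cone A B) u)) G \<and>
         Cod B (NAt (FAr (eval_cone A B) u) G) = FOb (NCod (FAr (eval_cone A B) u)) G"
      using eq(3)[OF G] functor_arr[OF G] u A by (simp add: eq(1,2))
  next
    fix \<alpha> assume "\<alpha> \<in> Ar (functor_cat A B)"
    then have \<alpha>: "nat_trans A B \<alpha>" by simp
    show "NAt (FAr (eval_cone A B) u) (Cod (functor_cat A B) \<alpha>) \<cdot>[B] FAr (NDom (FAr (eval_cone A B) u)) \<alpha> =
         FAr (NCod (FAr (eval_cone A B) u)) \<alpha> \<cdot>[B] NAt (FAr (eval_cone A B) u) (Dom (functor_cat A B) \<alpha>)"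
      using \<alpha> nat_trans_arr(1,2)[OF \<alpha>] nat_trans_arr(6)[OF \<alpha> u] eq(3) by (simp add: eq(1,2))
  next
    show "NAt (FAr (eval_cone A B) u) \<in> extensional (Ob (functor_cat A B))"
      using u by (simp add: eval_cone_def)
  qed (use eq eval_ob_functor[OF A] A u in auto)
qed

locale presheaf_with_arrow_tensors = presheaf C F
  for C :: "('o, 'm, 't) twocat"
    and F :: "('o, 'm, 't, 'p, 'b) cat_psf" +
  fixes T :: "'o \<Rightarrow> 'o" and Z :: "'o \<Rightarrow> (bool, bool \<times> bool, 'm, 't) ftr"
  assumes tensors: "has_tensors C arrow_cat T Z"
    and preserves: "preserves_tensors C arrow_cat T Z F"
begin

text \<open>The tensor cone of \<open>X\<close> is a 2-morphism \<open>univ_cell X\<close> between the two morphisms \<open>end_of a X\<close>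
  from \<open>X\<close> to \<open>T X\<close>, and \<open>F\<close> turns it into a natural transformation between two functors from
  \<open>F (T X)\<close> to \<open>F X\<close>.\<close>

abbreviation end_of :: "bool \<Rightarrow> 'o \<Rightarrow> 'm" where
  "end_of a X \<equiv> FOb (Z X) a"

abbreviation univ_cell :: "'o \<Rightarrow> 't" where
  "univ_cell X \<equiv> FAr (Z X) (False, True)"

abbreviation at_end :: "bool \<Rightarrow> 'o \<Rightarrow> 'p \<Rightarrow> 'p" where
  "at_end a X \<equiv> act F (T X) X (end_of a X)"

abbreviation at_end_ar :: "bool \<Rightarrow> 'o \<Rightarrow> 'b \<Rightarrow> 'b" where
  "at_end_ar a X \<equiv> act_ar F (T X) X (end_of a X)"

abbreviation at_cell :: "'o \<Rightarrow> 'p \<Rightarrow> 'b" where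
  "at_cell X \<equiv> act_cell F (T X) X (univ_cell X)"

lemma tensor_simps [simp]:
  assumes "X \<in> Obj C"
  shows "T X \<in> Obj C" "end_of a X \<in> Ob (Hom C X (T X))" "univ_cell X \<in> Ar (Hom C X (T X))"
    "Dom (Hom C X (T X)) (univ_cell X) = end_of False X"
    "Cod (Hom C X (T X)) (univ_cell X) = end_of True X"
proof -
  have "T X \<in> Obj C" and Z: "cat_functor arrow_cat (Hom C X (T X)) (Z X)"
    using tensors assms by (auto simp: has_tensors_def is_tensor_def)
  then show "T X \<in> Obj C" "end_of a X \<in> Ob (Hom C X (T X))" "univ_cell X \<in> Ar (Hom C X (T X))"
    "Dom (Hom C X (T X)) (univ_cell X) = end_of False X"
    "Cod (Hom C X (T X)) (univ_cell X) = end_of True X"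
    using functor_arr[OF Z] by simp_all
qed

lemma tensor_classifies_cells:
  assumes "X \<in> Obj C" "Y \<in> Obj C" "\<gamma> \<in> Ar (Hom C X Y)"
  obtains h where "h \<in> Ob (Hom C (T X) Y)" "HC1 C X (T X) Y h (end_of False X) = Dom (Hom C X Y) \<gamma>"
    "HC1 C X (T X) Y h (end_of True X) = Cod (Hom C X Y) \<gamma>" "lwh C X (T X) Y h (univ_cell X) = \<gamma>"
proof -
  have "cat_iso (Hom C (T X) Y) (functor_cat arrow_cat (Hom C X Y)) (tensor_comparison C arrow_cat X (T X) (Z X) Y)"
    using tensors assms by (auto simp: has_tensors_def is_tensor_def)
  then obtain h where h: "h \<in> Ob (Hom C (T X) Y)"
      "FOb (tensor_comparison C arrow_cat X (T X) (Z X) Y) h = arrow_functor (Hom C X Y) \<gamma>"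
    by (rule cat_iso_surj_ob[of _ _ _ "arrow_functor (Hom C X Y) \<gamma>"]) (use assms in \<open>auto simp: arrow_functor\<close>)
  then have eq: "tensor_ob C arrow_cat X (T X) (Z X) Y h = arrow_functor (Hom C X Y) \<gamma>"
    by (simp add: tensor_comparison_def)
  show ?thesis
    by (rule that[OF h(1)])
      (use arg_cong[OF eq, of "\<lambda>G. FOb G False"] arg_cong[OF eq, of "\<lambda>G. FOb G True"]
        arg_cong[OF eq, of "\<lambda>G. FAr G (False, True)"] in \<open>simp_all add: tensor_ob_def\<close>)
qed

text \<open>Compatibility of \<open>\<Theta>\<close> with the cones, read off at the two objects and at the nonidentity arrow
  of the arrow category: \<open>\<Theta>\<close> sends \<open>y\<close> to the arrow \<open>at_cell X y\<close>, and \<open>v\<close> to the square with sides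
  \<open>at_end_ar a X v\<close>.\<close>

lemma power_comparison:
  assumes X [simp]: "X \<in> Obj C"
  obtains \<Theta> where "cat_iso (PO F (T X)) (functor_cat arrow_cat (PO F X)) \<Theta>"
    and "\<And>y a. y \<in> Ob (PO F (T X)) \<Longrightarrow> FOb (FOb \<Theta> y) a = at_end a X y"
    and "\<And>v a. v \<in> Ar (PO F (T X)) \<Longrightarrow> NAt (FAr \<Theta> v) a = at_end_ar a X v"
    and "\<And>y. y \<in> Ob (PO F (T X)) \<Longrightarrow> FAr (FOb \<Theta> y) (False, True) = at_cell X y"
proof -
  let ?P = "functor_cat arrow_cat (PO F X)"
  obtain \<Theta> where \<Theta>: "cat_iso (PO F (T X)) ?P \<Theta>"
    and eq: "comp_ftr arrow_cat (precomp (PO F (T X)) ?P (PO F X) \<Theta>) (eval_cone arrow_cat (PO F X))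
      = comp_ftr arrow_cat (PF F (T X) X) (Z X)"
    using preserves X unfolding preserves_tensors_def by blast
  have \<Theta>F: "cat_functor (PO F (T X)) ?P \<Theta>" using \<Theta> by (simp add: cat_iso_def)
  note [simp] = functor_arr(1-4)[OF \<Theta>F, simplified] eval_ob_functor nat_trans_Ide
  have ob: "comp_ftr (PO F (T X)) (eval_ob arrow_cat (PO F X) a) \<Theta> = FOb (PF F (T X) X) (end_of a X)" for a
    using arg_cong[OF eq, of "\<lambda>G. FOb G a"] by (simp add: precomp_def eval_cone_def)
  have ar: "hcomp_nat (PO F (T X)) (PO F X) (FAr (eval_cone arrow_cat (PO F X)) (False, True))
      (Ide (functor_cat (PO F (T X)) ?P) \<Theta>) = FAr (PF F (T X) X) (univ_cell X)"
    using arg_cong[OF eq, of "\<lambda>G. FAr G (False, True)"] eval_cone_at(1)[of arrow_cat "PO F X" "(False, True)"]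
    by (simp add: precomp_def)
  show ?thesis
  proof (rule that[OF \<Theta>])
    fix y a assume y: "y \<in> Ob (PO F (T X))"
    show "FOb (FOb \<Theta> y) a = at_end a X y"
      using arg_cong[OF ob[of a], of "\<lambda>G. FOb G y"] y by simp
    show "FAr (FOb \<Theta> y) (False, True) = at_cell X y"
      using arg_cong[OF ar, of "\<lambda>\<alpha>. NAt \<alpha> y"] y eval_cone_at[of arrow_cat "PO F X" "(False, True)"]
        functor_arr[OF functor_arr(1)[OF \<Theta>F y, simplified]]
      by simp
  next
    fix v a assume v: "v \<in> Ar (PO F (T X))"
    show "NAt (FAr \<Theta> v) a = at_end_ar a X v"
      using arg_cong[OF ob[of a], of "\<lambda>G. FAr G v"] v by simp
  qed
qed

lemma power_object:
  assumes X [simp]: "X \<in> Obj C" and u [simp]: "u \<in> Ar (PO F X)"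
  obtains y where "y \<in> Ob (PO F (T X))" "at_end False X y = Dom (PO F X) u"
    "at_end True X y = Cod (PO F X) u" "at_cell X y = u"
proof -
  obtain \<Theta> where \<Theta>: "cat_iso (PO F (T X)) (functor_cat arrow_cat (PO F X)) \<Theta>"
    "\<And>y a. y \<in> Ob (PO F (T X)) \<Longrightarrow> FOb (FOb \<Theta> y) a = at_end a X y"
    "\<And>y. y \<in> Ob (PO F (T X)) \<Longrightarrow> FAr (FOb \<Theta> y) (False, True) = at_cell X y"
    using power_comparison[OF X] by metis
  obtain y where y: "y \<in> Ob (PO F (T X))" "FOb \<Theta> y = arrow_functor (PO F X) u"
    by (rule cat_iso_surj_ob[OF \<Theta>(1), of "arrow_functor (PO F X) u"]) (auto simp: arrow_functor)
  show ?thesis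
    by (rule that[OF y(1)])
      (simp_all only: y(2) arrow_functor_simps flip: \<Theta>(2)[OF y(1)] \<Theta>(3)[OF y(1)])
qed

lemma power_iso:
  assumes X [simp]: "X \<in> Obj C" and y [simp]: "y \<in> Ob (PO F (T X))" "y' \<in> Ob (PO F (T X))"
    and v: "\<And>a. iso_in (PO F X) (at_end a X y) (at_end a X y') (v a)"
    and sq: "at_cell X y' \<cdot>[PO F X] v False = v True \<cdot>[PO F X] at_cell X y"
  obtains w where "iso_in (PO F (T X)) y y' w" "\<And>a. at_end_ar a X w = v a"
proof -
  obtain \<Theta> where \<Theta>: "cat_iso (PO F (T X)) (functor_cat arrow_cat (PO F X)) \<Theta>"
    "\<And>y a. y \<in> Ob (PO F (T X)) \<Longrightarrow> FOb (FOb \<Theta> y) a = at_end a X y"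
    "\<And>v a. v \<in> Ar (PO F (T X)) \<Longrightarrow> NAt (FAr \<Theta> v) a = at_end_ar a X v"
    "\<And>y. y \<in> Ob (PO F (T X)) \<Longrightarrow> FAr (FOb \<Theta> y) (False, True) = at_cell X y"
    using power_comparison[OF X] by metis
  have [simp]: "v a \<in> Ar (PO F X)" "Dom (PO F X) (v a) = at_end a X y"
    "Cod (PO F X) (v a) = at_end a X y'" "is_iso (PO F X) (v a)" for a
    using v[of a] by (auto simp: iso_in_iff)
  have \<Theta>F: "cat_functor (PO F (T X)) (functor_cat arrow_cat (PO F X)) \<Theta>" using \<Theta>(1) by (simp add: cat_iso_def)
  note \<Theta>y = functor_arr(1)[OF \<Theta>F y(1), simplified] functor_arr(1)[OF \<Theta>F y(2), simplified]
  have \<Theta>_id: "FAr (FOb \<Theta> y) (a, a) = Ide (PO F X) (at_end a X y)"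
    "FAr (FOb \<Theta> y') (a, a) = Ide (PO F X) (at_end a X y')" for a
    using functor_arr(5)[OF \<Theta>y(1), of a] functor_arr(5)[OF \<Theta>y(2), of a] \<Theta>(2) by simp_all
  let ?\<alpha> = "\<lparr>NDom = FOb \<Theta> y, NCod = FOb \<Theta> y', NAt = v\<rparr>"
  have \<alpha>: "nat_trans arrow_cat (PO F X) ?\<alpha>"
    by (rule nat_transI) (use \<Theta>y \<Theta>_id sq in \<open>auto simp: \<Theta> arrow_cat_Ar\<close>)
  then have "iso_in (functor_cat arrow_cat (PO F X)) (FOb \<Theta> y) (FOb \<Theta> y') ?\<alpha>"
    using is_iso_nat_transI[OF _ _ \<alpha>] by (simp add: iso_in_iff)
  then obtain w where w: "iso_in (PO F (T X)) y y' w" "FAr \<Theta> w = ?\<alpha>"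
    by (rule cat_iso_lift_iso[OF _ _ \<Theta>(1) y, rotated 2]) auto
  have "at_end_ar a X w = v a" for a
    using \<Theta>(3)[of w a] w by (simp add: iso_in_iff)
  then show ?thesis using that w(1) by blast
qed

text \<open>Write \<open>E X c = (F c) i\<close>, and let \<open>h : T X \<rightarrow> I\<close> classify a 2-morphism \<open>\<gamma> : c \<Rightarrow> d\<close>. The compositors
  \<open>k\<close> form an isomorphism between the arrow of \<open>F X\<close> that the object \<open>E (T X) h\<close> of \<open>F (T X)\<close>
  stands for and the arrow \<open>E X \<gamma>\<close>.

  If \<open>E X \<gamma> = E X \<gamma>'\<close>, with \<open>h'\<close> classifying \<open>\<gamma>'\<close>, the compositors hence form an isomorphism
  \<open>w : E (T X) h \<cong> E (T X) h'\<close> in \<open>F (T X)\<close>. It lifts to some \<open>\<beta> : h \<Rightarrow> h'\<close>. Restricting \<open>\<beta>\<close> to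
  either end of \<open>T X\<close> gives a 2-morphism that \<open>E X\<close> sends to an identity, so that it is an identity
  by uniqueness of lifts of isomorphisms. Naturality of \<open>\<beta>\<close> with respect to the universal
  2-morphism then reads \<open>\<gamma> = \<gamma>'\<close>.

  For fullness, an arrow \<open>w : E X c \<rightarrow> E X d\<close> is an object \<open>y\<close> of \<open>F (T X)\<close>. Essential surjectivity
  provides \<open>y \<cong> E (T X) h\<close>, so that \<open>w\<close> is isomorphic to \<open>E X\<close> of the 2-morphism classified by \<open>h\<close>.
  The isomorphisms at the two ends lie between values of \<open>E X\<close>; they lift, and conjugating with
  their lifts gives a preimage of \<open>w\<close>.\<close>

theorem evaluation_fully_faithful:
  assumes I [simp]: "I \<in> Obj C" "i \<in> Ob (PO F I)"
    and es: "\<And>X. X \<in> Obj C \<Longrightarrow> essentially_surjective (Hom C X I) (PO F X) (evaluation C F I i X)"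
    and lift: "\<And>X. X \<in> Obj C \<Longrightarrow> iso_lifting (Hom C X I) (PO F X) (evaluation C F I i X)"
    and X [simp]: "X \<in> Obj C"
  shows "fully_faithful (Hom C X I) (PO F X) (evaluation C F I i X)"
proof -
  let ?HX = "Hom C X I" and ?HT = "Hom C (T X) I" and ?FX = "PO F X" and ?FT = "PO F (T X)"
    and ?E = "evaluation C F I i X" and ?a = "act F I (T X)" and ?c = "HC1 C X (T X) I"
    and ?l = "lwh C X (T X) I" and ?r = "rwh C X (T X) I"
  let ?k = "\<lambda>a h. cmp F I (T X) X (end_of a X) h i"
  have lift_ex: "\<exists>\<gamma>. \<gamma> \<in> Ar (Hom C Y I) \<and> Dom (Hom C Y I) \<gamma> = c \<and> Cod (Hom C Y I) \<gamma> = d \<and> act_cell F I Y \<gamma> i = \<theta>"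
    if "Y \<in> Obj C" "c \<in> Ob (Hom C Y I)" "d \<in> Ob (Hom C Y I)" "\<theta> \<in> Ar (PO F Y)" "Dom (PO F Y) \<theta> = act F I Y c i"
      "Cod (PO F Y) \<theta> = act F I Y d i" "is_iso (PO F Y) \<theta>" for Y c d \<theta>
  proof -
    have "iso_in (PO F Y) (FOb (evaluation C F I i Y) c) (FOb (evaluation C F I i Y) d) \<theta>"
      using that by (simp add: iso_in_iff)
    then have "\<exists>\<gamma>. \<gamma> \<in> hom (Hom C Y I) c d \<and> FAr (evaluation C F I i Y) \<gamma> = \<theta>"
      using lift[OF that(1)] that(2,3) unfolding iso_lifting_def by blast
    then show ?thesis by (auto simp: in_hom)
  qed
  have lift_Ide: "\<gamma> = Ide ?HX c"
    if "\<gamma> \<in> Ar ?HX" "Dom ?HX \<gamma> = c" "Cod ?HX \<gamma> = c"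
      "act_cell F I X \<gamma> i = Ide ?FX (act F I X c i)" for \<gamma> c
  proof -
    have c: "c \<in> Ob ?HX" using that Dom_Ob[of "Hom C X I" \<gamma>] by simp
    then have "iso_in ?FX (FOb ?E c) (FOb ?E c)
        (Ide ?FX (act F I X c i))" by (simp add: iso_in_iff)
    then have "\<exists>!\<gamma>. \<gamma> \<in> hom ?HX c c \<and> FAr ?E \<gamma> = Ide ?FX (act F I X c i)"
      using lift[OF X] c unfolding iso_lifting_def by blast
    moreover have "\<gamma> \<in> hom ?HX c c \<and> FAr ?E \<gamma> = Ide ?FX (act F I X c i)"
      "Ide ?HX c \<in> hom ?HX c c \<and>
       FAr ?E (Ide ?HX c) = Ide ?FX (act F I X c i)"
      using that c by (auto simp: in_hom)
    ultimately show ?thesis by blast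
  qed
  have cell_lwh: "act_cell F I X (?l h (univ_cell X)) i \<cdot>[?FX] ?k False h
      = ?k True h \<cdot>[?FX] at_cell X (?a h i)"
    if "h \<in> Ob ?HT" for h
    using cmp_cell[of I "T X" X i "Ide ?HT h" h h "univ_cell X" "end_of False X" "end_of True X"] that
    by (simp add: lwh_def)
  show ?thesis
  proof (rule fully_faithfulI[OF _ _ evaluation_functor])
    fix \<gamma> \<gamma>'
    assume [simp]: "\<gamma> \<in> Ar ?HX" "\<gamma>' \<in> Ar ?HX" "Dom ?HX \<gamma> = Dom ?HX \<gamma>'"
      "Cod ?HX \<gamma> = Cod ?HX \<gamma>'"
      and eq: "FAr ?E \<gamma> = FAr ?E \<gamma>'"
    have eq [simp]: "act_cell F I X \<gamma> i = act_cell F I X \<gamma>' i" using eq by simp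
    define e where "e a = (if a then Cod ?HX \<gamma>' else Dom ?HX \<gamma>')" for a
    have [simp]: "e a \<in> Ob ?HX" for a by (simp add: e_def)
    obtain h where h [simp]: "h \<in> Ob ?HT" "\<And>a. ?c h (end_of a X) = e a"
        and h\<gamma>: "?l h (univ_cell X) = \<gamma>"
    proof (rule tensor_classifies_cells[of X I \<gamma>])
      fix h assume "h \<in> Ob ?HT" "?c h (end_of False X) = Dom ?HX \<gamma>"
        "?c h (end_of True X) = Cod ?HX \<gamma>" "?l h (univ_cell X) = \<gamma>"
      moreover then have "?c h (end_of a X) = e a" for a by (cases a) (simp_all add: e_def)
      ultimately show thesis using that by blast
    qed auto
    obtain h' where h' [simp]: "h' \<in> Ob ?HT" "\<And>a. ?c h' (end_of a X) = e a"
        and h\<gamma>': "?l h' (univ_cell X) = \<gamma>'"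
    proof (rule tensor_classifies_cells[of X I \<gamma>'])
      fix h assume "h \<in> Ob ?HT" "?c h (end_of False X) = Dom ?HX \<gamma>'"
        "?c h (end_of True X) = Cod ?HX \<gamma>'" "?l h (univ_cell X) = \<gamma>'"
      moreover then have "?c h (end_of a X) = e a" for a by (cases a) (simp_all add: e_def)
      ultimately show thesis using that by blast
    qed auto
    \<comment> \<open>Both 2-morphisms have the same ends, so the compositors of \<open>h\<close> and \<open>h'\<close> have the same codomains.\<close>
    define v where "v a = inv_in ?FX (?k a h')
      \<cdot>[?FX] ?k a h" for a
    have v_iso: "iso_in ?FX (at_end a X (?a h i))
       (at_end a X (?a h' i)) (v a)" for a
      by (simp add: v_def iso_in_iff)
    have "?k True h' \<cdot>[?FX]
        (at_cell X (?a h' i) \<cdot>[?FX] v False) =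
      ?k True h' \<cdot>[?FX]
        (v True \<cdot>[?FX] at_cell X (?a h i))"
      by (simp add: v_def comp_extend[OF cell_lwh[symmetric]] cell_lwh[symmetric] h\<gamma> h\<gamma>' e_def)
    then have sq: "at_cell X (?a h' i) \<cdot>[?FX] v False =
        v True \<cdot>[?FX] at_cell X (?a h i)"
      by (rule iso_cancel_left) (auto simp: v_def)
    obtain w where "iso_in ?FT (?a h i) (?a h' i) w"
        and w: "\<And>a. at_end_ar a X w = v a"
      by (rule power_iso[of X "?a h i" "?a h' i" v]) (use v_iso sq in auto)
    then obtain \<beta> where \<beta> [simp]: "\<beta> \<in> Ar ?HT" "Dom ?HT \<beta> = h" "Cod ?HT \<beta> = h'"
        "act_cell F I (T X) \<beta> i = w"
      using lift_ex[of "T X" h h' w] by (auto simp: iso_in_iff)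
    have \<beta>_end: "?r \<beta> (end_of a X) = Ide ?HX (e a)" for a
    proof (rule lift_Ide)
      have "act_cell F I X (?r \<beta> (end_of a X)) i \<cdot>[?FX] ?k a h
        = ?k a h' \<cdot>[?FX] v a"
        using cmp_cell[of I "T X" X i \<beta> h h' "Ide (Hom C X (T X)) (end_of a X)" "end_of a X" "end_of a X"] w[of a] v_iso[of a]
        by (simp add: rwh_def iso_in_iff)
      also have "\<dots> = Ide ?FX (act F I X (e a) i) \<cdot>[?FX] ?k a h"
        by (simp add: v_def)
      finally show "act_cell F I X (?r \<beta> (end_of a X)) i = Ide ?FX (act F I X (e a) i)"
        by (rule iso_cancel_right) auto
    qed auto
    have "?r \<beta> (end_of True X) \<cdot>[?HX] \<gamma> = \<gamma>' \<cdot>[?HX] ?r \<beta> (end_of False X)"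
      using C.HC2_whisker[of X "T X" I "univ_cell X" \<beta>] by (simp add: h\<gamma> h\<gamma>')
    then show "\<gamma> = \<gamma>'"
      unfolding \<beta>_end by (simp add: e_def)
  next
    fix c d w
    assume [simp]: "c \<in> Ob ?HX" "d \<in> Ob ?HX" "w \<in> Ar ?FX"
      and "Dom ?FX w = FOb ?E c" "Cod ?FX w = FOb ?E d"
    then have [simp]: "Dom ?FX w = act F I X c i" "Cod ?FX w = act F I X d i" by simp_all
    obtain y where y [simp]: "y \<in> Ob ?FT" "at_end False X y = act F I X c i"
        "at_end True X y = act F I X d i" "at_cell X y = w"
      by (rule power_object[of X w]) auto
    obtain h e where h [simp]: "h \<in> Ob ?HT" and "iso_in ?FT (FOb (evaluation C F I i (T X)) h) y e"
      using es[OF tensor_simps(1)[OF X]] y(1) unfolding essentially_surjective_def by blast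
    then have [simp]: "e \<in> Ar ?FT" "Dom ?FT e = ?a h i" "Cod ?FT e = y"
        "is_iso ?FT e" by (simp_all add: iso_in_iff)
    \<comment> \<open>The isomorphism from \<open>w\<close> to the evaluation of the 2-morphism classified by \<open>h\<close>, at the end \<open>a\<close>.\<close>
    define \<theta> where "\<theta> a = ?k a h \<cdot>[?FX]
        at_end_ar a X (inv_in ?FT e)" for a
    have \<theta>_iso: "iso_in ?FX (at_end a X y) (act F I X (?c h (end_of a X)) i) (\<theta> a)" for a
      by (simp add: \<theta>_def iso_in_iff)
    then have [simp]: "\<theta> a \<in> Ar ?FX" "Dom ?FX (\<theta> a) = at_end a X y"
        "Cod ?FX (\<theta> a) = act F I X (?c h (end_of a X)) i" "is_iso ?FX (\<theta> a)" for a
      by (simp_all add: iso_in_iff)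
    obtain \<gamma>0 where [simp]: "\<gamma>0 \<in> Ar ?HX" "Dom ?HX \<gamma>0 = c"
        "Cod ?HX \<gamma>0 = ?c h (end_of False X)" "act_cell F I X \<gamma>0 i = \<theta> False"
      using lift_ex[of X c "?c h (end_of False X)" "\<theta> False"] by auto
    obtain \<gamma>1 where [simp]: "\<gamma>1 \<in> Ar ?HX" "Cod ?HX \<gamma>1 = d"
        "Dom ?HX \<gamma>1 = ?c h (end_of True X)" "act_cell F I X \<gamma>1 i = inv_in ?FX (\<theta> True)"
      using lift_ex[of X "?c h (end_of True X)" d "inv_in ?FX (\<theta> True)"] by auto
    have nat: "at_cell X (?a h i) \<cdot>[?FX]
          at_end_ar False X (inv_in ?FT e)
        = at_end_ar True X (inv_in ?FT e) \<cdot>[?FX] w"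
      using cell_natural[of "T X" X "univ_cell X" "end_of False X" "end_of True X" "inv_in ?FT e" y "?a h i"]
      by simp
    have sq: "act_cell F I X (?l h (univ_cell X)) i \<cdot>[?FX] \<theta> False = \<theta> True \<cdot>[?FX] w"
      by (simp add: \<theta>_def comp_extend[OF cell_lwh] nat)
    let ?\<gamma> = "\<gamma>1 \<cdot>[?HX] (?l h (univ_cell X) \<cdot>[?HX] \<gamma>0)"
    have "act_cell F I X ?\<gamma> i = w"
      by (simp add: sq)
    then have "?\<gamma> \<in> Ar ?HX \<and> Dom ?HX ?\<gamma> = c \<and> Cod ?HX ?\<gamma> = d \<and>
        FAr ?E ?\<gamma> = w" by simp
    then show "\<exists>\<gamma>. \<gamma> \<in> Ar ?HX \<and> Dom ?HX \<gamma> = c \<and> Cod ?HX \<gamma> = d \<and>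
        FAr ?E \<gamma> = w" by blast
  qed auto
qed

end

section \<open>Pseudo-natural transformations and modifications in components\<close>

locale cat_pnt = F: cat_valued K F + G: cat_valued K G + pseudo_natural K Cat F G \<sigma>
  for K :: "('o, 'm, 't) twocat"
    and F G :: "('o, 'm, 't, 'p, 'b) cat_psf"
    and \<sigma> :: "('o, 'm, 'p, 'b) cat_tr"
begin

lemma SOb_functor: "X \<in> Obj K \<Longrightarrow> cat_functor (PO F X) (PO G X) (SOb \<sigma> X)"
  using sob_closed by simp

lemma SOb_simps [simp]:
  assumes "X \<in> Obj K"
  shows "x \<in> Ob (PO F X) \<Longrightarrow> FOb (SOb \<sigma> X) x \<in> Ob (PO G X)"
    "u \<in> Ar (PO F X) \<Longrightarrow> FAr (SOb \<sigma> X) u \<in> Ar (PO G X)"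
    "u \<in> Ar (PO F X) \<Longrightarrow> Dom (PO G X) (FAr (SOb \<sigma> X) u) = FOb (SOb \<sigma> X) (Dom (PO F X) u)"
    "u \<in> Ar (PO F X) \<Longrightarrow> Cod (PO G X) (FAr (SOb \<sigma> X) u) = FOb (SOb \<sigma> X) (Cod (PO F X) u)"
    "x \<in> Ob (PO F X) \<Longrightarrow> FAr (SOb \<sigma> X) (Ide (PO F X) x) = Ide (PO G X) (FOb (SOb \<sigma> X) x)"
    "u \<in> Ar (PO F X) \<Longrightarrow> v \<in> Ar (PO F X) \<Longrightarrow> Cod (PO F X) u = Dom (PO F X) v \<Longrightarrow>
      FAr (SOb \<sigma> X) (v \<cdot>[PO F X] u) = FAr (SOb \<sigma> X) v \<cdot>[PO G X] FAr (SOb \<sigma> X) u"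
    "is_iso (PO F X) u \<Longrightarrow> is_iso (PO G X) (FAr (SOb \<sigma> X) u)"
  using functor_arr[OF SOb_functor[OF assms]] functor_iso[OF SOb_functor[OF assms]] assms
  by simp_all

lemma SAr_nat:
  assumes "X \<in> Obj K" "Y \<in> Obj K" "a \<in> Ob (Hom K X Y)"
  shows "is_iso (functor_cat (PO F X) (PO G Y)) (SAr \<sigma> X Y a)"
    "nat_trans (PO F X) (PO G Y) (SAr \<sigma> X Y a)"
    "NDom (SAr \<sigma> X Y a) = comp_ftr (PO F X) (FOb (PF G X Y) a) (SOb \<sigma> X)"
    "NCod (SAr \<sigma> X Y a) = comp_ftr (PO F X) (SOb \<sigma> Y) (FOb (PF F X Y) a)"
  using sar_iso[OF assms] by (simp_all add: iso_in_iff)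

lemma SAr_simps [simp]:
  assumes "X \<in> Obj K" "Y \<in> Obj K" "a \<in> Ob (Hom K X Y)" "x \<in> Ob (PO F X)"
  shows "NAt (SAr \<sigma> X Y a) x \<in> Ar (PO G Y)"
    "Dom (PO G Y) (NAt (SAr \<sigma> X Y a) x) = act G X Y a (FOb (SOb \<sigma> X) x)"
    "Cod (PO G Y) (NAt (SAr \<sigma> X Y a) x) = FOb (SOb \<sigma> Y) (act F X Y a x)"
    "is_iso (PO G Y) (NAt (SAr \<sigma> X Y a) x)"
  using nat_trans_arr(3-5)[OF SAr_nat(2)[OF assms(1-3)] assms(4)]
    is_iso_component[OF SAr_nat(1)[OF assms(1-3)] assms(4)]
    SAr_nat(3,4)[OF assms(1-3)] assms(4)
  by simp_all

lemma SAr_natural: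
  assumes "X \<in> Obj K" "Y \<in> Obj K" "a \<in> Ob (Hom K X Y)"
    "u \<in> Ar (PO F X)" "Dom (PO F X) u = x" "Cod (PO F X) u = y"
  shows "NAt (SAr \<sigma> X Y a) y \<cdot>[PO G Y] act_ar G X Y a (FAr (SOb \<sigma> X) u) =
    FAr (SOb \<sigma> Y) (act_ar F X Y a u) \<cdot>[PO G Y] NAt (SAr \<sigma> X Y a) x"
  using nat_trans_arr(6)[OF SAr_nat(2)[OF assms(1-3)] assms(4-6)] SAr_nat(3,4)[OF assms(1-3)] assms(4)
  by simp

lemma SAr_cell:
  assumes "X \<in> Obj K" "Y \<in> Obj K" "x \<in> Ob (PO F X)"
    "\<alpha> \<in> Ar (Hom K X Y)" "Dom (Hom K X Y) \<alpha> = a" "Cod (Hom K X Y) \<alpha> = b"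
  shows "NAt (SAr \<sigma> X Y b) x \<cdot>[PO G Y] act_cell G X Y \<alpha> (FOb (SOb \<sigma> X) x) =
    FAr (SOb \<sigma> Y) (act_cell F X Y \<alpha> x) \<cdot>[PO G Y] NAt (SAr \<sigma> X Y a) x"
proof -
  have "NAt (SAr \<sigma> X Y b \<cdot>[functor_cat (PO F X) (PO G Y)]
        rwh Cat (PO F X) (PO G X) (PO G Y) (FAr (PF G X Y) \<alpha>) (SOb \<sigma> X)) x
      = NAt (lwh Cat (PO F X) (PO F Y) (PO G Y) (SOb \<sigma> Y) (FAr (PF F X Y) \<alpha>)
        \<cdot>[functor_cat (PO F X) (PO G Y)] SAr \<sigma> X Y a) x"
    using sar_natural[of X Y \<alpha> a b] assms by (simp add: in_hom)
  then show ?thesis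
    using assms SOb_functor F.cell_nat(1)[OF assms(1,2,4)] G.cell_nat(1)[OF assms(1,2,4)]
    by (simp add: lwh_Cat_at[where B = "PO F Y"] rwh_Cat_at[where B = "PO G X"])
qed

lemma SAr_One: "X \<in> Obj K \<Longrightarrow> x \<in> Ob (PO F X) \<Longrightarrow>
    NAt (SAr \<sigma> X X (One K X)) x = Ide (PO G X) (FOb (SOb \<sigma> X) x)"
  by (simp add: sar_one)

lemma SAr_HC1:
  assumes "X \<in> Obj K" "Y \<in> Obj K" "Z \<in> Obj K" "x \<in> Ob (PO F X)"
    "a \<in> Ob (Hom K X Y)" "b \<in> Ob (Hom K Y Z)"
  shows "NAt (SAr \<sigma> X Z (HC1 K X Y Z b a)) x \<cdot>[PO G Z] cmp G X Y Z b a (FOb (SOb \<sigma> X) x) =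
    FAr (SOb \<sigma> Z) (cmp F X Y Z b a x) \<cdot>[PO G Z]
      (NAt (SAr \<sigma> Y Z b) (act F X Y a x) \<cdot>[PO G Z] act_ar G Y Z b (NAt (SAr \<sigma> X Y a) x))"
proof -
  have "NAt (SAr \<sigma> X Z (HC1 K X Y Z b a) \<cdot>[functor_cat (PO F X) (PO G Z)]
        rwh Cat (PO F X) (PO G X) (PO G Z) (PC G X Y Z b a) (SOb \<sigma> X)) x
      = NAt (lwh Cat (PO F X) (PO F Z) (PO G Z) (SOb \<sigma> Z) (PC F X Y Z b a) \<cdot>[functor_cat (PO F X) (PO G Z)]
        (rwh Cat (PO F X) (PO F Y) (PO G Z) (SAr \<sigma> Y Z b) (FOb (PF F X Y) a) \<cdot>[functor_cat (PO F X) (PO G Z)]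
         lwh Cat (PO F X) (PO G Y) (PO G Z) (FOb (PF G Y Z) b) (SAr \<sigma> X Y a))) x"
    using sar_comp[of X Y Z a b] assms by simp
  then show ?thesis
    using assms SOb_functor F.cmp_nat(2)[OF assms(1-3,5,6)] G.cmp_nat(2)[OF assms(1-3,5,6)]
      SAr_nat(2) F.act_functor G.act_functor
    by (simp add: lwh_Cat_at[where B = "PO F Z"] lwh_Cat_at[where B = "PO G Y"]
        rwh_Cat_at[where B = "PO G X"] rwh_Cat_at[where B = "PO F Y"])
qed

end

text \<open>The axioms of a pseudo-natural transformation are equations between natural transformations;
  this rule reduces them to equations between their components.\<close>

lemma cat_pntI:
  assumes FG: "cat_valued K F" "cat_valued K G"
    and ob: "\<And>X. X \<in> Obj K \<Longrightarrow> cat_functor (PO F X) (PO G X) (SOb \<sigma> X)"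
    and ar: "\<And>X Y a. X \<in> Obj K \<Longrightarrow> Y \<in> Obj K \<Longrightarrow> a \<in> Ob (Hom K X Y) \<Longrightarrow>
      nat_trans (PO F X) (PO G Y) (SAr \<sigma> X Y a) \<and>
      NDom (SAr \<sigma> X Y a) = comp_ftr (PO F X) (FOb (PF G X Y) a) (SOb \<sigma> X) \<and>
      NCod (SAr \<sigma> X Y a) = comp_ftr (PO F X) (SOb \<sigma> Y) (FOb (PF F X Y) a)"
    and iso: "\<And>X Y a x. X \<in> Obj K \<Longrightarrow> Y \<in> Obj K \<Longrightarrow> a \<in> Ob (Hom K X Y) \<Longrightarrow> x \<in> Ob (PO F X) \<Longrightarrow>
      is_iso (PO G Y) (NAt (SAr \<sigma> X Y a) x)"
    and cell: "\<And>X Y \<alpha> x. X \<in> Obj K \<Longrightarrow> Y \<in> Obj K \<Longrightarrow> \<alpha> \<in> Ar (Hom K X Y) \<Longrightarrow> x \<in> Ob (PO F X) \<Longrightarrow>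
      NAt (SAr \<sigma> X Y (Cod (Hom K X Y) \<alpha>)) x \<cdot>[PO G Y] act_cell G X Y \<alpha> (FOb (SOb \<sigma> X) x) =
      FAr (SOb \<sigma> Y) (act_cell F X Y \<alpha> x) \<cdot>[PO G Y] NAt (SAr \<sigma> X Y (Dom (Hom K X Y) \<alpha>)) x"
    and one: "\<And>X x. X \<in> Obj K \<Longrightarrow> x \<in> Ob (PO F X) \<Longrightarrow>
      NAt (SAr \<sigma> X X (One K X)) x = Ide (PO G X) (FOb (SOb \<sigma> X) x)"
    and comp: "\<And>X Y Z a b x. X \<in> Obj K \<Longrightarrow> Y \<in> Obj K \<Longrightarrow> Z \<in> Obj K \<Longrightarrow> x \<in> Ob (PO F X) \<Longrightarrow>
      a \<in> Ob (Hom K X Y) \<Longrightarrow> b \<in> Ob (Hom K Y Z) \<Longrightarrow>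
      NAt (SAr \<sigma> X Z (HC1 K X Y Z b a)) x \<cdot>[PO G Z] cmp G X Y Z b a (FOb (SOb \<sigma> X) x) =
      FAr (SOb \<sigma> Z) (cmp F X Y Z b a x) \<cdot>[PO G Z]
        (NAt (SAr \<sigma> Y Z b) (act F X Y a x) \<cdot>[PO G Z] act_ar G Y Z b (NAt (SAr \<sigma> X Y a) x))"
    and ext: "SOb \<sigma> \<in> extensional (Obj K)"
      "\<And>X Y a. \<not> (X \<in> Obj K \<and> Y \<in> Obj K \<and> a \<in> Ob (Hom K X Y)) \<Longrightarrow> SAr \<sigma> X Y a = undefined"
  shows "cat_pnt K F G \<sigma>"
proof -
  interpret F: cat_valued K F by fact
  interpret G: cat_valued K G by fact
  have ar_nat: "nat_trans (PO F X) (PO G Y) (SAr \<sigma> X Y a)" if "X \<in> Obj K" "Y \<in> Obj K" "a \<in> Ob (Hom K X Y)" for X Y a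
    using ar[OF that] by blast
  have dom [simp]: "NDom (SAr \<sigma> X Y a) = comp_ftr (PO F X) (FOb (PF G X Y) a) (SOb \<sigma> X)"
      "NCod (SAr \<sigma> X Y a) = comp_ftr (PO F X) (SOb \<sigma> Y) (FOb (PF F X Y) a)"
    if "X \<in> Obj K" "Y \<in> Obj K" "a \<in> Ob (Hom K X Y)" for X Y a
    using ar[OF that] by simp_all
  note assoc = comp_ftr_assoc[OF F.PO_category ob]  comp_ftr_assoc[OF F.PO_category F.act_functor]
  have "pseudo_natural K Cat F G \<sigma>"
  proof (rule pseudo_natural.intro)
    fix X assume [simp]: "X \<in> Obj K"
    show "SOb \<sigma> X \<in> Ob (Hom Cat (PO F X) (PO G X))" using ob by simp
    show "SAr \<sigma> X X (One K X) = Ide (Hom Cat (PO F X) (PO G X)) (SOb \<sigma> X)"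
      by (rule nat_trans_eqI[where A = "PO F X" and B = "PO G X"])
        (simp_all add: ar_nat one nat_trans_Ide ob F.pf_one G.pf_one comp_ftr_id[OF _ _ ob])
  next
    fix X Y a assume *: "X \<in> Obj K" "Y \<in> Obj K" "a \<in> Ob (Hom K X Y)"
    then show "iso_in (Hom Cat (PO F X) (PO G Y))
        (HC1 Cat (PO F X) (PO G X) (PO G Y) (FOb (PF G X Y) a) (SOb \<sigma> X))
        (HC1 Cat (PO F X) (PO F Y) (PO G Y) (SOb \<sigma> Y) (FOb (PF F X Y) a)) (SAr \<sigma> X Y a)"
      using is_iso_nat_transI[OF _ _ ar_nat[OF *] iso[OF *]] ar_nat by (simp add: iso_in_iff)
  next
    fix X Y \<alpha> a b assume *: "X \<in> Obj K" "Y \<in> Obj K" "\<alpha> \<in> hom (Hom K X Y) a b"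
    then have [simp]: "\<alpha> \<in> Ar (Hom K X Y)" "Dom (Hom K X Y) \<alpha> = a" "Cod (Hom K X Y) \<alpha> = b"
        "a \<in> Ob (Hom K X Y)" "b \<in> Ob (Hom K X Y)" "X \<in> Obj K" "Y \<in> Obj K"
      by (auto simp: in_hom)
    note nats = F.cell_nat[of X Y \<alpha>, simplified] G.cell_nat[of X Y \<alpha>, simplified]
    show "SAr \<sigma> X Y b \<cdot>[Hom Cat (PO F X) (PO G Y)]
          rwh Cat (PO F X) (PO G X) (PO G Y) (FAr (PF G X Y) \<alpha>) (SOb \<sigma> X)
        = lwh Cat (PO F X) (PO F Y) (PO G Y) (SOb \<sigma> Y) (FAr (PF F X Y) \<alpha>)
          \<cdot>[Hom Cat (PO F X) (PO G Y)] SAr \<sigma> X Y a"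
      unfolding Cat_simps
      by (rule nat_trans_eqI[where A = "PO F X" and B = "PO G Y"])
        (use cell[of X Y \<alpha>] in \<open>simp_all add: nats ob ar_nat nat_trans_Comp nat_trans_rwh[where B = "PO G X"]
          nat_trans_lwh[where B = "PO F Y"] lwh_Cat_at[where B = "PO F Y"] rwh_Cat_at[where B = "PO G X"]\<close>)
  next
    fix X Y Z a b assume [simp]: "X \<in> Obj K" "Y \<in> Obj K" "Z \<in> Obj K" "a \<in> Ob (Hom K X Y)" "b \<in> Ob (Hom K Y Z)"
    show "SAr \<sigma> X Z (HC1 K X Y Z b a) \<cdot>[Hom Cat (PO F X) (PO G Z)]
          rwh Cat (PO F X) (PO G X) (PO G Z) (PC G X Y Z b a) (SOb \<sigma> X)
        = lwh Cat (PO F X) (PO F Z) (PO G Z) (SOb \<sigma> Z) (PC F X Y Z b a) \<cdot>[Hom Cat (PO F X) (PO G Z)]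
            (rwh Cat (PO F X) (PO F Y) (PO G Z) (SAr \<sigma> Y Z b) (FOb (PF F X Y) a) \<cdot>[Hom Cat (PO F X) (PO G Z)]
              lwh Cat (PO F X) (PO G Y) (PO G Z) (FOb (PF G Y Z) b) (SAr \<sigma> X Y a))"
      unfolding Cat_simps
      by (rule nat_trans_eqI[where A = "PO F X" and B = "PO G Z"])
        (use comp[of X Y Z _ a b] in \<open>simp_all add: F.cmp_nat G.cmp_nat ob ar_nat nat_trans_Comp
          F.act_functor G.act_functor assoc
          nat_trans_rwh[where B = "PO G X"] nat_trans_rwh[where B = "PO F Y"]
          nat_trans_lwh[where B = "PO F Z"] nat_trans_lwh[where B = "PO G Y"]
          lwh_Cat_at[where B = "PO F Z"] lwh_Cat_at[where B = "PO G Y"]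
          rwh_Cat_at[where B = "PO G X"] rwh_Cat_at[where B = "PO F Y"]\<close>)
  qed (use ext in auto)
  then show ?thesis
    by (intro cat_pnt.intro FG)
qed

lemma pseudo_natural_eqI:
  assumes "pseudo_natural K B F G \<sigma>" "pseudo_natural K B F G \<tau>"
    and "\<And>X. X \<in> Obj K \<Longrightarrow> SOb \<sigma> X = SOb \<tau> X"
    and "\<And>X Y a. X \<in> Obj K \<Longrightarrow> Y \<in> Obj K \<Longrightarrow> a \<in> Ob (Hom K X Y) \<Longrightarrow> SAr \<sigma> X Y a = SAr \<tau> X Y a"
  shows "\<sigma> = \<tau>"
proof -
  have "SOb \<sigma> = SOb \<tau>"
    by (rule extensionalityI[OF pseudo_natural.sob_ext[OF assms(1)] pseudo_natural.sob_ext[OF assms(2)] assms(3)])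
  moreover have "SAr \<sigma> X Y a = SAr \<tau> X Y a" for X Y a
    by (cases "X \<in> Obj K \<and> Y \<in> Obj K \<and> a \<in> Ob (Hom K X Y)")
      (simp_all add: assms(4) pseudo_natural.sar_ext[OF assms(1)] pseudo_natural.sar_ext[OF assms(2)])
  ultimately show ?thesis by (simp add: fun_eq_iff)
qed

lemma id_pnt_simps [simp]:
  "X \<in> Obj K \<Longrightarrow> SOb (id_pnt K Cat F) X = id_ftr (PO F X)"
  "X \<in> Obj K \<Longrightarrow> Y \<in> Obj K \<Longrightarrow> a \<in> Ob (Hom K X Y) \<Longrightarrow>
    SAr (id_pnt K Cat F) X Y a = Ide (functor_cat (PO F X) (PO F Y)) (FOb (PF F X Y) a)"
  by (simp_all add: id_pnt_def)

lemma comp_pnt_simps [simp]: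
  "X \<in> Obj K \<Longrightarrow> SOb (comp_pnt K Cat F G H \<tau> \<sigma>) X = comp_ftr (PO F X) (SOb \<tau> X) (SOb \<sigma> X)"
  "X \<in> Obj K \<Longrightarrow> Y \<in> Obj K \<Longrightarrow> a \<in> Ob (Hom K X Y) \<Longrightarrow> SAr (comp_pnt K Cat F G H \<tau> \<sigma>) X Y a =
    lwh Cat (PO F X) (PO G Y) (PO H Y) (SOb \<tau> Y) (SAr \<sigma> X Y a) \<cdot>[functor_cat (PO F X) (PO H Y)]
    rwh Cat (PO F X) (PO G X) (PO H Y) (SAr \<tau> X Y a) (SOb \<sigma> X)"
  by (simp_all add: comp_pnt_def)

lemma cat_pnt_id:
  assumes "cat_valued K F"
  shows "cat_pnt K F F (id_pnt K Cat F)"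
proof -
  interpret F: cat_valued K F by fact
  show ?thesis
  proof (rule cat_pntI[OF assms assms])
    fix X Y a assume *: "X \<in> Obj K" "Y \<in> Obj K" "a \<in> Ob (Hom K X Y)"
    then show "nat_trans (PO F X) (PO F Y) (SAr (id_pnt K Cat F) X Y a) \<and>
       NDom (SAr (id_pnt K Cat F) X Y a) = comp_ftr (PO F X) (FOb (PF F X Y) a) (SOb (id_pnt K Cat F) X) \<and>
       NCod (SAr (id_pnt K Cat F) X Y a) = comp_ftr (PO F X) (SOb (id_pnt K Cat F) Y) (FOb (PF F X Y) a)"
      by (simp add: nat_trans_Ide F.act_functor comp_ftr_id[OF _ _ F.act_functor[OF *]])
  qed (auto simp: F.pf_one, simp_all add: id_pnt_def)
qed

text \<open>The composite pastes the 2-morphism components of \<open>\<sigma>\<close> and \<open>\<tau>\<close>; each axiom follows from that of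
  \<open>\<tau>\<close>, that of \<open>\<sigma>\<close> under the functor \<open>\<tau> Z\<close>, and naturality of the components of \<open>\<tau>\<close>.\<close>

lemma cat_pnt_comp:
  assumes "cat_pnt K F G \<sigma>" "cat_pnt K G H \<tau>"
  shows "cat_pnt K F H (comp_pnt K Cat F G H \<tau> \<sigma>)"
    "X \<in> Obj K \<Longrightarrow> Y \<in> Obj K \<Longrightarrow> a \<in> Ob (Hom K X Y) \<Longrightarrow> x \<in> Ob (PO F X) \<Longrightarrow>
      NAt (SAr (comp_pnt K Cat F G H \<tau> \<sigma>) X Y a) x =
      FAr (SOb \<tau> Y) (NAt (SAr \<sigma> X Y a) x) \<cdot>[PO H Y] NAt (SAr \<tau> X Y a) (FOb (SOb \<sigma> X) x)"
proof -
  interpret \<sigma>: cat_pnt K F G \<sigma> by fact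
  interpret \<tau>: cat_pnt K G H \<tau> by fact
  let ?c = "comp_pnt K Cat F G H \<tau> \<sigma>"
  have at: "NAt (SAr ?c X Y a) x = FAr (SOb \<tau> Y) (NAt (SAr \<sigma> X Y a) x) \<cdot>[PO H Y] NAt (SAr \<tau> X Y a) (FOb (SOb \<sigma> X) x)"
    if "X \<in> Obj K" "Y \<in> Obj K" "a \<in> Ob (Hom K X Y)" "x \<in> Ob (PO F X)" for X Y a x
    using that \<sigma>.SOb_functor \<tau>.SOb_functor \<sigma>.SAr_nat(2) \<tau>.SAr_nat(2)
    by (simp add: lwh_Cat_at[where B = "PO G Y"] rwh_Cat_at[where B = "PO G X"])
  then show "X \<in> Obj K \<Longrightarrow> Y \<in> Obj K \<Longrightarrow> a \<in> Ob (Hom K X Y) \<Longrightarrow> x \<in> Ob (PO F X) \<Longrightarrow>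
      NAt (SAr ?c X Y a) x = FAr (SOb \<tau> Y) (NAt (SAr \<sigma> X Y a) x) \<cdot>[PO H Y] NAt (SAr \<tau> X Y a) (FOb (SOb \<sigma> X) x)" .
  show "cat_pnt K F H ?c"
  proof (rule cat_pntI[OF \<sigma>.F.cat_valued_axioms \<tau>.G.cat_valued_axioms])
    fix X assume "X \<in> Obj K"
    then show "cat_functor (PO F X) (PO H X) (SOb ?c X)"
      using comp_functor[OF _ \<sigma>.SOb_functor \<tau>.SOb_functor] by simp
  next
    fix X Y a assume *: "X \<in> Obj K" "Y \<in> Obj K" "a \<in> Ob (Hom K X Y)"
    then show "nat_trans (PO F X) (PO H Y) (SAr ?c X Y a) \<and>
       NDom (SAr ?c X Y a) = comp_ftr (PO F X) (FOb (PF H X Y) a) (SOb ?c X) \<and>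
       NCod (SAr ?c X Y a) = comp_ftr (PO F X) (SOb ?c Y) (FOb (PF F X Y) a)"
      using \<sigma>.SOb_functor \<tau>.SOb_functor \<sigma>.SAr_nat(2-4)[OF *] \<tau>.SAr_nat(2-4)[OF *]
      by (simp add: comp_ftr_assoc[OF _ \<sigma>.SOb_functor] comp_ftr_assoc[OF _ \<sigma>.F.act_functor] nat_trans_Comp
          nat_trans_lwh[where B = "PO G Y"] nat_trans_rwh[where B = "PO G X"])
  next
    fix X Y a x assume *: "X \<in> Obj K" "Y \<in> Obj K" "a \<in> Ob (Hom K X Y)" "x \<in> Ob (PO F X)"
    then show "is_iso (PO H Y) (NAt (SAr ?c X Y a) x)" by (simp add: at[OF *] del: comp_pnt_simps(2))
  next
    fix X Y \<alpha> x assume [simp]: "X \<in> Obj K" "Y \<in> Obj K" "\<alpha> \<in> Ar (Hom K X Y)" "x \<in> Ob (PO F X)"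
    have 1: "NAt (SAr \<tau> X Y (Cod (Hom K X Y) \<alpha>)) (FOb (SOb \<sigma> X) x) \<cdot>[PO H Y] act_cell H X Y \<alpha> (FOb (SOb \<tau> X) (FOb (SOb \<sigma> X) x))
      = FAr (SOb \<tau> Y) (act_cell G X Y \<alpha> (FOb (SOb \<sigma> X) x)) \<cdot>[PO H Y] NAt (SAr \<tau> X Y (Dom (Hom K X Y) \<alpha>)) (FOb (SOb \<sigma> X) x)"
      using \<tau>.SAr_cell[of X Y "FOb (SOb \<sigma> X) x" \<alpha>] by simp
    have 2: "FAr (SOb \<tau> Y) (NAt (SAr \<sigma> X Y (Cod (Hom K X Y) \<alpha>)) x) \<cdot>[PO H Y] FAr (SOb \<tau> Y) (act_cell G X Y \<alpha> (FOb (SOb \<sigma> X) x))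
      = FAr (SOb \<tau> Y) (FAr (SOb \<sigma> Y) (act_cell F X Y \<alpha> x)) \<cdot>[PO H Y] FAr (SOb \<tau> Y) (NAt (SAr \<sigma> X Y (Dom (Hom K X Y) \<alpha>)) x)"
      using arg_cong[OF \<sigma>.SAr_cell[OF _ _ _ _ refl refl, of X Y x \<alpha>], where f = "FAr (SOb \<tau> Y)"] by simp
    show "NAt (SAr ?c X Y (Cod (Hom K X Y) \<alpha>)) x \<cdot>[PO H Y] act_cell H X Y \<alpha> (FOb (SOb ?c X) x) =
       FAr (SOb ?c Y) (act_cell F X Y \<alpha> x) \<cdot>[PO H Y] NAt (SAr ?c X Y (Dom (Hom K X Y) \<alpha>)) x"
      by (simp add: at 1 comp_extend[OF 2] del: comp_pnt_simps(2))
  next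
    fix X x assume [simp]: "X \<in> Obj K" "x \<in> Ob (PO F X)"
    show "NAt (SAr ?c X X (One K X)) x = Ide (PO H X) (FOb (SOb ?c X) x)"
      by (simp add: at \<sigma>.SAr_One \<tau>.SAr_One del: comp_pnt_simps(2))
  next
    fix X Y Z a b x assume [simp]: "X \<in> Obj K" "Y \<in> Obj K" "Z \<in> Obj K" "x \<in> Ob (PO F X)"
       "a \<in> Ob (Hom K X Y)" "b \<in> Ob (Hom K Y Z)"
    let ?x = "FOb (SOb \<sigma> X) x" and ?T = "FAr (SOb \<tau> Z)"
    have 1: "NAt (SAr \<tau> X Z (HC1 K X Y Z b a)) ?x \<cdot>[PO H Z] cmp H X Y Z b a (FOb (SOb \<tau> X) ?x) =
        ?T (cmp G X Y Z b a ?x) \<cdot>[PO H Z] (NAt (SAr \<tau> Y Z b) (act G X Y a ?x) \<cdot>[PO H Z] act_ar H Y Z b (NAt (SAr \<tau> X Y a) ?x))"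
      using \<tau>.SAr_HC1[of X Y Z ?x a b] by simp
    have 2: "?T (NAt (SAr \<sigma> X Z (HC1 K X Y Z b a)) x) \<cdot>[PO H Z] ?T (cmp G X Y Z b a ?x) =
        ?T (FAr (SOb \<sigma> Z) (cmp F X Y Z b a x)) \<cdot>[PO H Z]
          (?T (NAt (SAr \<sigma> Y Z b) (act F X Y a x)) \<cdot>[PO H Z] ?T (act_ar G Y Z b (NAt (SAr \<sigma> X Y a) x)))"
      using arg_cong[OF \<sigma>.SAr_HC1[of X Y Z x a b], where f = ?T] by simp
    have 3: "NAt (SAr \<tau> Y Z b) (FOb (SOb \<sigma> Y) (act F X Y a x)) \<cdot>[PO H Z] act_ar H Y Z b (FAr (SOb \<tau> Y) (NAt (SAr \<sigma> X Y a) x))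
        = ?T (act_ar G Y Z b (NAt (SAr \<sigma> X Y a) x)) \<cdot>[PO H Z] NAt (SAr \<tau> Y Z b) (act G X Y a ?x)"
      using \<tau>.SAr_natural[of Y Z b "NAt (SAr \<sigma> X Y a) x"] by simp
    show "NAt (SAr ?c X Z (HC1 K X Y Z b a)) x \<cdot>[PO H Z] cmp H X Y Z b a (FOb (SOb ?c X) x) =
       FAr (SOb ?c Z) (cmp F X Y Z b a x) \<cdot>[PO H Z]
        (NAt (SAr ?c Y Z b) (act F X Y a x) \<cdot>[PO H Z] act_ar H Y Z b (NAt (SAr ?c X Y a) x))"
      by (simp add: at 1 comp_extend[OF 2] comp_extend[OF 3] del: comp_pnt_simps(2))
  qed (auto simp: comp_pnt_def)
qed

lemma comp_pnt_id:
  assumes "cat_pnt K F G \<sigma>"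
  shows "comp_pnt K Cat F F G \<sigma> (id_pnt K Cat F) = \<sigma>" "comp_pnt K Cat F G G (id_pnt K Cat G) \<sigma> = \<sigma>"
proof -
  interpret \<sigma>: cat_pnt K F G \<sigma> by fact
  note id = cat_pnt_id[OF \<sigma>.F.cat_valued_axioms] cat_pnt_id[OF \<sigma>.G.cat_valued_axioms]
  have pn: "pseudo_natural K Cat F G (comp_pnt K Cat F F G \<sigma> (id_pnt K Cat F))"
      "pseudo_natural K Cat F G (comp_pnt K Cat F G G (id_pnt K Cat G) \<sigma>)"
    using cat_pnt_comp(1)[OF id(1) assms] cat_pnt_comp(1)[OF assms id(2)] by (auto simp: cat_pnt_def)
  interpret l: cat_pnt K F G "comp_pnt K Cat F F G \<sigma> (id_pnt K Cat F)" by (rule cat_pnt_comp(1)[OF id(1) assms])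
  interpret r: cat_pnt K F G "comp_pnt K Cat F G G (id_pnt K Cat G) \<sigma>" by (rule cat_pnt_comp(1)[OF assms id(2)])
  show "comp_pnt K Cat F F G \<sigma> (id_pnt K Cat F) = \<sigma>"
  proof (rule pseudo_natural_eqI[OF pn(1) \<sigma>.pseudo_natural_axioms])
    fix X Y a assume *: "X \<in> Obj K" "Y \<in> Obj K" "a \<in> Ob (Hom K X Y)"
    show "SAr (comp_pnt K Cat F F G \<sigma> (id_pnt K Cat F)) X Y a = SAr \<sigma> X Y a"
      by (rule nat_trans_eqI[OF l.SAr_nat(2)[OF *] \<sigma>.SAr_nat(2)[OF *]])
        (use * in \<open>simp_all add: l.SAr_nat(3,4)[OF *] \<sigma>.SAr_nat(3,4)[OF *] cat_pnt_comp(2)[OF id(1) assms]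
          comp_ftr_id[OF _ _ \<sigma>.SOb_functor] del: comp_pnt_simps(2)\<close>)
  qed (simp add: comp_ftr_id[OF _ _ \<sigma>.SOb_functor])
  show "comp_pnt K Cat F G G (id_pnt K Cat G) \<sigma> = \<sigma>"
  proof (rule pseudo_natural_eqI[OF pn(2) \<sigma>.pseudo_natural_axioms])
    fix X Y a assume *: "X \<in> Obj K" "Y \<in> Obj K" "a \<in> Ob (Hom K X Y)"
    show "SAr (comp_pnt K Cat F G G (id_pnt K Cat G) \<sigma>) X Y a = SAr \<sigma> X Y a"
      by (rule nat_trans_eqI[OF r.SAr_nat(2)[OF *] \<sigma>.SAr_nat(2)[OF *]])
        (use * in \<open>simp_all add: r.SAr_nat(3,4)[OF *] \<sigma>.SAr_nat(3,4)[OF *] cat_pnt_comp(2)[OF assms id(2)]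
          comp_ftr_id[OF _ _ \<sigma>.SOb_functor] del: comp_pnt_simps(2)\<close>)
  qed (simp add: comp_ftr_id[OF _ _ \<sigma>.SOb_functor])
qed

lemma Ps_simps [simp]:
  "F \<in> Obj (Ps A B) \<longleftrightarrow> normal_pseudo_functor A B F" "Hom (Ps A B) = pnt_cat A B"
  "One (Ps A B) = id_pnt A B" "HC1 (Ps A B) = comp_pnt A B" "HC2 (Ps A B) = hcomp_mdf A B"
  by (simp_all add: Ps_def)

lemma pnt_cat_simps [simp]:
  "\<sigma> \<in> Ob (pnt_cat A B F G) \<longleftrightarrow> pseudo_natural A B F G \<sigma>"
  "\<Gamma> \<in> Ar (pnt_cat A B F G) \<longleftrightarrow> modification A B F G \<Gamma>"
  "Dom (pnt_cat A B F G) = MDom" "Cod (pnt_cat A B F G) = MCod"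
  "MDom (Ide (pnt_cat A B F G) \<sigma>) = \<sigma>" "MCod (Ide (pnt_cat A B F G) \<sigma>) = \<sigma>"
  "X \<in> Obj A \<Longrightarrow> MAt (Ide (pnt_cat A B F G) \<sigma>) X = Ide (Hom B (PO F X) (PO G X)) (SOb \<sigma> X)"
  "MDom (\<Delta> \<cdot>[pnt_cat A B F G] \<Gamma>) = MDom \<Gamma>" "MCod (\<Delta> \<cdot>[pnt_cat A B F G] \<Gamma>) = MCod \<Delta>"
  "X \<in> Obj A \<Longrightarrow> MAt (\<Delta> \<cdot>[pnt_cat A B F G] \<Gamma>) X = MAt \<Delta> X \<cdot>[Hom B (PO F X) (PO G X)] MAt \<Gamma> X"
  "MAt (Ide (pnt_cat A B F G) \<sigma>) \<in> extensional (Obj A)"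
  "MAt (\<Delta> \<cdot>[pnt_cat A B F G] \<Gamma>) \<in> extensional (Obj A)"
  by (simp_all add: pnt_cat_def)

lemma hcomp_mdf_simps [simp]:
  "MDom (hcomp_mdf A B F G H \<Delta> \<Gamma>) = comp_pnt A B F G H (MDom \<Delta>) (MDom \<Gamma>)"
  "MCod (hcomp_mdf A B F G H \<Delta> \<Gamma>) = comp_pnt A B F G H (MCod \<Delta>) (MCod \<Gamma>)"
  "X \<in> Obj A \<Longrightarrow> MAt (hcomp_mdf A B F G H \<Delta> \<Gamma>) X = HC2 B (PO F X) (PO G X) (PO H X) (MAt \<Delta> X) (MAt \<Gamma> X)"
  by (simp_all add: hcomp_mdf_def)

lemma mdf_eqI:
  fixes \<Gamma> \<Delta> :: "('o, 'm, 'n, 's) mdf"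
  assumes "MDom \<Gamma> = MDom \<Delta>" "MCod \<Gamma> = MCod \<Delta>" "MAt \<Gamma> \<in> extensional S" "MAt \<Delta> \<in> extensional S"
    "\<And>X. X \<in> S \<Longrightarrow> MAt \<Gamma> X = MAt \<Delta> X"
  shows "\<Gamma> = \<Delta>"
  using extensionalityI[OF assms(3-5)] assms(1,2) by simp

lemma modificationI:
  assumes \<sigma>: "cat_pnt K F G (MDom \<Gamma>)" and \<tau>: "cat_pnt K F G (MCod \<Gamma>)"
    and at: "\<And>X. X \<in> Obj K \<Longrightarrow> nat_trans (PO F X) (PO G X) (MAt \<Gamma> X) \<and>
      NDom (MAt \<Gamma> X) = SOb (MDom \<Gamma>) X \<and> NCod (MAt \<Gamma> X) = SOb (MCod \<Gamma>) X"
    and nat: "\<And>X Y a x. X \<in> Obj K \<Longrightarrow> Y \<in> Obj K \<Longrightarrow> a \<in> Ob (Hom K X Y) \<Longrightarrow> x \<in> Ob (PO F X) \<Longrightarrow>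
      NAt (SAr (MCod \<Gamma>) X Y a) x \<cdot>[PO G Y] act_ar G X Y a (NAt (MAt \<Gamma> X) x) =
      NAt (MAt \<Gamma> Y) (act F X Y a x) \<cdot>[PO G Y] NAt (SAr (MDom \<Gamma>) X Y a) x"
    and ext: "MAt \<Gamma> \<in> extensional (Obj K)"
  shows "modification K Cat F G \<Gamma>"
proof (rule modification.intro)
  interpret \<sigma>: cat_pnt K F G "MDom \<Gamma>" by fact
  interpret \<tau>: cat_pnt K F G "MCod \<Gamma>" by fact
  show "pseudo_natural K Cat F G (MDom \<Gamma>)" "pseudo_natural K Cat F G (MCod \<Gamma>)"
    by (rule \<sigma>.pseudo_natural_axioms \<tau>.pseudo_natural_axioms)+
  show "MAt \<Gamma> X \<in> hom (Hom Cat (PO F X) (PO G X)) (SOb (MDom \<Gamma>) X) (SOb (MCod \<Gamma>) X)" if "X \<in> Obj K" for X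
    using at[OF that] by (simp add: in_hom)
  show "MAt \<Gamma> \<in> extensional (Obj K)" by (rule ext)
  fix X Y a assume *: "X \<in> Obj K" "Y \<in> Obj K" "a \<in> Ob (Hom K X Y)"
  note [simp] = * at[OF *(1)] at[OF *(2)]
  show "SAr (MCod \<Gamma>) X Y a \<cdot>[Hom Cat (PO F X) (PO G Y)]
        lwh Cat (PO F X) (PO G X) (PO G Y) (FOb (PF G X Y) a) (MAt \<Gamma> X)
      = rwh Cat (PO F X) (PO F Y) (PO G Y) (MAt \<Gamma> Y) (FOb (PF F X Y) a)
        \<cdot>[Hom Cat (PO F X) (PO G Y)] SAr (MDom \<Gamma>) X Y a"
    unfolding Cat_simps
    by (rule nat_trans_eqI[where A = "PO F X" and B = "PO G Y"])
      (use nat[OF *] in \<open>simp_all add: \<sigma>.SAr_nat[OF *] \<tau>.SAr_nat[OF *] nat_trans_Comp \<sigma>.F.act_functor \<sigma>.G.act_functor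
        nat_trans_lwh[where B = "PO G X"] nat_trans_rwh[where B = "PO F Y"]
        lwh_Cat_at[where B = "PO G X"] rwh_Cat_at[where B = "PO F Y"]\<close>)
qed

lemma modification_at:
  assumes "modification K Cat F G \<Gamma>" "X \<in> Obj K"
  shows "nat_trans (PO F X) (PO G X) (MAt \<Gamma> X)" "NDom (MAt \<Gamma> X) = SOb (MDom \<Gamma>) X"
    "NCod (MAt \<Gamma> X) = SOb (MCod \<Gamma>) X"
  using modification.mat_closed[OF assms] by (simp_all add: in_hom)

lemma modification_natural:
  assumes "modification K Cat F G \<Gamma>" "cat_pnt K F G (MDom \<Gamma>)" "cat_pnt K F G (MCod \<Gamma>)"
    and *: "X \<in> Obj K" "Y \<in> Obj K" "a \<in> Ob (Hom K X Y)" and x: "x \<in> Ob (PO F X)"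
  shows "NAt (SAr (MCod \<Gamma>) X Y a) x \<cdot>[PO G Y] act_ar G X Y a (NAt (MAt \<Gamma> X) x) =
    NAt (MAt \<Gamma> Y) (act F X Y a x) \<cdot>[PO G Y] NAt (SAr (MDom \<Gamma>) X Y a) x"
proof -
  interpret \<sigma>: cat_pnt K F G "MDom \<Gamma>" by fact
  have "NAt (SAr (MCod \<Gamma>) X Y a \<cdot>[functor_cat (PO F X) (PO G Y)]
        lwh Cat (PO F X) (PO G X) (PO G Y) (FOb (PF G X Y) a) (MAt \<Gamma> X)) x
      = NAt (rwh Cat (PO F X) (PO F Y) (PO G Y) (MAt \<Gamma> Y) (FOb (PF F X Y) a)
        \<cdot>[functor_cat (PO F X) (PO G Y)] SAr (MDom \<Gamma>) X Y a) x"
    using modification.mat_natural[OF assms(1) *] by simp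
  then show ?thesis
    using * x modification_at[OF assms(1)] \<sigma>.F.act_functor \<sigma>.G.act_functor
    by (simp add: lwh_Cat_at[where B = "PO G X"] rwh_Cat_at[where B = "PO F Y"])
qed

text \<open>As for natural transformations, the modification axiom for the inverses of the components is the
  axiom for \<open>\<Gamma>\<close>, solved for the other pair of sides.\<close>

lemma is_iso_modification:
  assumes \<Gamma>: "modification K Cat F G \<Gamma>" and \<sigma>: "cat_pnt K F G (MDom \<Gamma>)" and \<tau>: "cat_pnt K F G (MCod \<Gamma>)"
    and iso: "\<And>X x. X \<in> Obj K \<Longrightarrow> x \<in> Ob (PO F X) \<Longrightarrow> is_iso (PO G X) (NAt (MAt \<Gamma> X) x)"
  shows "is_iso (pnt_cat K Cat F G) \<Gamma>"
proof -
  interpret \<sigma>: cat_pnt K F G "MDom \<Gamma>" by fact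
  interpret \<tau>: cat_pnt K F G "MCod \<Gamma>" by fact
  have iso_at: "is_iso (functor_cat (PO F X) (PO G X)) (MAt \<Gamma> X)" if X: "X \<in> Obj K" for X
    by (rule is_iso_nat_transI) (use X iso modification_at[OF \<Gamma> X] in auto)
  define \<Delta> where "\<Delta> = \<lparr>MDom = MCod \<Gamma>, MCod = MDom \<Gamma>,
    MAt = (\<lambda>X\<in>Obj K. inv_in (functor_cat (PO F X) (PO G X)) (MAt \<Gamma> X))\<rparr>"
  have \<Delta>_dom [simp]: "MDom \<Delta> = MCod \<Gamma>" "MCod \<Delta> = MDom \<Gamma>" by (simp_all add: \<Delta>_def)
  have \<Delta>_at [simp]: "MAt \<Delta> X = inv_in (functor_cat (PO F X) (PO G X)) (MAt \<Gamma> X)" if "X \<in> Obj K" for X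
    using that by (simp add: \<Delta>_def)
  have inv_at: "NAt (MAt \<Delta> X) x \<in> Ar (PO G X)" "Dom (PO G X) (NAt (MAt \<Delta> X) x) = Cod (PO G X) (NAt (MAt \<Gamma> X) x)"
     "Cod (PO G X) (NAt (MAt \<Delta> X) x) = Dom (PO G X) (NAt (MAt \<Gamma> X) x)"
     "NAt (MAt \<Delta> X) x \<cdot>[PO G X] NAt (MAt \<Gamma> X) x = Ide (PO G X) (FOb (SOb (MDom \<Gamma>) X) x)"
     "NAt (MAt \<Gamma> X) x \<cdot>[PO G X] NAt (MAt \<Delta> X) x = Ide (PO G X) (FOb (SOb (MCod \<Gamma>) X) x)"
     "NAt (MAt \<Gamma> X) x \<in> Ar (PO G X)" "Dom (PO G X) (NAt (MAt \<Gamma> X) x) = FOb (SOb (MDom \<Gamma>) X) x"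
     "Cod (PO G X) (NAt (MAt \<Gamma> X) x) = FOb (SOb (MCod \<Gamma>) X) x"
    if X: "X \<in> Obj K" and x: "x \<in> Ob (PO F X)" for X x
  proof -
    note inv_in_arr[OF iso_at[OF X]]
    then have \<delta>: "nat_trans (PO F X) (PO G X) (MAt \<Delta> X)" "NDom (MAt \<Delta> X) = SOb (MCod \<Gamma>) X" "NCod (MAt \<Delta> X) = SOb (MDom \<Gamma>) X"
      using X modification_at[OF \<Gamma> X] by simp_all
    show 1: "NAt (MAt \<Gamma> X) x \<in> Ar (PO G X)" "Dom (PO G X) (NAt (MAt \<Gamma> X) x) = FOb (SOb (MDom \<Gamma>) X) x"
     "Cod (PO G X) (NAt (MAt \<Gamma> X) x) = FOb (SOb (MCod \<Gamma>) X) x"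
      using nat_trans_arr(3-5)[OF modification_at(1)[OF \<Gamma> X] x] modification_at[OF \<Gamma> X] by simp_all
    show "NAt (MAt \<Delta> X) x \<in> Ar (PO G X)" "Dom (PO G X) (NAt (MAt \<Delta> X) x) = Cod (PO G X) (NAt (MAt \<Gamma> X) x)"
     "Cod (PO G X) (NAt (MAt \<Delta> X) x) = Dom (PO G X) (NAt (MAt \<Gamma> X) x)"
      using nat_trans_arr(3-5)[OF \<delta>(1) x] by (simp_all add: \<delta>(2,3) 1 del: \<Delta>_at)
    show "NAt (MAt \<Delta> X) x \<cdot>[PO G X] NAt (MAt \<Gamma> X) x = Ide (PO G X) (FOb (SOb (MDom \<Gamma>) X) x)"
      using arg_cong[OF inv_in_left[OF iso_at[OF X]], of "\<lambda>\<alpha>. NAt \<alpha> x"] X x modification_at[OF \<Gamma> X] by simp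
    show "NAt (MAt \<Gamma> X) x \<cdot>[PO G X] NAt (MAt \<Delta> X) x = Ide (PO G X) (FOb (SOb (MCod \<Gamma>) X) x)"
      using arg_cong[OF inv_in_right[OF iso_at[OF X]], of "\<lambda>\<alpha>. NAt \<alpha> x"] X x modification_at[OF \<Gamma> X] by simp
  qed
  have "modification K Cat F G \<Delta>"
  proof (rule modificationI)
    fix X assume X: "X \<in> Obj K"
    show "nat_trans (PO F X) (PO G X) (MAt \<Delta> X) \<and> NDom (MAt \<Delta> X) = SOb (MDom \<Delta>) X \<and> NCod (MAt \<Delta> X) = SOb (MCod \<Delta>) X"
      using X inv_in_arr[OF iso_at[OF X]] modification_at[OF \<Gamma> X] by simp
  next
    fix X Y a x assume * [simp]: "X \<in> Obj K" "Y \<in> Obj K" "a \<in> Ob (Hom K X Y)" "x \<in> Ob (PO F X)"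
    note [simp del] = \<Delta>_at
    note [simp] = inv_at(1-3,6-8)
    have "NAt (MAt \<Gamma> Y) (act F X Y a x) \<cdot>[PO G Y]
         ((NAt (SAr (MDom \<Gamma>) X Y a) x \<cdot>[PO G Y] act_ar G X Y a (NAt (MAt \<Delta> X) x)) \<cdot>[PO G Y] act_ar G X Y a (NAt (MAt \<Gamma> X) x))
       = NAt (SAr (MCod \<Gamma>) X Y a) x \<cdot>[PO G Y] act_ar G X Y a (NAt (MAt \<Gamma> X) x)"
      using arg_cong[OF inv_at(4)[of X x], of "act_ar G X Y a"] modification_natural[OF \<Gamma> \<sigma> \<tau> *] by simp
    also have "\<dots> = NAt (MAt \<Gamma> Y) (act F X Y a x) \<cdot>[PO G Y]
         ((NAt (MAt \<Delta> Y) (act F X Y a x) \<cdot>[PO G Y] NAt (SAr (MCod \<Gamma>) X Y a) x) \<cdot>[PO G Y] act_ar G X Y a (NAt (MAt \<Gamma> X) x))"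
      using inv_at(5)[of Y "act F X Y a x"] by (simp add: comp_extend[OF inv_at(5)[of Y "act F X Y a x"]])
    finally have "(NAt (SAr (MDom \<Gamma>) X Y a) x \<cdot>[PO G Y] act_ar G X Y a (NAt (MAt \<Delta> X) x)) \<cdot>[PO G Y] act_ar G X Y a (NAt (MAt \<Gamma> X) x)
       = (NAt (MAt \<Delta> Y) (act F X Y a x) \<cdot>[PO G Y] NAt (SAr (MCod \<Gamma>) X Y a) x) \<cdot>[PO G Y] act_ar G X Y a (NAt (MAt \<Gamma> X) x)"
      by (rule iso_cancel_left) (auto simp: iso)
    then have "NAt (SAr (MDom \<Gamma>) X Y a) x \<cdot>[PO G Y] act_ar G X Y a (NAt (MAt \<Delta> X) x)
       = NAt (MAt \<Delta> Y) (act F X Y a x) \<cdot>[PO G Y] NAt (SAr (MCod \<Gamma>) X Y a) x"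
      by (rule iso_cancel_right) (auto simp: iso)
    then show "NAt (SAr (MCod \<Delta>) X Y a) x \<cdot>[PO G Y] act_ar G X Y a (NAt (MAt \<Delta> X) x) =
       NAt (MAt \<Delta> Y) (act F X Y a x) \<cdot>[PO G Y] NAt (SAr (MDom \<Delta>) X Y a) x" by simp
  qed (use \<sigma> \<tau> in \<open>auto simp: \<Delta>_def\<close>)
  note \<Delta>_mod = this
  show ?thesis
    by (rule is_isoI[where g = \<Delta>]; (rule mdf_eqI[where S = "Obj K"])?)
      (use \<Gamma> \<Delta>_mod iso_at modification_at[OF \<Gamma>] in auto)
qed

lemma is_iso_modification_at:
  assumes F: "cat_valued K F" "cat_valued K G" and \<Gamma>: "is_iso (pnt_cat K Cat F G) \<Gamma>" and X: "X \<in> Obj K"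
  shows "is_iso (functor_cat (PO F X) (PO G X)) (MAt \<Gamma> X)"
proof -
  let ?\<Delta> = "inv_in (pnt_cat K Cat F G) \<Gamma>"
  have \<Gamma>m: "modification K Cat F G \<Gamma>" using is_iso_arr[OF \<Gamma>] by simp
  have \<Delta>: "modification K Cat F G ?\<Delta>" "MDom ?\<Delta> = MCod \<Gamma>" "MCod ?\<Delta> = MDom \<Gamma>"
    using inv_in_arr[OF \<Gamma>] by simp_all
  have "MAt (?\<Delta> \<cdot>[pnt_cat K Cat F G] \<Gamma>) X = MAt (Ide (pnt_cat K Cat F G) (MDom \<Gamma>)) X"
    "MAt (\<Gamma> \<cdot>[pnt_cat K Cat F G] ?\<Delta>) X = MAt (Ide (pnt_cat K Cat F G) (MCod \<Gamma>)) X"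
    using inv_in_left[OF \<Gamma>] inv_in_right[OF \<Gamma>] by simp_all
  then show ?thesis
    using X modification_at[OF \<Gamma>m X] modification_at[OF \<Delta>(1) X] \<Delta>(2,3)
    by (intro is_isoI[where g = "MAt ?\<Delta> X"]) simp_all
qed

section \<open>Pointwise equivalences are adjoint equivalences\<close>

text \<open>Write \<open>R X\<close> for the functor \<open>\<rho> X\<close>. For every \<open>y\<close> in \<open>G X\<close> a preimage \<open>Q X y\<close> up to an isomorphism
  \<open>counit X y : R (Q y) \<rightarrow> y\<close> is chosen. Since \<open>R X\<close> is fully faithful, this isomorphism is couniversal:
  every \<open>p : R x \<rightarrow> y\<close> is \<open>counit y\<close> after \<open>R q\<close> for exactly one \<open>q : x \<rightarrow> Q y\<close>, which is called
  \<open>lift X x y p\<close> and is invertible if \<open>p\<close> is. The inverse transformation and the unit are lifts, and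
  an equation between arrows into \<open>Q y\<close> is proved by applying \<open>R\<close> and composing with the counit.\<close>

locale pointwise_equivalence = cat_pnt K F G \<rho>
  for K :: "('o, 'm, 't) twocat"
    and F G :: "('o, 'm, 't, 'p, 'b) cat_psf"
    and \<rho> :: "('o, 'm, 'p, 'b) cat_tr" +
  assumes ff: "X \<in> Obj K \<Longrightarrow> fully_faithful (PO F X) (PO G X) (SOb \<rho> X)"
    and es: "X \<in> Obj K \<Longrightarrow> essentially_surjective (PO F X) (PO G X) (SOb \<rho> X)"
begin

abbreviation R :: "'o \<Rightarrow> 'p \<Rightarrow> 'p" where "R X \<equiv> FOb (SOb \<rho> X)"
abbreviation Rm :: "'o \<Rightarrow> 'b \<Rightarrow> 'b" where "Rm X \<equiv> FAr (SOb \<rho> X)"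
abbreviation s :: "'o \<Rightarrow> 'o \<Rightarrow> 'm \<Rightarrow> 'p \<Rightarrow> 'b" where "s X Y a \<equiv> NAt (SAr \<rho> X Y a)"

definition Q :: "'o \<Rightarrow> 'p \<Rightarrow> 'p" where
  "Q X y = (SOME x. x \<in> Ob (PO F X) \<and> (\<exists>e. iso_in (PO G X) (R X x) y e))"

definition counit :: "'o \<Rightarrow> 'p \<Rightarrow> 'b" where
  "counit X y = (SOME e. iso_in (PO G X) (R X (Q X y)) y e)"

lemma Q_counit [simp]:
  assumes "X \<in> Obj K" "y \<in> Ob (PO G X)"
  shows "Q X y \<in> Ob (PO F X)" "counit X y \<in> Ar (PO G X)" "Dom (PO G X) (counit X y) = R X (Q X y)"
    "Cod (PO G X) (counit X y) = y" "is_iso (PO G X) (counit X y)"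
proof -
  have "\<exists>x. x \<in> Ob (PO F X) \<and> (\<exists>e. iso_in (PO G X) (R X x) y e)"
    using es[OF assms(1)] assms(2) unfolding essentially_surjective_def by blast
  from someI_ex[OF this] have Q: "Q X y \<in> Ob (PO F X)" "\<exists>e. iso_in (PO G X) (R X (Q X y)) y e"
    by (simp_all add: Q_def)
  from someI_ex[OF Q(2)] have "iso_in (PO G X) (R X (Q X y)) y (counit X y)"
    by (simp add: counit_def)
  then show "Q X y \<in> Ob (PO F X)" "counit X y \<in> Ar (PO G X)" "Dom (PO G X) (counit X y) = R X (Q X y)"
    "Cod (PO G X) (counit X y) = y" "is_iso (PO G X) (counit X y)"
    using Q(1) by (simp_all add: iso_in_iff)
qed

definition lift :: "'o \<Rightarrow> 'p \<Rightarrow> 'p \<Rightarrow> 'b \<Rightarrow> 'b" where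
  "lift X x y p = (SOME q. q \<in> Ar (PO F X) \<and> Dom (PO F X) q = x \<and> Cod (PO F X) q = Q X y \<and>
     counit X y \<cdot>[PO G X] Rm X q = p)"

lemma lift [simp]:
  assumes [simp]: "X \<in> Obj K" "x \<in> Ob (PO F X)" "y \<in> Ob (PO G X)" "p \<in> Ar (PO G X)"
    "Dom (PO G X) p = R X x" "Cod (PO G X) p = y"
  shows "lift X x y p \<in> Ar (PO F X)" "Dom (PO F X) (lift X x y p) = x"
    "Cod (PO F X) (lift X x y p) = Q X y" "counit X y \<cdot>[PO G X] Rm X (lift X x y p) = p"
proof -
  obtain q where q: "q \<in> Ar (PO F X)" "Dom (PO F X) q = x" "Cod (PO F X) q = Q X y"
      "Rm X q = inv_in (PO G X) (counit X y) \<cdot>[PO G X] p"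
    by (rule fully_faithful_surj[OF ff[of X], of x "Q X y" "inv_in (PO G X) (counit X y) \<cdot>[PO G X] p"]) auto
  then have "\<exists>q. q \<in> Ar (PO F X) \<and> Dom (PO F X) q = x \<and> Cod (PO F X) q = Q X y \<and>
     counit X y \<cdot>[PO G X] Rm X q = p"
    by (intro exI[of _ q]) simp
  from someI_ex[OF this] show "lift X x y p \<in> Ar (PO F X)" "Dom (PO F X) (lift X x y p) = x"
    "Cod (PO F X) (lift X x y p) = Q X y" "counit X y \<cdot>[PO G X] Rm X (lift X x y p) = p"
    by (simp_all add: lift_def)
qed

lemma lift_iso [simp]:
  assumes [simp]: "X \<in> Obj K" "x \<in> Ob (PO F X)" "y \<in> Ob (PO G X)" "is_iso (PO G X) p"
    "Dom (PO G X) p = R X x" "Cod (PO G X) p = y"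
  shows "is_iso (PO F X) (lift X x y p)"
proof -
  have [simp]: "p \<in> Ar (PO G X)" by (rule is_iso_arr) simp
  have "Rm X (lift X x y p) = inv_in (PO G X) (counit X y) \<cdot>[PO G X] p"
    by (rule iso_cancel_left[where A = "PO G X" and f = "counit X y"]) auto
  then show ?thesis
    by (intro fully_faithful_reflects_iso[OF ff SOb_functor]) auto
qed

text \<open>Uniqueness of lifts. Precomposition with an isomorphism \<open>k\<close> is allowed for, so that an instance
  of \<open>SAr \<rho>\<close> can be appended to both sides; with it the characteristic equation of
  \<open>inverse_at\<close> becomes applicable.\<close>

lemma lift_unique:
  assumes "counit X y \<cdot>[PO G X] (Rm X q \<cdot>[PO G X] k) = counit X y \<cdot>[PO G X] (Rm X q' \<cdot>[PO G X] k)"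
    and [simp]: "X \<in> Obj K" "y \<in> Ob (PO G X)" "q \<in> Ar (PO F X)" "q' \<in> Ar (PO F X)"
    "Dom (PO F X) q = Dom (PO F X) q'" "Cod (PO F X) q = Q X y" "Cod (PO F X) q' = Q X y"
    and k [simp]: "is_iso (PO G X) k" "Cod (PO G X) k = R X (Dom (PO F X) q')"
  shows "q = q'"
proof -
  have [simp]: "k \<in> Ar (PO G X)" by (rule is_iso_arr) simp
  have "Rm X q \<cdot>[PO G X] k = Rm X q' \<cdot>[PO G X] k"
    by (rule iso_cancel_left[OF assms(1)]) auto
  then have "Rm X q = Rm X q'"
    by (rule iso_cancel_right) auto
  from fully_faithful_inj[OF ff[of X] F.PO_category this] show ?thesis by simp
qed

lemma lift_unique_Ide:
  assumes "counit X y \<cdot>[PO G X] Rm X q = counit X y \<cdot>[PO G X] Rm X q'"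
    and "X \<in> Obj K" "y \<in> Ob (PO G X)" "q \<in> Ar (PO F X)" "q' \<in> Ar (PO F X)"
    "Dom (PO F X) q = Dom (PO F X) q'" "Cod (PO F X) q = Q X y" "Cod (PO F X) q' = Q X y"
  shows "q = q'"
  by (rule lift_unique[of X y _ "Ide (PO G X) (R X (Dom (PO F X) q'))"]) (use assms in auto)

definition inverse_ftr :: "'o \<Rightarrow> ('p, 'b, 'p, 'b) ftr" where
  "inverse_ftr X = \<lparr>FOb = (\<lambda>y\<in>Ob (PO G X). Q X y),
     FAr = (\<lambda>u\<in>Ar (PO G X). lift X (Q X (Dom (PO G X) u)) (Cod (PO G X) u)
       (u \<cdot>[PO G X] counit X (Dom (PO G X) u)))\<rparr>"

lemma inverse_ftr_simps [simp]:
  assumes "X \<in> Obj K"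
  shows "y \<in> Ob (PO G X) \<Longrightarrow> FOb (inverse_ftr X) y = Q X y"
    "u \<in> Ar (PO G X) \<Longrightarrow> FAr (inverse_ftr X) u \<in> Ar (PO F X)"
    "u \<in> Ar (PO G X) \<Longrightarrow> Dom (PO F X) (FAr (inverse_ftr X) u) = Q X (Dom (PO G X) u)"
    "u \<in> Ar (PO G X) \<Longrightarrow> Cod (PO F X) (FAr (inverse_ftr X) u) = Q X (Cod (PO G X) u)"
    "u \<in> Ar (PO G X) \<Longrightarrow> Cod (PO G X) u = y \<Longrightarrow>
      counit X y \<cdot>[PO G X] Rm X (FAr (inverse_ftr X) u) = u \<cdot>[PO G X] counit X (Dom (PO G X) u)"
  using assms by (auto simp: inverse_ftr_def)

lemma counit_inverse_ftr [simp]: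
  assumes [simp]: "X \<in> Obj K" "u \<in> Ar (PO G X)" "Cod (PO G X) u = y" "k \<in> Ar (PO G X)"
    "Cod (PO G X) k = R X (Q X (Dom (PO G X) u))"
  shows "counit X y \<cdot>[PO G X] (Rm X (FAr (inverse_ftr X) u) \<cdot>[PO G X] k) =
    u \<cdot>[PO G X] (counit X (Dom (PO G X) u) \<cdot>[PO G X] k)"
proof -
  have [simp]: "y \<in> Ob (PO G X)" using assms(3) Cod_Ob[of "PO G X" u] by simp
  show ?thesis by (subst comp_extend[OF inverse_ftr_simps(5)[of X u y]]) auto
qed

lemma inverse_ftr_functor:
  assumes [simp]: "X \<in> Obj K"
  shows "cat_functor (PO G X) (PO F X) (inverse_ftr X)"
proof (rule functorI)
  fix y assume [simp]: "y \<in> Ob (PO G X)"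
  show "FAr (inverse_ftr X) (Ide (PO G X) y) = Ide (PO F X) (FOb (inverse_ftr X) y)"
    by (rule lift_unique_Ide[of X y]) auto
next
  fix u v assume [simp]: "u \<in> Ar (PO G X)" "v \<in> Ar (PO G X)" "Cod (PO G X) u = Dom (PO G X) v"
  show "FAr (inverse_ftr X) (v \<cdot>[PO G X] u) = FAr (inverse_ftr X) v \<cdot>[PO F X] FAr (inverse_ftr X) u"
    by (rule lift_unique_Ide[of X "Cod (PO G X) v"]) auto
qed (auto, simp_all add: inverse_ftr_def)

text \<open>The mate of the 2-morphism component of \<open>\<rho>\<close> at \<open>a\<close>: the lift of
  \<open>R ((F a) (Q y)) \<cong> (G a) (R (Q y)) \<rightarrow> (G a) y\<close>.\<close>

definition inverse_at :: "'o \<Rightarrow> 'o \<Rightarrow> 'm \<Rightarrow> 'p \<Rightarrow> 'b" where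
  "inverse_at X Y a y = lift Y (act F X Y a (Q X y)) (act G X Y a y)
     (act_ar G X Y a (counit X y) \<cdot>[PO G Y] inv_in (PO G Y) (s X Y a (Q X y)))"

lemma inverse_at [simp]:
  assumes [simp]: "X \<in> Obj K" "Y \<in> Obj K" "a \<in> Ob (Hom K X Y)" "y \<in> Ob (PO G X)"
  shows "inverse_at X Y a y \<in> Ar (PO F Y)" "Dom (PO F Y) (inverse_at X Y a y) = act F X Y a (Q X y)"
    "Cod (PO F Y) (inverse_at X Y a y) = Q Y (act G X Y a y)" "is_iso (PO F Y) (inverse_at X Y a y)"
  by (auto simp: inverse_at_def)

text \<open>The defining equation of \<open>inverse_at\<close>, freed from inverses; all calculations rest on this form.\<close>

lemma inverse_at_eq:
  assumes [simp]: "X \<in> Obj K" "Y \<in> Obj K" "a \<in> Ob (Hom K X Y)" "y \<in> Ob (PO G X)"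
  shows "counit Y (act G X Y a y) \<cdot>[PO G Y] (Rm Y (inverse_at X Y a y) \<cdot>[PO G Y] s X Y a (Q X y)) =
    act_ar G X Y a (counit X y)"
proof -
  have "counit Y (act G X Y a y) \<cdot>[PO G Y] Rm Y (inverse_at X Y a y) =
      act_ar G X Y a (counit X y) \<cdot>[PO G Y] inv_in (PO G Y) (s X Y a (Q X y))"
    by (simp add: inverse_at_def)
  from comp_extend[OF this, of "s X Y a (Q X y)"] show ?thesis by simp
qed

lemma inverse_at_eq_comp [simp]:
  assumes [simp]: "X \<in> Obj K" "Y \<in> Obj K" "a \<in> Ob (Hom K X Y)" "y \<in> Ob (PO G X)"
    "k \<in> Ar (PO G Y)" "Cod (PO G Y) k = act G X Y a (R X (Q X y))"
  shows "counit Y (act G X Y a y) \<cdot>[PO G Y] (Rm Y (inverse_at X Y a y) \<cdot>[PO G Y] (s X Y a (Q X y) \<cdot>[PO G Y] k)) =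
    act_ar G X Y a (counit X y) \<cdot>[PO G Y] k"
proof -
  have "(counit Y (act G X Y a y) \<cdot>[PO G Y] (Rm Y (inverse_at X Y a y) \<cdot>[PO G Y] s X Y a (Q X y))) \<cdot>[PO G Y] k =
    act_ar G X Y a (counit X y) \<cdot>[PO G Y] k"
    by (simp only: inverse_at_eq assms)
  then show ?thesis by simp
qed

definition inverse :: "('o, 'm, 'p, 'b) cat_tr" where
  "inverse = \<lparr>SOb = (\<lambda>X\<in>Obj K. inverse_ftr X),
     SAr = (\<lambda>X Y a. if X \<in> Obj K \<and> Y \<in> Obj K \<and> a \<in> Ob (Hom K X Y)
       then \<lparr>NDom = comp_ftr (PO G X) (FOb (PF F X Y) a) (inverse_ftr X),
             NCod = comp_ftr (PO G X) (inverse_ftr Y) (FOb (PF G X Y) a),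
             NAt = (\<lambda>y\<in>Ob (PO G X). inverse_at X Y a y)\<rparr>
       else undefined)\<rparr>"

lemma inverse_simps [simp]:
  "X \<in> Obj K \<Longrightarrow> SOb inverse X = inverse_ftr X"
  "X \<in> Obj K \<Longrightarrow> Y \<in> Obj K \<Longrightarrow> a \<in> Ob (Hom K X Y) \<Longrightarrow>
    NDom (SAr inverse X Y a) = comp_ftr (PO G X) (FOb (PF F X Y) a) (inverse_ftr X)"
  "X \<in> Obj K \<Longrightarrow> Y \<in> Obj K \<Longrightarrow> a \<in> Ob (Hom K X Y) \<Longrightarrow>
    NCod (SAr inverse X Y a) = comp_ftr (PO G X) (inverse_ftr Y) (FOb (PF G X Y) a)"
  "X \<in> Obj K \<Longrightarrow> Y \<in> Obj K \<Longrightarrow> a \<in> Ob (Hom K X Y) \<Longrightarrow> y \<in> Ob (PO G X) \<Longrightarrow>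
    NAt (SAr inverse X Y a) y = inverse_at X Y a y"
  by (simp_all add: inverse_def)

lemma inverse_at_natural:
  assumes [simp]: "X \<in> Obj K" "Y \<in> Obj K" "a \<in> Ob (Hom K X Y)" "u \<in> Ar (PO G X)"
    "Dom (PO G X) u = y" "Cod (PO G X) u = y'"
  shows "inverse_at X Y a y' \<cdot>[PO F Y] act_ar F X Y a (FAr (inverse_ftr X) u) =
    FAr (inverse_ftr Y) (act_ar G X Y a u) \<cdot>[PO F Y] inverse_at X Y a y"
proof -
  have [simp]: "y \<in> Ob (PO G X)" "y' \<in> Ob (PO G X)"
    using Dom_Ob[of "PO G X" u] Cod_Ob[of "PO G X" u] by simp_all
  have 1: "Rm Y (act_ar F X Y a (FAr (inverse_ftr X) u)) \<cdot>[PO G Y] s X Y a (Q X y) =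
      s X Y a (Q X y') \<cdot>[PO G Y] act_ar G X Y a (Rm X (FAr (inverse_ftr X) u))"
    using SAr_natural[of X Y a "FAr (inverse_ftr X) u"] by simp
  have 2: "act_ar G X Y a (counit X y') \<cdot>[PO G Y] act_ar G X Y a (Rm X (FAr (inverse_ftr X) u)) =
      act_ar G X Y a u \<cdot>[PO G Y] act_ar G X Y a (counit X y)"
    by (simp flip: G.act_simps(6))
  show ?thesis
    by (rule lift_unique[of Y "act G X Y a y'" _ "s X Y a (Q X y)"])
      (simp_all add: 1 2 inverse_at_eq)
qed

text \<open>Each axiom for the mates is reduced by \<open>lift_unique\<close> to the corresponding axiom for \<open>\<rho>\<close> followed
  by naturality of the structure of \<open>G\<close> with respect to the counits.\<close>

lemma cat_pnt_inverse: "cat_pnt K G F inverse"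
proof (rule cat_pntI[OF G.cat_valued_axioms F.cat_valued_axioms])
  fix X assume "X \<in> Obj K"
  then show "cat_functor (PO G X) (PO F X) (SOb inverse X)" by (simp add: inverse_ftr_functor)
next
  fix X Y a assume * [simp]: "X \<in> Obj K" "Y \<in> Obj K" "a \<in> Ob (Hom K X Y)"
  have "nat_trans (PO G X) (PO F Y) (SAr inverse X Y a)"
  proof (rule nat_transI)
    show "cat_functor (PO G X) (PO F Y) (NDom (SAr inverse X Y a))"
      by (simp add: comp_functor[OF _ inverse_ftr_functor F.act_functor])
    show "cat_functor (PO G X) (PO F Y) (NCod (SAr inverse X Y a))"
      by (simp add: comp_functor[OF _ G.act_functor inverse_ftr_functor])
    show "NAt (SAr inverse X Y a) \<in> extensional (Ob (PO G X))" by (simp add: inverse_def)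
  qed (auto simp: inverse_at_natural)
  then show "nat_trans (PO G X) (PO F Y) (SAr inverse X Y a) \<and>
      NDom (SAr inverse X Y a) = comp_ftr (PO G X) (FOb (PF F X Y) a) (SOb inverse X) \<and>
      NCod (SAr inverse X Y a) = comp_ftr (PO G X) (SOb inverse Y) (FOb (PF G X Y) a)"
    by simp
next
  fix X Y \<alpha> y assume [simp]: "X \<in> Obj K" "Y \<in> Obj K" "\<alpha> \<in> Ar (Hom K X Y)" "y \<in> Ob (PO G X)"
  let ?a = "Dom (Hom K X Y) \<alpha>" and ?b = "Cod (Hom K X Y) \<alpha>"
  have 1: "Rm Y (act_cell F X Y \<alpha> (Q X y)) \<cdot>[PO G Y] s X Y ?a (Q X y) =
      s X Y ?b (Q X y) \<cdot>[PO G Y] act_cell G X Y \<alpha> (R X (Q X y))"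
    using SAr_cell[of X Y "Q X y" \<alpha>] by simp
  have 2: "act_ar G X Y ?b (counit X y) \<cdot>[PO G Y] act_cell G X Y \<alpha> (R X (Q X y)) =
      act_cell G X Y \<alpha> y \<cdot>[PO G Y] act_ar G X Y ?a (counit X y)"
    using G.cell_natural[of X Y \<alpha> ?a ?b "counit X y"] by simp
  have "inverse_at X Y ?b y \<cdot>[PO F Y] act_cell F X Y \<alpha> (Q X y) =
      FAr (inverse_ftr Y) (act_cell G X Y \<alpha> y) \<cdot>[PO F Y] inverse_at X Y ?a y"
    by (rule lift_unique[of Y "act G X Y ?b y" _ "s X Y ?a (Q X y)"])
      (simp_all add: 1 2 inverse_at_eq)
  then show "NAt (SAr inverse X Y ?b) y \<cdot>[PO F Y] act_cell F X Y \<alpha> (FOb (SOb inverse X) y) =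
      FAr (SOb inverse Y) (act_cell G X Y \<alpha> y) \<cdot>[PO F Y] NAt (SAr inverse X Y ?a) y"
    by simp
next
  fix X y assume [simp]: "X \<in> Obj K" "y \<in> Ob (PO G X)"
  have "inverse_at X X (One K X) y = Ide (PO F X) (Q X y)"
    by (rule lift_unique_Ide[of X y]) (simp_all add: inverse_at_def SAr_One inv_in_eqI[of _ _ "Ide (PO G X) (R X (Q X y))"])
  then show "NAt (SAr inverse X X (One K X)) y = Ide (PO F X) (FOb (SOb inverse X) y)" by simp
next
  fix X Y Z a b y assume [simp]: "X \<in> Obj K" "Y \<in> Obj K" "Z \<in> Obj K" "y \<in> Ob (PO G X)"
    "a \<in> Ob (Hom K X Y)" "b \<in> Ob (Hom K Y Z)"
  let ?c = "HC1 K X Y Z b a" and ?x = "Q X y"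
  \<comment> \<open>the isomorphism \<open>(G b) (G a) (R x) \<Rightarrow> R ((F b) (F a) x)\<close>\<close>
  let ?k = "s Y Z b (act F X Y a ?x) \<cdot>[PO G Z] act_ar G Y Z b (s X Y a ?x)"
  have 1: "Rm Z (cmp F X Y Z b a ?x) \<cdot>[PO G Z] ?k = s X Z ?c ?x \<cdot>[PO G Z] cmp G X Y Z b a (R X ?x)"
    using SAr_HC1[of X Y Z ?x a b] by simp
  have 2: "act_ar G X Z ?c (counit X y) \<cdot>[PO G Z] cmp G X Y Z b a (R X ?x) =
      cmp G X Y Z b a y \<cdot>[PO G Z] act_ar G Y Z b (act_ar G X Y a (counit X y))"
    using G.cmp_natural[of X Y Z a b "counit X y"] by simp
  have 3: "Rm Z (act_ar F Y Z b (inverse_at X Y a y)) \<cdot>[PO G Z] s Y Z b (act F X Y a ?x) =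
      s Y Z b (Q Y (act G X Y a y)) \<cdot>[PO G Z] act_ar G Y Z b (Rm Y (inverse_at X Y a y))"
    using SAr_natural[of Y Z b "inverse_at X Y a y"] by simp
  have 4: "act_ar G Y Z b (counit Y (act G X Y a y)) \<cdot>[PO G Z]
      (act_ar G Y Z b (Rm Y (inverse_at X Y a y)) \<cdot>[PO G Z] act_ar G Y Z b (s X Y a ?x)) =
      act_ar G Y Z b (act_ar G X Y a (counit X y))"
    using arg_cong[OF inverse_at_eq[of X Y a y], where f = "act_ar G Y Z b"] by simp
  have "inverse_at X Z ?c y \<cdot>[PO F Z] cmp F X Y Z b a ?x =
      FAr (inverse_ftr Z) (cmp G X Y Z b a y) \<cdot>[PO F Z]
        (inverse_at Y Z b (act G X Y a y) \<cdot>[PO F Z] act_ar F Y Z b (inverse_at X Y a y))"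
    by (rule lift_unique[of Z "act G X Z ?c y" _ ?k])
      (simp_all add: 1 2 comp_extend[OF 3] 4)
  then show "NAt (SAr inverse X Z ?c) y \<cdot>[PO F Z] cmp F X Y Z b a (FOb (SOb inverse X) y) =
      FAr (SOb inverse Z) (cmp G X Y Z b a y) \<cdot>[PO F Z]
        (NAt (SAr inverse Y Z b) (act G X Y a y) \<cdot>[PO F Z] act_ar F Y Z b (NAt (SAr inverse X Y a) y))"
    by simp
qed (auto simp: inverse_def)

definition unit_at :: "'o \<Rightarrow> 'p \<Rightarrow> 'b" where
  "unit_at X x = lift X x (R X x) (Ide (PO G X) (R X x))"

lemma unit_at [simp]:
  assumes [simp]: "X \<in> Obj K" "x \<in> Ob (PO F X)"
  shows "unit_at X x \<in> Ar (PO F X)" "Dom (PO F X) (unit_at X x) = x"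
    "Cod (PO F X) (unit_at X x) = Q X (R X x)" "is_iso (PO F X) (unit_at X x)"
    "counit X (R X x) \<cdot>[PO G X] Rm X (unit_at X x) = Ide (PO G X) (R X x)"
  by (auto simp: unit_at_def)

abbreviation QR :: "('o, 'm, 'p, 'b) cat_tr" where
  "QR \<equiv> comp_pnt K Cat F G F inverse \<rho>"

abbreviation RQ :: "('o, 'm, 'p, 'b) cat_tr" where
  "RQ \<equiv> comp_pnt K Cat G F G \<rho> inverse"

definition unit_mdf :: "('o, 'm, 'p, 'b) cat_mdf" where
  "unit_mdf = \<lparr>MDom = id_pnt K Cat F, MCod = QR,
     MAt = (\<lambda>X\<in>Obj K. \<lparr>NDom = id_ftr (PO F X), NCod = comp_ftr (PO F X) (inverse_ftr X) (SOb \<rho> X),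
       NAt = (\<lambda>x\<in>Ob (PO F X). unit_at X x)\<rparr>)\<rparr>"

definition counit_mdf :: "('o, 'm, 'p, 'b) cat_mdf" where
  "counit_mdf = \<lparr>MDom = RQ, MCod = id_pnt K Cat G,
     MAt = (\<lambda>X\<in>Obj K. \<lparr>NDom = comp_ftr (PO G X) (SOb \<rho> X) (inverse_ftr X), NCod = id_ftr (PO G X),
       NAt = (\<lambda>y\<in>Ob (PO G X). counit X y)\<rparr>)\<rparr>"

lemma unit_mdf_simps [simp]:
  "MDom unit_mdf = id_pnt K Cat F" "MCod unit_mdf = QR"
  "X \<in> Obj K \<Longrightarrow> NDom (MAt unit_mdf X) = id_ftr (PO F X)"
  "X \<in> Obj K \<Longrightarrow> NCod (MAt unit_mdf X) = comp_ftr (PO F X) (inverse_ftr X) (SOb \<rho> X)"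
  "X \<in> Obj K \<Longrightarrow> x \<in> Ob (PO F X) \<Longrightarrow> NAt (MAt unit_mdf X) x = unit_at X x"
  by (simp_all add: unit_mdf_def)

lemma counit_mdf_simps [simp]:
  "MDom counit_mdf = RQ" "MCod counit_mdf = id_pnt K Cat G"
  "X \<in> Obj K \<Longrightarrow> NCod (MAt counit_mdf X) = id_ftr (PO G X)"
  "X \<in> Obj K \<Longrightarrow> NDom (MAt counit_mdf X) = comp_ftr (PO G X) (SOb \<rho> X) (inverse_ftr X)"
  "X \<in> Obj K \<Longrightarrow> y \<in> Ob (PO G X) \<Longrightarrow> NAt (MAt counit_mdf X) y = counit X y"
  by (simp_all add: counit_mdf_def)

lemma composite_pnts: "cat_pnt K F F QR" "cat_pnt K G G RQ"
  "cat_pnt K F F (id_pnt K Cat F)" "cat_pnt K G G (id_pnt K Cat G)"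
  using cat_pnt_comp(1)[OF cat_pnt_axioms cat_pnt_inverse] cat_pnt_comp(1)[OF cat_pnt_inverse cat_pnt_axioms]
    cat_pnt_id[OF F.cat_valued_axioms] cat_pnt_id[OF G.cat_valued_axioms] by simp_all

lemma unit_nat: "X \<in> Obj K \<Longrightarrow> nat_trans (PO F X) (PO F X) (MAt unit_mdf X)"
proof (rule nat_transI)
  assume X [simp]: "X \<in> Obj K"
  show "cat_functor (PO F X) (PO F X) (NDom (MAt unit_mdf X))" by simp
  show "cat_functor (PO F X) (PO F X) (NCod (MAt unit_mdf X))"
    by (simp add: comp_functor[OF _ SOb_functor inverse_ftr_functor])
  show "NAt (MAt unit_mdf X) \<in> extensional (Ob (PO F X))" by (simp add: unit_mdf_def)
  fix u assume [simp]: "u \<in> Ar (PO F X)"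
  have "unit_at X (Cod (PO F X) u) \<cdot>[PO F X] u = FAr (inverse_ftr X) (Rm X u) \<cdot>[PO F X] unit_at X (Dom (PO F X) u)"
    by (rule lift_unique_Ide[of X "R X (Cod (PO F X) u)"]) (simp_all add: comp_extend[OF unit_at(5)])
  then show "NAt (MAt unit_mdf X) (Cod (PO F X) u) \<cdot>[PO F X] FAr (NDom (MAt unit_mdf X)) u =
      FAr (NCod (MAt unit_mdf X)) u \<cdot>[PO F X] NAt (MAt unit_mdf X) (Dom (PO F X) u)"
    by simp
qed auto

lemma counit_nat: "X \<in> Obj K \<Longrightarrow> nat_trans (PO G X) (PO G X) (MAt counit_mdf X)"
proof (rule nat_transI)
  assume X [simp]: "X \<in> Obj K"
  show "cat_functor (PO G X) (PO G X) (NCod (MAt counit_mdf X))" by simp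
  show "cat_functor (PO G X) (PO G X) (NDom (MAt counit_mdf X))"
    by (simp add: comp_functor[OF _ inverse_ftr_functor SOb_functor])
  show "NAt (MAt counit_mdf X) \<in> extensional (Ob (PO G X))" by (simp add: counit_mdf_def)
qed auto

lemma unit_modification: "modification K Cat F F unit_mdf"
proof (rule modificationI)
  fix X Y a x assume [simp]: "X \<in> Obj K" "Y \<in> Obj K" "a \<in> Ob (Hom K X Y)" "x \<in> Ob (PO F X)"
  have 1: "Rm Y (act_ar F X Y a (unit_at X x)) \<cdot>[PO G Y] s X Y a x =
      s X Y a (Q X (R X x)) \<cdot>[PO G Y] act_ar G X Y a (Rm X (unit_at X x))"
    using SAr_natural[of X Y a "unit_at X x"] by simp
  have 2: "act_ar G X Y a (counit X (R X x)) \<cdot>[PO G Y] act_ar G X Y a (Rm X (unit_at X x)) =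
      Ide (PO G Y) (act G X Y a (R X x))"
    by (simp flip: G.act_simps(6))
  have "(FAr (inverse_ftr Y) (s X Y a x) \<cdot>[PO F Y] inverse_at X Y a (R X x)) \<cdot>[PO F Y] act_ar F X Y a (unit_at X x)
      = unit_at Y (act F X Y a x)"
    by (rule lift_unique[of Y "R Y (act F X Y a x)" _ "s X Y a x"])
      (simp_all add: 1 2 comp_extend[OF unit_at(5)])
  then show "NAt (SAr (MCod unit_mdf) X Y a) x \<cdot>[PO F Y] act_ar F X Y a (NAt (MAt unit_mdf X) x) =
      NAt (MAt unit_mdf Y) (act F X Y a x) \<cdot>[PO F Y] NAt (SAr (MDom unit_mdf) X Y a) x"
    by (simp add: cat_pnt_comp(2)[OF cat_pnt_axioms cat_pnt_inverse] del: comp_pnt_simps(2))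
qed (simp_all add: composite_pnts unit_nat, simp add: unit_mdf_def)

lemma counit_modification: "modification K Cat G G counit_mdf"
proof (rule modificationI)
  fix X Y a y assume [simp]: "X \<in> Obj K" "Y \<in> Obj K" "a \<in> Ob (Hom K X Y)" "y \<in> Ob (PO G X)"
  show "NAt (SAr (MCod counit_mdf) X Y a) y \<cdot>[PO G Y] act_ar G X Y a (NAt (MAt counit_mdf X) y) =
      NAt (MAt counit_mdf Y) (act G X Y a y) \<cdot>[PO G Y] NAt (SAr (MDom counit_mdf) X Y a) y"
    by (simp add: cat_pnt_comp(2)[OF cat_pnt_inverse cat_pnt_axioms] inverse_at_eq del: comp_pnt_simps(2))
qed (simp_all add: composite_pnts counit_nat, simp add: counit_mdf_def)

lemma triangle_counit_unit:
  "rwh (Ps K Cat) F G G counit_mdf \<rho> \<cdot>[pnt_cat K Cat F G] lwh (Ps K Cat) F F G \<rho> unit_mdf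
    = Ide (pnt_cat K Cat F G) \<rho>"
proof (rule mdf_eqI[where S = "Obj K"])
  fix X assume [simp]: "X \<in> Obj K"
  have "rwh Cat (PO F X) (PO G X) (PO G X) (MAt counit_mdf X) (SOb \<rho> X) \<cdot>[functor_cat (PO F X) (PO G X)]
      lwh Cat (PO F X) (PO F X) (PO G X) (SOb \<rho> X) (MAt unit_mdf X) = Ide (functor_cat (PO F X) (PO G X)) (SOb \<rho> X)"
    by (rule nat_trans_eqI[where A = "PO F X" and B = "PO G X"])
      (simp_all add: nat_trans_Comp nat_trans_Ide SOb_functor unit_nat counit_nat
        nat_trans_rwh[where B = "PO G X"] nat_trans_lwh[where B = "PO F X"] comp_ftr_id[OF _ _ SOb_functor]
        comp_ftr_assoc[OF _ SOb_functor]
        rwh_Cat_at[where B = "PO G X"] lwh_Cat_at[where B = "PO F X"])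
  then show "MAt (rwh (Ps K Cat) F G G counit_mdf \<rho> \<cdot>[pnt_cat K Cat F G] lwh (Ps K Cat) F F G \<rho> unit_mdf) X
      = MAt (Ide (pnt_cat K Cat F G) \<rho>) X"
    by (simp add: rwh_def lwh_def)
qed (simp_all add: rwh_def lwh_def comp_pnt_id[OF cat_pnt_axioms])

lemma triangle_unit_counit:
  "lwh (Ps K Cat) G G F inverse counit_mdf \<cdot>[pnt_cat K Cat G F] rwh (Ps K Cat) G F F unit_mdf inverse
    = Ide (pnt_cat K Cat G F) inverse"
proof (rule mdf_eqI[where S = "Obj K"])
  fix X assume [simp]: "X \<in> Obj K"
  have 1: "FAr (inverse_ftr X) (counit X y) \<cdot>[PO F X] unit_at X (Q X y) = Ide (PO F X) (Q X y)"
    if [simp]: "y \<in> Ob (PO G X)" for y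
    by (rule lift_unique_Ide[of X y]) simp_all
  have "lwh Cat (PO G X) (PO G X) (PO F X) (inverse_ftr X) (MAt counit_mdf X) \<cdot>[functor_cat (PO G X) (PO F X)]
      rwh Cat (PO G X) (PO F X) (PO F X) (MAt unit_mdf X) (inverse_ftr X)
      = Ide (functor_cat (PO G X) (PO F X)) (inverse_ftr X)"
    by (rule nat_trans_eqI[where A = "PO G X" and B = "PO F X"])
      (simp_all add: 1 nat_trans_Comp nat_trans_Ide inverse_ftr_functor unit_nat counit_nat
        nat_trans_rwh[where B = "PO F X"] nat_trans_lwh[where B = "PO G X"] comp_ftr_id[OF _ _ inverse_ftr_functor]
        comp_ftr_assoc[OF _ inverse_ftr_functor]
        rwh_Cat_at[where B = "PO F X"] lwh_Cat_at[where B = "PO G X"])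
  then show "MAt (lwh (Ps K Cat) G G F inverse counit_mdf \<cdot>[pnt_cat K Cat G F] rwh (Ps K Cat) G F F unit_mdf inverse) X
      = MAt (Ide (pnt_cat K Cat G F) inverse) X"
    by (simp add: rwh_def lwh_def)
qed (simp_all add: rwh_def lwh_def comp_pnt_id[OF cat_pnt_inverse])

text \<open>The counit isomorphisms form a modification by \<open>inverse_at_eq\<close>, and the unit consists of the
  lifts of identities. One triangle identity is the defining equation of the unit, and the other
  one holds by uniqueness of lifts.\<close>

theorem adjoint_equivalence: "adjoint_equivalence (Ps K Cat) F G \<rho>"
proof -
  interpret inv: cat_pnt K G F inverse by (rule cat_pnt_inverse)
  have "iso_in (pnt_cat K Cat F F) (id_pnt K Cat F) QR unit_mdf"
    using is_iso_modification[OF unit_modification] unit_modification composite_pnts by (simp add: iso_in_iff)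
  moreover have "iso_in (pnt_cat K Cat G G) RQ (id_pnt K Cat G) counit_mdf"
    using is_iso_modification[OF counit_modification] counit_modification composite_pnts by (simp add: iso_in_iff)
  ultimately show ?thesis
    unfolding adjoint_equivalence_def Ps_simps pnt_cat_simps(1)
    by (intro conjI bexI[of _ inverse] exI[of _ unit_mdf] exI[of _ counit_mdf] triangle_counit_unit
        triangle_unit_counit F.normal_pseudo_functor_axioms G.normal_pseudo_functor_axioms
        pseudo_natural_axioms) (simp_all add: inv.pseudo_natural_axioms)
qed

end

text \<open>Conversely, an equivalence in the 2-category of pseudo-functors is one at each object.\<close>

lemma adjoint_equivalence_pointwise:
  assumes FG: "cat_valued K F" "cat_valued K G" and eq: "adjoint_equivalence (Ps K Cat) F G \<rho>" and X: "X \<in> Obj K"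
  shows "fully_faithful (PO F X) (PO G X) (SOb \<rho> X)" "essentially_surjective (PO F X) (PO G X) (SOb \<rho> X)"
proof -
  interpret F: cat_valued K F by fact
  interpret G: cat_valued K G by fact
  obtain g \<eta> \<epsilon> where g: "pseudo_natural K Cat G F g" and \<rho>: "pseudo_natural K Cat F G \<rho>"
    and \<eta>: "iso_in (pnt_cat K Cat F F) (id_pnt K Cat F) (comp_pnt K Cat F G F g \<rho>) \<eta>"
    and \<epsilon>: "iso_in (pnt_cat K Cat G G) (comp_pnt K Cat G F G \<rho> g) (id_pnt K Cat G) \<epsilon>"
    using eq unfolding adjoint_equivalence_def by auto
  interpret \<rho>: cat_pnt K F G \<rho> using FG \<rho> by (intro cat_pnt.intro)
  interpret g: cat_pnt K G F g using FG g by (intro cat_pnt.intro)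
  note [simp] = X
  have \<eta>': "modification K Cat F F \<eta>" "MDom \<eta> = id_pnt K Cat F" "MCod \<eta> = comp_pnt K Cat F G F g \<rho>"
      "is_iso (pnt_cat K Cat F F) \<eta>"
    using \<eta> by (simp_all add: iso_in_iff)
  have \<epsilon>': "modification K Cat G G \<epsilon>" "MDom \<epsilon> = comp_pnt K Cat G F G \<rho> g" "MCod \<epsilon> = id_pnt K Cat G"
      "is_iso (pnt_cat K Cat G G) \<epsilon>"
    using \<epsilon> by (simp_all add: iso_in_iff)
  note \<eta>_at = modification_at[OF \<eta>'(1) X, unfolded \<eta>'(2,3)] is_iso_modification_at[OF FG(1) FG(1) \<eta>'(4) X]
  note \<epsilon>_at = modification_at[OF \<epsilon>'(1) X, unfolded \<epsilon>'(2,3)] is_iso_modification_at[OF FG(2) FG(2) \<epsilon>'(4) X]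
  have 1: "iso_in (PO F X) x (FOb (SOb g X) (FOb (SOb \<rho> X) x)) (NAt (MAt \<eta> X) x)" if "x \<in> Ob (PO F X)" for x
    using that \<eta>_at nat_trans_arr(3-5)[OF \<eta>_at(1) that] is_iso_component[OF \<eta>_at(4) that]
    by (simp add: iso_in_iff)
  have 2: "NAt (MAt \<eta> X) (Cod (PO F X) u) \<cdot>[PO F X] u =
      FAr (SOb g X) (FAr (SOb \<rho> X) u) \<cdot>[PO F X] NAt (MAt \<eta> X) (Dom (PO F X) u)" if "u \<in> Ar (PO F X)" for u
    using that \<eta>_at nat_trans_arr(6)[OF \<eta>_at(1) that refl refl] by simp
  have 3: "iso_in (PO G X) (FOb (SOb \<rho> X) (FOb (SOb g X) y)) y (NAt (MAt \<epsilon> X) y)" if "y \<in> Ob (PO G X)" for y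
    using that \<epsilon>_at nat_trans_arr(3-5)[OF \<epsilon>_at(1) that] is_iso_component[OF \<epsilon>_at(4) that]
    by (simp add: iso_in_iff)
  have 4: "NAt (MAt \<epsilon> X) (Cod (PO G X) v) \<cdot>[PO G X] FAr (SOb \<rho> X) (FAr (SOb g X) v) =
      v \<cdot>[PO G X] NAt (MAt \<epsilon> X) (Dom (PO G X) v)" if "v \<in> Ar (PO G X)" for v
    using that \<epsilon>_at nat_trans_arr(6)[OF \<epsilon>_at(1) that refl refl] by simp
  show "fully_faithful (PO F X) (PO G X) (SOb \<rho> X)" "essentially_surjective (PO F X) (PO G X) (SOb \<rho> X)"
    by (rule equivalence_fully_faithful[OF _ _ \<rho>.SOb_functor g.SOb_functor 1 2 3 4]; simp)+
qed

section \<open>Representables and the transformation named by an element\<close>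

lemma representable_simps [simp]:
  "PO (representable K I) X = Hom K X I"
  "c \<in> Ob (Hom K Y X) \<Longrightarrow> FOb (PF (representable K I) X Y) c = repr_ob K I X Y c"
  "\<gamma> \<in> Ar (Hom K Y X) \<Longrightarrow> NDom (FAr (PF (representable K I) X Y) \<gamma>) = repr_ob K I X Y (Dom (Hom K Y X) \<gamma>)"
  "\<gamma> \<in> Ar (Hom K Y X) \<Longrightarrow> NCod (FAr (PF (representable K I) X Y) \<gamma>) = repr_ob K I X Y (Cod (Hom K Y X) \<gamma>)"
  "\<gamma> \<in> Ar (Hom K Y X) \<Longrightarrow> f \<in> Ob (Hom K X I) \<Longrightarrow> NAt (FAr (PF (representable K I) X Y) \<gamma>) f = lwh K Y X I f \<gamma>"
  "HC1 K Z Y X a b \<in> Ob (Hom K Z X) \<Longrightarrow> PC (representable K I) X Y Z b a =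
     Ide (functor_cat (Hom K X I) (Hom K Z I)) (repr_ob K I X Z (HC1 K Z Y X a b))"
  by (simp_all add: representable_def repr_hom_def)

lemma repr_ob_simps [simp]:
  "f \<in> Ob (Hom K X I) \<Longrightarrow> FOb (repr_ob K I X Y c) f = HC1 K Y X I f c"
  "\<theta> \<in> Ar (Hom K X I) \<Longrightarrow> FAr (repr_ob K I X Y c) \<theta> = rwh K Y X I \<theta> c"
  by (simp_all add: repr_ob_def)

context two_category
begin

lemma repr_ob_functor:
  assumes [simp]: "I \<in> Obj K" "X \<in> Obj K" "Y \<in> Obj K" "c \<in> Ob (Hom K Y X)"
  shows "cat_functor (Hom K X I) (Hom K Y I) (repr_ob K I X Y c)"
  by (rule functorI) (auto simp: rwh_Comp, simp_all add: repr_ob_def)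

lemma repr_cell_nat:
  assumes [simp]: "I \<in> Obj K" "X \<in> Obj K" "Y \<in> Obj K" "\<gamma> \<in> Ar (Hom K Y X)"
  shows "nat_trans (Hom K X I) (Hom K Y I) (FAr (PF (representable K I) X Y) \<gamma>)"
proof (rule nat_transI)
  fix \<theta> assume [simp]: "\<theta> \<in> Ar (Hom K X I)"
  show "NAt (FAr (PF (representable K I) X Y) \<gamma>) (Cod (Hom K X I) \<theta>) \<cdot>[Hom K Y I]
        FAr (NDom (FAr (PF (representable K I) X Y) \<gamma>)) \<theta> =
      FAr (NCod (FAr (PF (representable K I) X Y) \<gamma>)) \<theta> \<cdot>[Hom K Y I]
        NAt (FAr (PF (representable K I) X Y) \<gamma>) (Dom (Hom K X I) \<theta>)"
    using HC2_whisker[of Y X I \<gamma> \<theta>] by simp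
qed (auto simp: repr_ob_functor, simp_all add: representable_def repr_hom_def)

lemma repr_ob_One:
  assumes [simp]: "I \<in> Obj K" "X \<in> Obj K"
  shows "repr_ob K I X X (One K X) = id_ftr (Hom K X I)"
  by (rule functor_eqI[where A = "Hom K X I" and B = "Hom K X I"])
    (auto simp: repr_ob_functor hc1_one rwh_def hc2_one)

lemma repr_ob_HC1:
  assumes [simp]: "I \<in> Obj K" "X \<in> Obj K" "Y \<in> Obj K" "Z \<in> Obj K" "a \<in> Ob (Hom K Y X)" "b \<in> Ob (Hom K Z Y)"
  shows "comp_ftr (Hom K X I) (repr_ob K I Y Z b) (repr_ob K I X Y a) = repr_ob K I X Z (HC1 K Z Y X a b)"
  by (rule functor_eqI[OF comp_functor[OF _ repr_ob_functor repr_ob_functor] repr_ob_functor])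
    (auto simp: hc1_assoc rwh_def hc2_assoc hc2_ide)

text \<open>Its compositors are identities because composition in \<open>K\<close> is strictly associative; naturality
  of the compositor is the agreement of the two descriptions of horizontal composition by
  whiskerings.\<close>

lemma cat_valued_representable:
  assumes I [simp]: "I \<in> Obj K"
  shows "cat_valued (op2 K) (representable K I)"
proof (intro cat_valued.intro two_category_op2 two_category_axioms normal_pseudo_functor.intro)
  let ?R = "representable K I"
  note [simp] = nat_trans_Ide nat_trans_Comp repr_ob_functor repr_cell_nat
  {
    fix X assume "X \<in> Obj (op2 K)"
    then show "PO ?R X \<in> Obj Cat"
      "FOb (PF ?R X X) (One (op2 K) X) = One Cat (PO ?R X)"
      by (simp_all add: repr_ob_One)
  }
  {
    fix X Y assume "X \<in> Obj (op2 K)" "Y \<in> Obj (op2 K)"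
    then have [simp]: "X \<in> Obj K" "Y \<in> Obj K" by simp_all
    have "cat_functor (Hom K Y X) (functor_cat (Hom K X I) (Hom K Y I)) (PF ?R X Y)"
    proof (rule functorI)
      fix c assume [simp]: "c \<in> Ob (Hom K Y X)"
      show "FAr (PF ?R X Y) (Ide (Hom K Y X) c) =
          Ide (functor_cat (Hom K X I) (Hom K Y I)) (FOb (PF ?R X Y) c)"
        by (rule nat_trans_eqI[where A = "Hom K X I" and B = "Hom K Y I"]) auto
    next
      fix \<gamma> \<delta> assume [simp]: "\<gamma> \<in> Ar (Hom K Y X)" "\<delta> \<in> Ar (Hom K Y X)" "Cod (Hom K Y X) \<gamma> = Dom (Hom K Y X) \<delta>"
      show "FAr (PF ?R X Y) (\<delta> \<cdot>[Hom K Y X] \<gamma>) =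
          FAr (PF ?R X Y) \<delta> \<cdot>[functor_cat (Hom K X I) (Hom K Y I)] FAr (PF ?R X Y) \<gamma>"
        by (rule nat_trans_eqI[where A = "Hom K X I" and B = "Hom K Y I"]) (auto simp: lwh_Comp)
    qed (auto, simp_all add: representable_def repr_hom_def)
    then show "cat_functor (Hom (op2 K) X Y) (Hom Cat (PO ?R X) (PO ?R Y))
        (PF ?R X Y)" by simp
  }
  {
    fix X Y Z a b
    assume "X \<in> Obj (op2 K)" "Y \<in> Obj (op2 K)" "Z \<in> Obj (op2 K)" "a \<in> Ob (Hom (op2 K) X Y)" "b \<in> Ob (Hom (op2 K) Y Z)"
    then show "iso_in (Hom Cat (PO ?R X) (PO ?R Z))
        (HC1 Cat (PO ?R X) (PO ?R Y) (PO ?R Z)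
          (FOb (PF ?R Y Z) b) (FOb (PF ?R X Y) a))
        (FOb (PF ?R X Z) (HC1 (op2 K) X Y Z b a)) (PC ?R X Y Z b a)"
      by (simp add: iso_in_iff repr_ob_HC1)
  }
  {
    fix X Y Z \<alpha> a a' \<beta> b b'
    assume *: "X \<in> Obj (op2 K)" "Y \<in> Obj (op2 K)" "Z \<in> Obj (op2 K)" "\<alpha> \<in> hom (Hom (op2 K) X Y) a a'"
      "\<beta> \<in> hom (Hom (op2 K) Y Z) b b'"
    then have [simp]: "X \<in> Obj K" "Y \<in> Obj K" "Z \<in> Obj K" "\<alpha> \<in> Ar (Hom K Y X)" "\<beta> \<in> Ar (Hom K Z Y)"
        "Dom (Hom K Y X) \<alpha> = a" "Cod (Hom K Y X) \<alpha> = a'" "Dom (Hom K Z Y) \<beta> = b" "Cod (Hom K Z Y) \<beta> = b'"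
      by (auto simp: in_hom)
    have [simp]: "a \<in> Ob (Hom K Y X)" "a' \<in> Ob (Hom K Y X)" "b \<in> Ob (Hom K Z Y)" "b' \<in> Ob (Hom K Z Y)"
      using Dom_Ob[of "Hom K Y X" \<alpha>] Cod_Ob[of "Hom K Y X" \<alpha>] Dom_Ob[of "Hom K Z Y" \<beta>] Cod_Ob[of "Hom K Z Y" \<beta>]
      by simp_all
    have "lwh K Z X I f (HC2 K Z Y X \<alpha> \<beta>) = lwh K Z Y I (HC1 K Y X I f a') \<beta> \<cdot>[Hom K Z I] rwh K Z Y I (lwh K Y X I f \<alpha>) b"
      if "f \<in> Ob (Hom K X I)" for f
      using HC2_whisker(2)[of Z Y I \<beta> "lwh K Y X I f \<alpha>"] that by (simp add: lwh_def hc2_assoc)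
    then have "FAr (PF ?R X Z) (HC2 K Z Y X \<alpha> \<beta>)
          \<cdot>[functor_cat (Hom K X I) (Hom K Z I)] PC ?R X Y Z b a
        = PC ?R X Y Z b' a' \<cdot>[functor_cat (Hom K X I) (Hom K Z I)]
          hcomp_nat (Hom K X I) (Hom K Z I) (FAr (PF ?R Y Z) \<beta>) (FAr (PF ?R X Y) \<alpha>)"
      by (intro nat_trans_eqI[where A = "Hom K X I" and B = "Hom K Z I"])
        (auto simp: repr_ob_HC1 nat_trans_hcomp[where B = "Hom K Y I"] hc1_assoc)
    then show "FAr (PF ?R X Z) (HC2 (op2 K) X Y Z \<beta> \<alpha>)
          \<cdot>[Hom Cat (PO ?R X) (PO ?R Z)] PC ?R X Y Z b a
        = PC ?R X Y Z b' a' \<cdot>[Hom Cat (PO ?R X) (PO ?R Z)]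
          HC2 Cat (PO ?R X) (PO ?R Y) (PO ?R Z)
            (FAr (PF ?R Y Z) \<beta>) (FAr (PF ?R X Y) \<alpha>)"
      by (simp only: op2_simps Cat_simps representable_simps(1))
  }
  {
    fix W X Y Z a b c
    assume "W \<in> Obj (op2 K)" "X \<in> Obj (op2 K)" "Y \<in> Obj (op2 K)" "Z \<in> Obj (op2 K)"
      "a \<in> Ob (Hom (op2 K) W X)" "b \<in> Ob (Hom (op2 K) X Y)" "c \<in> Ob (Hom (op2 K) Y Z)"
    then have [simp]: "W \<in> Obj K" "X \<in> Obj K" "Y \<in> Obj K" "Z \<in> Obj K" "a \<in> Ob (Hom K X W)" "b \<in> Ob (Hom K Y X)"
      "c \<in> Ob (Hom K Z Y)" by simp_all
    have "PC ?R W X Z (HC1 K Z Y X b c) a \<cdot>[functor_cat (Hom K W I) (Hom K Z I)]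
        rwh Cat (Hom K W I) (Hom K X I) (Hom K Z I) (PC ?R X Y Z c b) (FOb (PF ?R W X) a)
      = PC ?R W Y Z c (HC1 K Y X W a b) \<cdot>[functor_cat (Hom K W I) (Hom K Z I)]
        lwh Cat (Hom K W I) (Hom K Y I) (Hom K Z I) (FOb (PF ?R Y Z) c) (PC ?R W X Y b a)"
      by (rule nat_trans_eqI[where A = "Hom K W I" and B = "Hom K Z I"])
        (auto simp: repr_ob_HC1 hc1_assoc nat_trans_rwh[where B = "Hom K X I"] nat_trans_lwh[where B = "Hom K Y I"]
          rwh_Cat_at[where B = "Hom K X I"] lwh_Cat_at[where B = "Hom K Y I"])
    then show "PC ?R W X Z (HC1 (op2 K) X Y Z c b) a
          \<cdot>[Hom Cat (PO ?R W) (PO ?R Z)]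
          rwh Cat (PO ?R W) (PO ?R X) (PO ?R Z)
            (PC ?R X Y Z c b) (FOb (PF ?R W X) a)
        = PC ?R W Y Z c (HC1 (op2 K) W X Y b a)
          \<cdot>[Hom Cat (PO ?R W) (PO ?R Z)]
          lwh Cat (PO ?R W) (PO ?R Y) (PO ?R Z)
            (FOb (PF ?R Y Z) c) (PC ?R W X Y b a)"
      by simp
  }
  {
    fix X Y a assume "X \<in> Obj (op2 K)" "Y \<in> Obj (op2 K)" "a \<in> Ob (Hom (op2 K) X Y)"
    then show "PC ?R X X Y a (One (op2 K) X) =
        Ide (Hom Cat (PO ?R X) (PO ?R Y)) (FOb (PF ?R X Y) a)"
      "PC ?R X Y Y (One (op2 K) Y) a =
        Ide (Hom Cat (PO ?R X) (PO ?R Y)) (FOb (PF ?R X Y) a)"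
      by (simp_all add: one_hc1 hc1_one)
  }
qed

end

text \<open>The pseudo-natural transformation \<open>Hom K (-, I) \<Rightarrow> F\<close> that corresponds to the element \<open>i\<close> under
  the bicategorical Yoneda lemma. Its component at \<open>a\<close> compares \<open>(F a) ((F c) i)\<close> with \<open>F (c a) i\<close>.\<close>

definition yoneda_pnt ::
  "('o, 'm, 't) twocat \<Rightarrow> ('o, 'm, 't, 'm, 't) cat_psf
    \<Rightarrow> 'o \<Rightarrow> 'm \<Rightarrow> ('o, 'm, 'm, 't) cat_tr" where
  "yoneda_pnt K F I i = \<lparr>
     SOb = (\<lambda>X\<in>Obj K. evaluation K F I i X),
     SAr = (\<lambda>X Y a. if X \<in> Obj K \<and> Y \<in> Obj K \<and> a \<in> Ob (Hom K Y X)
       then \<lparr>NDom = comp_ftr (Hom K X I) (FOb (PF F X Y) a) (evaluation K F I i X),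
             NCod = comp_ftr (Hom K X I) (evaluation K F I i Y) (repr_ob K I X Y a),
             NAt = (\<lambda>c\<in>Ob (Hom K X I). cmp F I X Y a c i)\<rparr>
       else undefined)\<rparr>"

lemma yoneda_pnt_simps [simp]:
  "X \<in> Obj K \<Longrightarrow> SOb (yoneda_pnt K F I i) X = evaluation K F I i X"
  "X \<in> Obj K \<Longrightarrow> Y \<in> Obj K \<Longrightarrow> a \<in> Ob (Hom K Y X) \<Longrightarrow>
    NDom (SAr (yoneda_pnt K F I i) X Y a) = comp_ftr (Hom K X I) (FOb (PF F X Y) a) (evaluation K F I i X)"
  "X \<in> Obj K \<Longrightarrow> Y \<in> Obj K \<Longrightarrow> a \<in> Ob (Hom K Y X) \<Longrightarrow>
    NCod (SAr (yoneda_pnt K F I i) X Y a) = comp_ftr (Hom K X I) (evaluation K F I i Y) (repr_ob K I X Y a)"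
  "X \<in> Obj K \<Longrightarrow> Y \<in> Obj K \<Longrightarrow> a \<in> Ob (Hom K Y X) \<Longrightarrow> c \<in> Ob (Hom K X I) \<Longrightarrow>
    NAt (SAr (yoneda_pnt K F I i) X Y a) c = cmp F I X Y a c i"
  by (simp_all add: yoneda_pnt_def)

text \<open>Naturality in both variables is naturality of the compositor in 2-morphisms, and
  compatibility with composition is its associativity axiom.\<close>

lemma cat_pnt_yoneda:
  assumes "presheaf C F" and I: "I \<in> Obj C" "i \<in> Ob (PO F I)"
  shows "cat_pnt (op2 C) (representable C I) F (yoneda_pnt C F I i)"
proof -
  interpret presheaf C F by fact
  note [simp] = I
  let ?R = "representable C I" and ?y = "yoneda_pnt C F I i"
  show ?thesis
  proof (rule cat_pntI[OF C.cat_valued_representable[OF I(1)] cat_valued_axioms])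
    fix X assume "X \<in> Obj (op2 C)"
    then show "cat_functor (PO ?R X) (PO F X) (SOb ?y X)" by (simp add: evaluation_functor)
  next
    fix X Y a assume *: "X \<in> Obj (op2 C)" "Y \<in> Obj (op2 C)" "a \<in> Ob (Hom (op2 C) X Y)"
    then have [simp]: "X \<in> Obj C" "Y \<in> Obj C" "a \<in> Ob (Hom C Y X)" by simp_all
    have "nat_trans (Hom C X I) (PO F Y) (SAr ?y X Y a)"
    proof (rule nat_transI)
      show "cat_functor (Hom C X I) (PO F Y) (NDom (SAr ?y X Y a))"
        using comp_functor[OF _ evaluation_functor act_functor[OF *]] by simp
      show "cat_functor (Hom C X I) (PO F Y) (NCod (SAr ?y X Y a))"
        using comp_functor[OF _ C.repr_ob_functor evaluation_functor] by simp
      show "NAt (SAr ?y X Y a) \<in> extensional (Ob (Hom C X I))" by (simp add: yoneda_pnt_def)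
      fix \<theta> assume [simp]: "\<theta> \<in> Ar (Hom C X I)"
      show "NAt (SAr ?y X Y a) (Cod (Hom C X I) \<theta>) \<cdot>[PO F Y] FAr (NDom (SAr ?y X Y a)) \<theta> =
          FAr (NCod (SAr ?y X Y a)) \<theta> \<cdot>[PO F Y] NAt (SAr ?y X Y a) (Dom (Hom C X I) \<theta>)"
        using cmp_cell[of I X Y i \<theta> "Dom (Hom C X I) \<theta>" "Cod (Hom C X I) \<theta>" "Ide (Hom C Y X) a" a a]
        by (simp add: rwh_def)
    qed auto
    then show "nat_trans (PO ?R X) (PO F Y) (SAr ?y X Y a) \<and>
        NDom (SAr ?y X Y a) = comp_ftr (PO ?R X) (FOb (PF F X Y) a) (SOb ?y X) \<and>
        NCod (SAr ?y X Y a) = comp_ftr (PO ?R X) (SOb ?y Y) (FOb (PF ?R X Y) a)"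
      by simp
    fix x assume "x \<in> Ob (PO ?R X)"
    then show "is_iso (PO F Y) (NAt (SAr ?y X Y a) x)" by simp
  next
    fix X Y \<alpha> c assume "X \<in> Obj (op2 C)" "Y \<in> Obj (op2 C)" "\<alpha> \<in> Ar (Hom (op2 C) X Y)" "c \<in> Ob (PO ?R X)"
    then have [simp]: "X \<in> Obj C" "Y \<in> Obj C" "\<alpha> \<in> Ar (Hom C Y X)" "c \<in> Ob (Hom C X I)" by simp_all
    show "NAt (SAr ?y X Y (Cod (Hom (op2 C) X Y) \<alpha>)) c \<cdot>[PO F Y] act_cell F X Y \<alpha> (FOb (SOb ?y X) c) =
        FAr (SOb ?y Y) (act_cell ?R X Y \<alpha> c) \<cdot>[PO F Y] NAt (SAr ?y X Y (Dom (Hom (op2 C) X Y) \<alpha>)) c"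
      using cmp_cell[of I X Y i "Ide (Hom C X I) c" c c \<alpha> "Dom (Hom C Y X) \<alpha>" "Cod (Hom C Y X) \<alpha>"]
      by (simp add: lwh_def)
  next
    fix X Y Z a b c assume "X \<in> Obj (op2 C)" "Y \<in> Obj (op2 C)" "Z \<in> Obj (op2 C)" "c \<in> Ob (PO ?R X)"
      "a \<in> Ob (Hom (op2 C) X Y)" "b \<in> Ob (Hom (op2 C) Y Z)"
    then have [simp]: "X \<in> Obj C" "Y \<in> Obj C" "Z \<in> Obj C" "c \<in> Ob (Hom C X I)" "a \<in> Ob (Hom C Y X)" "b \<in> Ob (Hom C Z Y)"
      by simp_all
    show "NAt (SAr ?y X Z (HC1 (op2 C) X Y Z b a)) c \<cdot>[PO F Z] cmp F X Y Z b a (FOb (SOb ?y X) c) =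
        FAr (SOb ?y Z) (cmp ?R X Y Z b a c) \<cdot>[PO F Z]
          (NAt (SAr ?y Y Z b) (act ?R X Y a c) \<cdot>[PO F Z] act_ar F Y Z b (NAt (SAr ?y X Y a) c))"
      using cmp_assoc[of I X Y Z i c a b] by (simp add: C.hc1_assoc)
  qed (auto simp: yoneda_pnt_def)
qed

section \<open>Bi-representations are bi-initial objects of the 2-category of elements\<close>

text \<open>The 2-morphism component of \<open>\<rho>\<close> at \<open>c : X \<rightarrow> I\<close>, taken at the identity of \<open>I\<close>, is an isomorphism
  \<open>(F c) (\<rho> I id) \<cong> \<rho> X (id c) = \<rho> X c\<close>, natural in \<open>c\<close>. So evaluation at the element \<open>\<rho> I id\<close> is
  isomorphic to the equivalence \<open>\<rho> X\<close>.\<close>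

lemma bi_representation_bi_initial:
  assumes "presheaf C F" and rep: "bi_representation C F I \<rho>"
  shows "\<exists>i \<in> Ob (PO F I). bi_initial (el C F) (I, i)"
proof -
  interpret presheaf C F by fact
  have I [simp]: "I \<in> Obj C" and eq: "adjoint_equivalence (Ps (op2 C) Cat) (representable C I) F \<rho>"
    using rep by (auto simp: bi_representation_def)
  have "pseudo_natural (op2 C) Cat (representable C I) F \<rho>"
    using eq by (simp add: adjoint_equivalence_def)
  then interpret \<rho>: cat_pnt "op2 C" "representable C I" F \<rho>
    by (intro cat_pnt.intro C.cat_valued_representable cat_valued_axioms) simp_all
  let ?i = "FOb (SOb \<rho> I) (One C I)"
  have i [simp]: "?i \<in> Ob (PO F I)" by simp
  have "fully_faithful (Hom C X I) (PO F X) (evaluation C F I ?i X)"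
    "essentially_surjective (Hom C X I) (PO F X) (evaluation C F I ?i X)" if [simp]: "X \<in> Obj C" for X
  proof -
    let ?s = "\<lambda>c. NAt (SAr \<rho> I X c) (One C I)"
    have pw: "fully_faithful (Hom C X I) (PO F X) (SOb \<rho> X)" "essentially_surjective (Hom C X I) (PO F X) (SOb \<rho> X)"
      using adjoint_equivalence_pointwise[OF C.cat_valued_representable[OF I] cat_valued_axioms eq, of X] by simp_all
    have fr: "cat_functor (Hom C X I) (PO F X) (SOb \<rho> X)" using \<rho>.SOb_functor[of X] by simp
    have s: "iso_in (PO F X) (FOb (evaluation C F I ?i X) c) (FOb (SOb \<rho> X) c) (?s c)"
      if "c \<in> Ob (Hom C X I)" for c
      using that \<rho>.SAr_simps[of I X c "One C I"] by (simp add: iso_in_iff C.one_hc1)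
    have sn: "?s (Cod (Hom C X I) \<gamma>) \<cdot>[PO F X] FAr (evaluation C F I ?i X) \<gamma> = FAr (SOb \<rho> X) \<gamma> \<cdot>[PO F X] ?s (Dom (Hom C X I) \<gamma>)"
      if "\<gamma> \<in> Ar (Hom C X I)" for \<gamma>
      using that \<rho>.SAr_cell[of I X "One C I" \<gamma>] by (simp add: lwh_def C.one_hc2)
    show "fully_faithful (Hom C X I) (PO F X) (evaluation C F I ?i X)"
      "essentially_surjective (Hom C X I) (PO F X) (evaluation C F I ?i X)"
      by (rule equivalence_transport[OF _ _ fr evaluation_functor s sn pw]; simp)+
  qed
  then have "bi_initial (el C F) (I, ?i)"
    unfolding bi_initial_el_iff[OF I i] by (auto intro: fully_faithful_iso_lifting)
  then show ?thesis using i by blast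
qed

theorem theorem5:
  fixes C :: "('o, 'm, 't) twocat"
    and F :: "('o, 'm, 't, ('m, 't) cat, ('m, 't, 'm, 't) ftr, ('m, 't, 'm, 't) ntr) psf"
    and T :: "'o \<Rightarrow> 'o"
    and Z :: "'o \<Rightarrow> (bool, bool \<times> bool, 'm, 't) ftr"
  assumes "two_category C"
    and "has_tensors C arrow_cat T Z"
    and "normal_pseudo_functor (op2 C) Cat F"
    and "preserves_tensors C arrow_cat T Z F"
  shows "(\<exists>I \<rho>. bi_representation C F I \<rho>) \<longleftrightarrow>
         (\<exists>I \<in> Obj C. \<exists>i \<in> Ob (PO F I). bi_initial (el C F) (I, i))"
proof -
  interpret presheaf_with_arrow_tensors C F T Z
    using assms by (intro presheaf_with_arrow_tensors.intro presheaf.intro presheaf_with_arrow_tensors_axioms.intro)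
  show ?thesis
  proof
    assume "\<exists>I \<rho>. bi_representation C F I \<rho>"
    then obtain I \<rho> where "bi_representation C F I \<rho>" by blast
    then show "\<exists>I \<in> Obj C. \<exists>i \<in> Ob (PO F I). bi_initial (el C F) (I, i)"
      using bi_representation_bi_initial[OF presheaf_axioms] unfolding bi_representation_def by blast
  next
    assume "\<exists>I \<in> Obj C. \<exists>i \<in> Ob (PO F I). bi_initial (el C F) (I, i)"
    then obtain I i where I: "I \<in> Obj C" "i \<in> Ob (PO F I)" and init: "bi_initial (el C F) (I, i)" by blast
    interpret \<rho>: cat_pnt "op2 C" "representable C I" F "yoneda_pnt C F I i"
      by (rule cat_pnt_yoneda[OF presheaf_axioms I])
    have es: "essentially_surjective (Hom C X I) (PO F X) (evaluation C F I i X)"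
      and lift: "iso_lifting (Hom C X I) (PO F X) (evaluation C F I i X)" if "X \<in> Obj C" for X
      using init bi_initial_el_iff[OF I] that by blast+
    interpret \<rho>: pointwise_equivalence "op2 C" "representable C I" F "yoneda_pnt C F I i"
      by unfold_locales (simp_all add: es evaluation_fully_faithful[OF I es lift])
    have "bi_representation C F I (yoneda_pnt C F I i)"
      using \<rho>.adjoint_equivalence I by (simp add: bi_representation_def)
    then show "\<exists>I \<rho>. bi_representation C F I \<rho>" by blast
  qed
qed

end
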